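(* Let $\mathfrak{g}$ be a simple complex Lie algebra of rank $r$ and let $m\in\{1,2,3\}$ be the ratio of the squared length of a long root to that of a short root. Let $\ell$ be a positive integer, and put $\ell_m=0$ if $m\mid\ell$ and $\ell_m=1$ if $m\nmid\ell$. Let the multiset $\mathcal{S}(\mathfrak{g},\ell_m)$ and the integer $\ell_0$ be those given by the table in the context (according to the Lie type of $\mathfrak{g}$ and the divisibility of $\ell$ by $m$), and assume $\ell\ge\ell_0$. Define the formal power series $$F_{\mathfrak{g},\ell_m}(x)=\frac{1}{1-x}\prod_{k\in\mathcal{S}(\mathfrak{g},\ell_m)}\frac{1}{1-x^k},$$ where the product is taken with multiplicity. Then the rank $|C_\ell(\mathfrak{g})|$ of the pre-modular category $\mathcal{C}(\mathfrak{g},q,\ell)$ is the coefficient of $$x^{\ell-\ell_0+\ell_m}$$ in the power series expansion of $F_{\mathfrak{g},\ell_m}(x)$.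
   Context: The rank of a semisimple tensor category is its number of isomorphism classes of simple objects. For $q^2$ a primitive $\ell$th root of unity, $\mathcal{C}(\mathfrak{g},q,\ell)$ denotes the pre-modular category (finite rank ribbon category) obtained as the quotient of the category of tilting modules of Lusztig's integral form of the quantum group $U_q\mathfrak{g}$ by the tensor ideal of negligible morphisms. Its isomorphism classes of simple objects are labeled by the finite set $C_\ell(\mathfrak{g})$ defined as follows, so that its rank is $|C_\ell(\mathfrak{g})|$. Let $P_+$ be the set of dominant weights of $\mathfrak{g}$ (the $\mathbb{N}$-linear combinations of the fundamental weights $\lambda_1,\dots,\lambda_r$, with $0\in\mathbb{N}$), $\rho$ half the sum of the positive roots, $\theta_0$ the longest (highest) root, $\theta_1$ the longest (highest) short root (in the simply-laced case $\theta_1=\theta_0$), and $\langle\cdot,\cdot\rangle$ the Weyl-invariant symmetric bilinear form on the weight lattice normalized so that the squared length of a short root is $2$ (in the simply-laced case all roots have squared length $2$). Then $$C_\ell(\mathfrak{g})=\begin{cases}\{\lambda\in P_+:\langle\lambda+\rho,\theta_0\rangle<\ell\} & \text{if } m\mid\ell,\\ \{\lambda\in P_+:\langle\lambda+\rho,\theta_1\rangle<\ell\} & \text{if } m\nmid\ell.\end{cases}$$ Here $m=1$ for types $A,D,E$, $m=2$ for types $B,C,F_4$, and $m=3$ for type $G_2$. Table of multisets $\mathcal{S}(\mathfrak{g},\ell_m)$ (each of size $r$) and of the integer $\ell_0$, which is the minimal $\ell$ in the given divisibility class for which $C_\ell(\mathfrak{g})$ is nonempty: - $A_r$ ($r\ge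 1$): $\mathcal{S}=[1,\ldots,1]$ ($r$ ones), $\ell_0=r+1$. - $B_r$ ($r\ge 2$), $\ell$ odd: $\mathcal{S}=[1,2,\ldots,2]$ (one $1$ and $r-1$ twos), $\ell_0=2r+1$. - $B_r$ ($r\ge 2$), $\ell$ even: $\mathcal{S}=[2,2,4,\ldots,4]$ (two $2$'s and $r-2$ fours), $\ell_0=4r-2$. - $C_r$ ($r\ge 2$), $\ell$ odd: $\mathcal{S}=[1,2,\ldots,2]$ (one $1$ and $r-1$ twos), $\ell_0=2r+1$. - $C_r$ ($r\ge 2$), $\ell$ even: $\mathcal{S}=[2,\ldots,2]$ ($r$ twos), $\ell_0=2r+2$. - $D_r$ ($r\ge 4$): $\mathcal{S}=[1,1,1,2,\ldots,2]$ (three $1$'s and $r-3$ twos), $\ell_0=2r-2$. - $E_6$: $\mathcal{S}=[1,1,2,2,2,3]$, $\ell_0=12$. - $E_7$: $\mathcal{S}=[1,2,2,2,3,3,4]$, $\ell_0=18$. - $E_8$: $\mathcal{S}=[2,2,3,3,4,4,5,6]$, $\ell_0=30$. - $F_4$, $\ell$ even: $\mathcal{S}=[2,4,4,6]$, $\ell_0=18$. - $F_4$, $\ell$ odd: $\mathcal{S}=[2,2,3,4]$, $\ell_0=13$. - $G_2$, $3\mid\ell$: $\mathcal{S}=[3,6]$, $\ell_0=12$. - $G_2$, $3\nmid\ell$: $\mathcal{S}=[2,3]$, $\ell_0=7$. *)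

theory Defs
  imports
    Complex_Main
    "HOL-Library.Function_Algebras"
    "HOL-Library.Multiset"
    "HOL-Computational_Algebra.Formal_Power_Series"
begin

section \<open>Finite-dimensional simple complex Lie algebras\<close>

class complex_lie_algebra = ab_group_add +
  fixes cscale :: "complex \<Rightarrow> 'a \<Rightarrow> 'a"  (infixr \<open>*\<^sub>C\<close> 75)
    and lie :: "'a \<Rightarrow> 'a \<Rightarrow> 'a"
  assumes cscale_add_right: "a *\<^sub>C (x + y) = a *\<^sub>C x + a *\<^sub>C y"
    and cscale_add_left: "(a + b) *\<^sub>C x = a *\<^sub>C x + b *\<^sub>C x"
    and cscale_cscale: "a *\<^sub>C (b *\<^sub>C x) = (a * b) *\<^sub>C x"
    and cscale_one: "1 *\<^sub>C x = x"
    and lie_add_left: "lie (x + y) z = lie x z + lie y z"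
    and lie_add_right: "lie x (y + z) = lie x y + lie x z"
    and lie_cscale_left: "lie (a *\<^sub>C x) y = a *\<^sub>C lie x y"
    and lie_cscale_right: "lie x (a *\<^sub>C y) = a *\<^sub>C lie x y"
    and lie_self: "lie x x = 0"
    and lie_jacobi: "lie x (lie y z) + lie y (lie z x) + lie z (lie x y) = 0"

global_interpretation lie: vector_space "cscale :: complex \<Rightarrow> 'a \<Rightarrow> 'a::complex_lie_algebra"
  by unfold_locales
    (rule cscale_add_right cscale_add_left cscale_cscale cscale_one)+

definition lie_ideal :: "'a::complex_lie_algebra set \<Rightarrow> bool" where
  "lie_ideal I \<longleftrightarrow> lie.subspace I \<and> (\<forall>x. \<forall>y\<in>I. lie x y \<in> I)"

definition simple_lie_algebra :: "'a::complex_lie_algebra itself \<Rightarrow> bool" where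
  "simple_lie_algebra _ \<longleftrightarrow>
     (\<exists>S :: 'a set. finite S \<and> lie.span S = UNIV) \<and>
     (\<exists>x y :: 'a. lie x y \<noteq> 0) \<and>
     (\<forall>I :: 'a set. lie_ideal I \<longrightarrow> I = {0} \<or> I = UNIV)"


section \<open>Cartan subalgebras, roots and bases\<close>

text \<open>An abelian subalgebra that is its own centralizer and whose adjoint action is
  (simultaneously) diagonalizable.  In a simple complex Lie algebra these are exactly the
  Cartan subalgebras.\<close>

definition cartan_subalgebra :: "'g::complex_lie_algebra set \<Rightarrow> bool" where
  "cartan_subalgebra H \<longleftrightarrow>
     lie.subspace H \<and>
     (\<forall>x. x \<in> H \<longleftrightarrow> (\<forall>h\<in>H. lie h x = 0)) \<and>
     lie.span {x. \<exists>\<phi>. \<forall>h\<in>H. lie h x = \<phi> h *\<^sub>C x} = UNIV"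

text \<open>Linear functionals on \<open>H\<close> are represented by functions on the whole Lie algebra that
  vanish outside \<open>H\<close>, so that equality of functionals is equality of functions and the
  pointwise operations of \<open>Function_Algebras\<close> are those of the dual space.\<close>

definition dual_space :: "'g::complex_lie_algebra set \<Rightarrow> ('g \<Rightarrow> complex) set" where
  "dual_space H = {\<phi>. (\<forall>x\<in>H. \<forall>y\<in>H. \<phi> (x + y) = \<phi> x + \<phi> y) \<and>
                       (\<forall>c. \<forall>x\<in>H. \<phi> (c *\<^sub>C x) = c * \<phi> x) \<and>
                       (\<forall>x. x \<notin> H \<longrightarrow> \<phi> x = 0)}"

definition root_space :: "'g::complex_lie_algebra set \<Rightarrow> ('g \<Rightarrow> complex) \<Rightarrow> 'g set" where
  "root_space H \<phi> = {x. \<forall>h\<in>H. lie h x = \<phi> h *\<^sub>C x}"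

definition roots :: "'g::complex_lie_algebra set \<Rightarrow> ('g \<Rightarrow> complex) set" where
  "roots H = {\<phi> \<in> dual_space H. \<phi> \<noteq> 0 \<and> root_space H \<phi> \<noteq> {0}}"

definition int_comb :: "nat \<Rightarrow> (nat \<Rightarrow> int) \<Rightarrow> (nat \<Rightarrow> 'g \<Rightarrow> complex) \<Rightarrow> 'g \<Rightarrow> complex" where
  "int_comb r c \<alpha> = (\<lambda>x. \<Sum>i=1..r. of_int (c i) * \<alpha> i x)"

definition nonneg_cone :: "nat \<Rightarrow> (nat \<Rightarrow> 'g \<Rightarrow> complex) \<Rightarrow> ('g \<Rightarrow> complex) set" where
  "nonneg_cone r \<alpha> = {int_comb r c \<alpha> | c. \<forall>i\<in>{1..r}. 0 \<le> c i}"

text \<open>The auxiliary choices on which the roots and weights depend: a Cartan subalgebra, and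
  simple roots \<open>\<alpha>\<^sub>1, \<dots>, \<alpha>\<^sub>r\<close> together with the corresponding coroots.  Entries with index
  outside \<open>{1..r}\<close> are irrelevant.\<close>

record 'g root_frame =
  rnk :: nat
  csa :: "'g set"
  sroot :: "nat \<Rightarrow> 'g \<Rightarrow> complex"
  scoroot :: "nat \<Rightarrow> 'g"

definition root_base :: "'g::complex_lie_algebra root_frame \<Rightarrow> bool" where
  "root_base D \<longleftrightarrow>
     (\<forall>i\<in>{1..rnk D}. sroot D i \<in> roots (csa D)) \<and>
     (\<forall>c :: nat \<Rightarrow> complex. (\<forall>h. (\<Sum>i=1..rnk D. c i * sroot D i h) = 0)
        \<longrightarrow> (\<forall>i\<in>{1..rnk D}. c i = 0)) \<and>
     (\<forall>\<beta>\<in>roots (csa D). \<beta> \<in> nonneg_cone (rnk D) (sroot D) \<or>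
                          - \<beta> \<in> nonneg_cone (rnk D) (sroot D))"

text \<open>The coroot of \<open>\<alpha>\<close> is the unique element \<open>h\<close> of the line \<open>[\<gg>\<^sub>\<alpha>, \<gg>\<^sub>-\<^sub>\<alpha>]\<close>
  with \<open>\<alpha>(h) = 2\<close>.\<close>

definition is_coroot :: "'g::complex_lie_algebra set \<Rightarrow> ('g \<Rightarrow> complex) \<Rightarrow> 'g \<Rightarrow> bool" where
  "is_coroot H \<alpha> h \<longleftrightarrow>
     h \<in> H \<and> \<alpha> h = 2 \<and> (\<exists>x\<in>root_space H \<alpha>. \<exists>y\<in>root_space H (- \<alpha>). h = lie x y)"

definition simple_root_frame :: "'g::complex_lie_algebra root_frame \<Rightarrow> bool" where
  "simple_root_frame D \<longleftrightarrow>
     cartan_subalgebra (csa D) \<and> root_base D \<and>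
     (\<forall>i\<in>{1..rnk D}. is_coroot (csa D) (sroot D i) (scoroot D i))"


section \<open>Lie types\<close>

datatype lie_type = TypeA nat | TypeB nat | TypeC nat | TypeD nat
  | TypeE6 | TypeE7 | TypeE8 | TypeF4 | TypeG2

fun valid_type :: "lie_type \<Rightarrow> bool" where
  "valid_type (TypeA r) \<longleftrightarrow> 1 \<le> r"
| "valid_type (TypeB r) \<longleftrightarrow> 2 \<le> r"
| "valid_type (TypeC r) \<longleftrightarrow> 2 \<le> r"
| "valid_type (TypeD r) \<longleftrightarrow> 4 \<le> r"
| "valid_type TypeE6 \<longleftrightarrow> True"
| "valid_type TypeE7 \<longleftrightarrow> True"
| "valid_type TypeE8 \<longleftrightarrow> True"
| "valid_type TypeF4 \<longleftrightarrow> True"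
| "valid_type TypeG2 \<longleftrightarrow> True"

fun type_rank :: "lie_type \<Rightarrow> nat" where
  "type_rank (TypeA r) = r"
| "type_rank (TypeB r) = r"
| "type_rank (TypeC r) = r"
| "type_rank (TypeD r) = r"
| "type_rank TypeE6 = 6"
| "type_rank TypeE7 = 7"
| "type_rank TypeE8 = 8"
| "type_rank TypeF4 = 4"
| "type_rank TypeG2 = 2"

definition chain_edges :: "nat \<Rightarrow> nat \<Rightarrow> nat set set" where
  "chain_edges a b = {{i, i + 1} | i. a \<le> i \<and> i < b}"

text \<open>Vertices are numbered as in Bourbaki's plates.\<close>

fun dynkin_edges :: "lie_type \<Rightarrow> nat set set" where
  "dynkin_edges (TypeA r) = chain_edges 1 r"
| "dynkin_edges (TypeB r) = chain_edges 1 r"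
| "dynkin_edges (TypeC r) = chain_edges 1 r"
| "dynkin_edges (TypeD r) = chain_edges 1 (r - 1) \<union> {{r - 2, r}}"
| "dynkin_edges TypeE6 = {{1, 3}, {2, 4}} \<union> chain_edges 3 6"
| "dynkin_edges TypeE7 = {{1, 3}, {2, 4}} \<union> chain_edges 3 7"
| "dynkin_edges TypeE8 = {{1, 3}, {2, 4}} \<union> chain_edges 3 8"
| "dynkin_edges TypeF4 = chain_edges 1 4"
| "dynkin_edges TypeG2 = chain_edges 1 2"

text \<open>The multiplicity of the bond if \<open>\<alpha>\<^sub>i\<close> is long and its neighbour \<open>\<alpha>\<^sub>j\<close> is
  short, and \<open>1\<close> for all other pairs of neighbours.  The short simple roots are \<open>\<alpha>\<^sub>r\<close> for \<open>B\<^sub>r\<close>, all but \<open>\<alpha>\<^sub>r\<close> for \<open>C\<^sub>r\<close>,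
  \<open>\<alpha>\<^sub>3\<close> and \<open>\<alpha>\<^sub>4\<close> for \<open>F\<^sub>4\<close>, and \<open>\<alpha>\<^sub>1\<close> for \<open>G\<^sub>2\<close>.\<close>

fun bond :: "lie_type \<Rightarrow> nat \<Rightarrow> nat \<Rightarrow> int" where
  "bond (TypeB r) i j = (if i + 1 = r \<and> j = r then 2 else 1)"
| "bond (TypeC r) i j = (if i = r \<and> j + 1 = r then 2 else 1)"
| "bond TypeF4 i j = (if i = 2 \<and> j = 3 then 2 else 1)"
| "bond TypeG2 i j = (if i = 2 \<and> j = 1 then 3 else 1)"
| "bond _ i j = 1"

text \<open>\<open>cartan_entry X i j\<close> is \<open>\<alpha>\<^sub>i\<close> evaluated at the coroot of \<open>\<alpha>\<^sub>j\<close>.\<close>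

definition cartan_entry :: "lie_type \<Rightarrow> nat \<Rightarrow> nat \<Rightarrow> int" where
  "cartan_entry X i j =
     (if i = j then 2 else if {i, j} \<in> dynkin_edges X then - bond X i j else 0)"

definition has_type :: "'g::complex_lie_algebra root_frame \<Rightarrow> lie_type \<Rightarrow> bool" where
  "has_type D X \<longleftrightarrow>
     rnk D = type_rank X \<and>
     (\<forall>i\<in>{1..rnk D}. \<forall>j\<in>{1..rnk D}.
        sroot D i (scoroot D j) = of_int (cartan_entry X i j))"


section \<open>Weights and the normalized form\<close>

definition positive_roots :: "'g::complex_lie_algebra root_frame \<Rightarrow> ('g \<Rightarrow> complex) set" where
  "positive_roots D = roots (csa D) \<inter> nonneg_cone (rnk D) (sroot D)"

definition weyl_vector :: "'g::complex_lie_algebra root_frame \<Rightarrow> 'g \<Rightarrow> complex" where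
  "weyl_vector D = (\<lambda>x. (\<Sum>\<beta>\<in>positive_roots D. \<beta> x) / 2)"

definition fundamental_weight :: "'g::complex_lie_algebra root_frame \<Rightarrow> nat \<Rightarrow> 'g \<Rightarrow> complex" where
  "fundamental_weight D i =
     (THE \<omega>. \<omega> \<in> dual_space (csa D) \<and>
             (\<forall>j\<in>{1..rnk D}. \<omega> (scoroot D j) = (if i = j then 1 else 0)))"

definition weight_lattice :: "'g::complex_lie_algebra root_frame \<Rightarrow> ('g \<Rightarrow> complex) set" where
  "weight_lattice D = {int_comb (rnk D) c (fundamental_weight D) | c. True}"

definition dominant_weights :: "'g::complex_lie_algebra root_frame \<Rightarrow> ('g \<Rightarrow> complex) set" where
  "dominant_weights D = nonneg_cone (rnk D) (fundamental_weight D)"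

definition simple_reflection ::
  "'g::complex_lie_algebra root_frame \<Rightarrow> nat \<Rightarrow> ('g \<Rightarrow> complex) \<Rightarrow> 'g \<Rightarrow> complex" where
  "simple_reflection D i \<mu> = (\<lambda>x. \<mu> x - \<mu> (scoroot D i) * sroot D i x)"

inductive_set weyl_group ::
  "'g::complex_lie_algebra root_frame \<Rightarrow> (('g \<Rightarrow> complex) \<Rightarrow> 'g \<Rightarrow> complex) set"
  for D where
  weyl_id: "id \<in> weyl_group D"
| weyl_step: "w \<in> weyl_group D \<Longrightarrow> i \<in> {1..rnk D} \<Longrightarrow> simple_reflection D i \<circ> w \<in> weyl_group D"

type_synonym 'g weight_form = "('g \<Rightarrow> complex) \<Rightarrow> ('g \<Rightarrow> complex) \<Rightarrow> real"

text \<open>When all roots have the same length, every root is both short and long.\<close>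

definition short_roots ::
  "'g::complex_lie_algebra root_frame \<Rightarrow> 'g weight_form \<Rightarrow> ('g \<Rightarrow> complex) set" where
  "short_roots D b = {\<alpha> \<in> roots (csa D). \<forall>\<beta>\<in>roots (csa D). b \<alpha> \<alpha> \<le> b \<beta> \<beta>}"

definition long_roots ::
  "'g::complex_lie_algebra root_frame \<Rightarrow> 'g weight_form \<Rightarrow> ('g \<Rightarrow> complex) set" where
  "long_roots D b = {\<alpha> \<in> roots (csa D). \<forall>\<beta>\<in>roots (csa D). b \<beta> \<beta> \<le> b \<alpha> \<alpha>}"

text \<open>Invariance and normalization determine the form uniquely on the weight lattice; its
  values elsewhere are irrelevant.\<close>

definition normalized_form ::
  "'g::complex_lie_algebra root_frame \<Rightarrow> 'g weight_form \<Rightarrow> bool" where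
  "normalized_form D b \<longleftrightarrow>
     (\<forall>\<kappa>\<in>weight_lattice D. \<forall>\<mu>\<in>weight_lattice D. \<forall>\<nu>\<in>weight_lattice D.
        b (\<kappa> + \<mu>) \<nu> = b \<kappa> \<nu> + b \<mu> \<nu>) \<and>
     (\<forall>\<kappa>\<in>weight_lattice D. \<forall>\<mu>\<in>weight_lattice D. b \<kappa> \<mu> = b \<mu> \<kappa>) \<and>
     (\<forall>w\<in>weyl_group D. \<forall>\<kappa>\<in>weight_lattice D. \<forall>\<mu>\<in>weight_lattice D.
        b (w \<kappa>) (w \<mu>) = b \<kappa> \<mu>) \<and>
     (\<forall>\<alpha>\<in>short_roots D b. b \<alpha> \<alpha> = 2)"

definition length_ratio :: "'g::complex_lie_algebra root_frame \<Rightarrow> 'g weight_form \<Rightarrow> nat" where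
  "length_ratio D b =
     (THE m. \<exists>\<alpha>\<in>long_roots D b. \<exists>\<beta>\<in>short_roots D b. b \<alpha> \<alpha> = of_nat m * b \<beta> \<beta>)"

definition highest_root :: "'g::complex_lie_algebra root_frame \<Rightarrow> 'g \<Rightarrow> complex" where
  "highest_root D =
     (THE \<theta>. \<theta> \<in> roots (csa D) \<and>
             (\<forall>\<beta>\<in>roots (csa D). \<theta> - \<beta> \<in> nonneg_cone (rnk D) (sroot D)))"

definition highest_short_root ::
  "'g::complex_lie_algebra root_frame \<Rightarrow> 'g weight_form \<Rightarrow> 'g \<Rightarrow> complex" where
  "highest_short_root D b =
     (THE \<theta>. \<theta> \<in> short_roots D b \<and>
             (\<forall>\<beta>\<in>short_roots D b. \<theta> - \<beta> \<in> nonneg_cone (rnk D) (sroot D)))"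

text \<open>The labels of the simple objects of \<open>\<C>(\<gg>, q, \<ell>)\<close>.\<close>

definition simple_labels ::
  "'g::complex_lie_algebra root_frame \<Rightarrow> 'g weight_form \<Rightarrow> nat \<Rightarrow> ('g \<Rightarrow> complex) set" where
  "simple_labels D b l =
     (if length_ratio D b dvd l
      then {\<mu> \<in> dominant_weights D. b (\<mu> + weyl_vector D) (highest_root D) < of_nat l}
      else {\<mu> \<in> dominant_weights D. b (\<mu> + weyl_vector D) (highest_short_root D b) < of_nat l})"


section \<open>The generating function\<close>

text \<open>In the following two tables the second argument is \<open>\<ell>\<^sub>m\<close>: \<open>0\<close> if \<open>m\<close> divides \<open>\<ell>\<close>
  and \<open>1\<close> otherwise.  For the simply-laced types only \<open>0\<close> occurs.\<close>

fun exponents_table :: "lie_type \<Rightarrow> nat \<Rightarrow> nat multiset" where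
  "exponents_table (TypeA r) _ = replicate_mset r 1"
| "exponents_table (TypeB r) e =
     (if e = 0 then {#2, 2#} + replicate_mset (r - 2) 4 else {#1#} + replicate_mset (r - 1) 2)"
| "exponents_table (TypeC r) e =
     (if e = 0 then replicate_mset r 2 else {#1#} + replicate_mset (r - 1) 2)"
| "exponents_table (TypeD r) _ = {#1, 1, 1#} + replicate_mset (r - 3) 2"
| "exponents_table TypeE6 _ = {#1, 1, 2, 2, 2, 3#}"
| "exponents_table TypeE7 _ = {#1, 2, 2, 2, 3, 3, 4#}"
| "exponents_table TypeE8 _ = {#2, 2, 3, 3, 4, 4, 5, 6#}"
| "exponents_table TypeF4 e = (if e = 0 then {#2, 4, 4, 6#} else {#2, 2, 3, 4#})"
| "exponents_table TypeG2 e = (if e = 0 then {#3, 6#} else {#2, 3#})"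

fun min_level :: "lie_type \<Rightarrow> nat \<Rightarrow> nat" where
  "min_level (TypeA r) _ = r + 1"
| "min_level (TypeB r) e = (if e = 0 then 4 * r - 2 else 2 * r + 1)"
| "min_level (TypeC r) e = (if e = 0 then 2 * r + 2 else 2 * r + 1)"
| "min_level (TypeD r) _ = 2 * r - 2"
| "min_level TypeE6 _ = 12"
| "min_level TypeE7 _ = 18"
| "min_level TypeE8 _ = 30"
| "min_level TypeF4 e = (if e = 0 then 18 else 13)"
| "min_level TypeG2 e = (if e = 0 then 12 else 7)"

definition rank_series :: "lie_type \<Rightarrow> nat \<Rightarrow> rat fps" where
  "rank_series X e =
     1 / (1 - fps_X) * (\<Prod>k\<in>#exponents_table X e. 1 / (1 - fps_X ^ k))"

end

theory Submission
  imports Defs "Jordan_Normal_Form.Determinant"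
begin

text \<open>For every simple root the given coroot lies in an \<open>sl\<^sub>2\<close>-triple, so finite-dimensionality alone shows that
  the set of roots is stable under the simple reflections and that no proper multiple of a simple
  root is a root.  Together with positive definiteness of the form attached to the Cartan matrix this
  forces every root to be conjugate to a simple root, hence to have squared length 2 or \<open>2m\<close>, and to
  lie below a dominant root of the same length.  Two vectors \<open>c\<close>, \<open>\<theta>\<close> of the same squared length coincide
  as soon as \<open>(c, \<theta>) \<ge> (\<theta>, \<theta>)\<close>; applied to the tabulated \<open>\<theta>\<close>, where \<open>(c, \<theta>)\<close> involves only the
  coefficients of \<open>c\<close> at the neighbours of the affine node, this identifies the highest root and the
  highest short root.  Since \<open>\<rho>\<close> is the sum of the fundamental weights, the labels are the
  \<open>a \<in> \<nat>\<^sup>r\<close> with \<open>\<Sum> (a\<^sub>i + 1) w\<^sub>i < \<ell>\<close>, where the \<open>w\<^sub>i\<close> are the coefficients of \<open>\<theta>\<close>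
  scaled by half squared root lengths, that is, the entries of the table; they are counted by the series.\<close>


section \<open>Lie algebras and weights\<close>

text \<open>Coroots, and with them sl2-triples, are given for the simple roots only, and neither a
  Killing form nor complete reducibility enters: reflections come from explicit strings of weight
  vectors. Lengths are measured by the form built on the Cartan matrix, because \<open>b\<close> is
  not known to be definite on the root lattice before its scale factor has been determined. Besides
  finite-dimensionality, simplicity provides a trivial centre: it makes the simple coroots span the
  Cartan subalgebra, so that a functional is determined by its values on them, as the definite
  description of the fundamental weights demands. The constants of the table come from divisibility.
  If m divides \<ell>, all products of weights with the highest root are multiples of m, so a strict
  inequality leaves a gap of m. Otherwise the gap is 1, but the number following \<langle>\<rho>,
  \<theta>\<rangle> is a multiple of m and hence not an admissible level; the surplus of one is the
  \<open>l\<^sub>m\<close> in the exponent.\<close>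

lemma lie_zero_left [simp]: "lie 0 (x::'a::complex_lie_algebra) = 0"
  using lie_cscale_left[of 0 "0::'a" x] by (simp add: lie.scale_zero_left)

lemma lie_zero_right [simp]: "lie (x::'a::complex_lie_algebra) 0 = 0"
  using lie_cscale_right[of x 0 "0::'a"] by (simp add: lie.scale_zero_left)

lemma lie_minus_left [simp]: "lie (- x) (y::'a::complex_lie_algebra) = - lie x y"
  using lie_add_left[of "- x" x y] by (simp add: eq_neg_iff_add_eq_0)

lemma lie_minus_right [simp]: "lie x (- y) = - lie x (y::'a::complex_lie_algebra)"
  using lie_add_right[of x "- y" y] by (simp add: eq_neg_iff_add_eq_0)

lemma lie_anticomm: "lie y x = - lie x (y::'a::complex_lie_algebra)"
proof -
  have "lie x y + lie y x = lie (x + y) (x + y)"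
    by (simp add: lie_add_left lie_add_right lie_self[of x] lie_self[of y])
  also have "\<dots> = 0" by (rule lie_self)
  finally show ?thesis by (rule minus_unique[symmetric])
qed

lemma lie_derivation:
  "lie h (lie x y) = lie (lie h x) y + lie x (lie h (y::'a::complex_lie_algebra))"
proof -
  have "lie h (lie x y) + lie x (lie y h) + lie y (lie h x) = 0" by (rule lie_jacobi)
  moreover have "lie x (lie y h) = - lie x (lie h y)" by (simp add: lie_anticomm[of y h])
  moreover have "lie y (lie h x) = - lie (lie h x) y" by (rule lie_anticomm)
  ultimately show ?thesis by (simp add: algebra_simps)
qed

lemma lie_sum_right: "lie h (sum v F) = (\<Sum>i\<in>F. lie h (v i :: 'a::complex_lie_algebra))"
  by (induction F rule: infinite_finite_induct) (auto simp: lie_add_right)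

definition weights :: "'g::complex_lie_algebra set \<Rightarrow> ('g \<Rightarrow> complex) set" where
  "weights H = {\<phi> \<in> dual_space H. root_space H \<phi> \<noteq> {0}}"

lemma roots_eq_weights: "roots H = weights H - {0}"
  by (auto simp: roots_def weights_def)

lemma zero_in_root_space [simp]: "0 \<in> root_space H \<phi>"
  by (simp add: root_space_def lie.scale_zero_right)

lemma weightsI: "\<phi> \<in> dual_space H \<Longrightarrow> v \<in> root_space H \<phi> \<Longrightarrow> v \<noteq> 0 \<Longrightarrow> \<phi> \<in> weights H"
  by (auto simp: weights_def)

lemma weightsE:
  assumes "\<phi> \<in> weights H"
  obtains v where "v \<in> root_space H \<phi>" "v \<noteq> 0"
  using assms zero_in_root_space[of H \<phi>] unfolding weights_def by blast

lemma dual_space_eqI: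
  assumes "\<phi> \<in> dual_space H" "\<psi> \<in> dual_space H" "\<And>h. h \<in> H \<Longrightarrow> \<phi> h = \<psi> h"
  shows "\<phi> = \<psi>"
proof
  fix x show "\<phi> x = \<psi> x" using assms by (cases "x \<in> H") (auto simp: dual_space_def)
qed

lemma dual_space_sum:
  assumes "\<And>i. i \<in> F \<Longrightarrow> \<alpha> i \<in> dual_space H"
  shows "(\<lambda>x. \<Sum>i\<in>F. c i * \<alpha> i x) \<in> dual_space H"
  using assms
  by (auto simp: dual_space_def distrib_left sum.distrib sum_distrib_left algebra_simps)

lemma dual_space_add_mult:
  assumes "\<phi> \<in> dual_space H" "\<psi> \<in> dual_space H"
  shows "(\<lambda>x. \<phi> x + c * \<psi> x) \<in> dual_space H"
  using assms by (auto simp: dual_space_def algebra_simps)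

lemma root_space_lie:
  assumes "x \<in> root_space H \<phi>" "y \<in> root_space H \<psi>"
  shows "lie x y \<in> root_space H (\<lambda>h. \<phi> h + \<psi> h)"
  using assms
  by (auto simp: root_space_def lie_derivation lie_cscale_left lie_cscale_right cscale_add_left)

text \<open>Apply \<open>ad h\<close> to the relation, for an \<open>h\<close> that separates
  \<open>\<phi>'\<close> from the new functional \<open>\<psi>\<close>, and subtract
  \<open>\<psi> h\<close> times the relation. The term at \<open>\<psi>\<close> disappears, and the
  induction hypothesis kills the vector at \<open>\<phi>'\<close>, whose new coefficient
  \<open>\<phi>' h - \<psi> h\<close> is not zero.\<close>

lemma root_space_independent:
  assumes "finite F" "F \<subseteq> dual_space H" "\<And>\<phi>. \<phi> \<in> F \<Longrightarrow> v \<phi> \<in> root_space H \<phi>"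
    and "(\<Sum>\<phi>\<in>F. v \<phi>) = 0" "\<phi> \<in> F"
  shows "v \<phi> = 0"
  using assms
proof (induction F arbitrary: v \<phi> rule: finite_induct)
  case (insert \<psi> F)
  have F0: "v \<phi>' = 0" if "\<phi>' \<in> F" for \<phi>'
  proof -
    have "\<phi>' \<noteq> \<psi>" using that insert.hyps(2) by blast
    moreover have "\<phi>' \<in> dual_space H" "\<psi> \<in> dual_space H" using insert.prems(1) that by auto
    ultimately have "\<exists>h\<in>H. \<phi>' h \<noteq> \<psi> h" by (metis dual_space_eqI)
    then obtain h where h: "h \<in> H" "\<phi>' h \<noteq> \<psi> h" by auto
    have s: "v \<psi> + (\<Sum>\<phi>\<in>F. v \<phi>) = 0" using insert.hyps insert.prems(3) by simp
    have "lie h (v \<psi> + (\<Sum>\<phi>\<in>F. v \<phi>)) = 0" using s by simp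
    then have "\<psi> h *\<^sub>C v \<psi> + (\<Sum>\<phi>\<in>F. \<phi> h *\<^sub>C v \<phi>) = 0"
      using insert.prems(2) h(1) by (simp add: lie_add_right lie_sum_right root_space_def)
    moreover have "\<psi> h *\<^sub>C v \<psi> = - (\<Sum>\<phi>\<in>F. \<psi> h *\<^sub>C v \<phi>)"
      using s by (simp add: eq_neg_iff_add_eq_0 lie.scale_sum_right[symmetric]
          cscale_add_right[symmetric] lie.scale_zero_right)
    ultimately have "(\<Sum>\<phi>\<in>F. (\<phi> h - \<psi> h) *\<^sub>C v \<phi>) = 0"
      by (simp add: lie.scale_left_diff_distrib sum_subtractf)
    moreover have "(\<phi> h - \<psi> h) *\<^sub>C v \<phi> \<in> root_space H \<phi>" if "\<phi> \<in> F" for \<phi>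
      using insert.prems(2)[of \<phi>] that
      by (auto simp: root_space_def lie_cscale_right cscale_cscale mult.commute)
    ultimately have "(\<phi>' h - \<psi> h) *\<^sub>C v \<phi>' = 0"
      using insert.IH[of "\<lambda>\<phi>. (\<phi> h - \<psi> h) *\<^sub>C v \<phi>" \<phi>'] insert.prems(1) that by blast
    then show ?thesis using h(2) by (simp add: lie.scale_eq_0_iff)
  qed
  then have "(\<Sum>\<phi>\<in>F. v \<phi>) = 0" by simp
  then have "v \<psi> = 0" using insert.hyps insert.prems(3) by simp
  then show ?case using F0 insert.prems(4) by auto
qed simp

locale finite_lie_cartan =
  fixes H :: "'g::complex_lie_algebra set"
  assumes cartan: "cartan_subalgebra H"
    and finite_dim: "\<exists>S :: 'g set. finite S \<and> lie.span S = UNIV"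
begin

lemma subspace_H: "lie.subspace H"
  using cartan unfolding cartan_subalgebra_def by blast

lemma root_space_zero: "root_space H (\<lambda>_. 0) = H"
  using cartan unfolding cartan_subalgebra_def root_space_def lie.scale_zero_left by blast

text \<open>One nonzero vector from each weight space gives an independent family, whose size is
  bounded by that of a finite spanning set.\<close>

lemma finite_weights: "finite (weights H)"
proof -
  have "\<exists>v. \<forall>\<phi>\<in>weights H. v \<phi> \<in> root_space H \<phi> \<and> v \<phi> \<noteq> 0"
    by (rule bchoice) (meson weightsE)
  then obtain v where v: "\<And>\<phi>. \<phi> \<in> weights H \<Longrightarrow> v \<phi> \<in> root_space H \<phi>"
      "\<And>\<phi>. \<phi> \<in> weights H \<Longrightarrow> v \<phi> \<noteq> 0" by blast
  have inj: "inj_on v (weights H)"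
  proof (rule inj_onI)
    fix \<phi> \<psi> assume a: "\<phi> \<in> weights H" "\<psi> \<in> weights H" "v \<phi> = v \<psi>"
    have "\<phi> h = \<psi> h" if "h \<in> H" for h
    proof -
      have "\<phi> h *\<^sub>C v \<phi> = \<psi> h *\<^sub>C v \<phi>"
        using v(1)[OF a(1)] v(1)[OF a(2)] a(3) that by (auto simp: root_space_def)
      then show ?thesis using v(2)[OF a(1)] by (simp add: lie.scale_cancel_right)
    qed
    then show "\<phi> = \<psi>" using a by (intro dual_space_eqI[of _ H]) (auto simp: weights_def)
  qed
  have "lie.independent (v ` weights H)"
  proof
    assume "lie.dependent (v ` weights H)"
    then obtain S u w where S: "finite S" "S \<subseteq> v ` weights H" "w \<in> S" "u w \<noteq> 0"
        "(\<Sum>z\<in>S. u z *\<^sub>C z) = 0"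
      unfolding lie.dependent_explicit by blast
    obtain F where F: "F \<subseteq> weights H" "S = v ` F" "finite F"
      by (meson S(1,2) finite_subset_image)
    have injF: "inj_on v F" using inj F(1) inj_on_subset by blast
    have "(\<Sum>\<phi>\<in>F. u (v \<phi>) *\<^sub>C v \<phi>) = 0"
      using S(5) injF by (simp add: F(2) sum.reindex)
    moreover obtain \<phi> where \<phi>: "\<phi> \<in> F" "w = v \<phi>" using S(3) F(2) by blast
    ultimately have "u (v \<phi>) *\<^sub>C v \<phi> = 0"
      using F v(1) by (intro root_space_independent[of F H "\<lambda>\<phi>. u (v \<phi>) *\<^sub>C v \<phi>"])
        (auto simp: weights_def root_space_def lie_cscale_right cscale_cscale mult.commute subset_iff)
    then show False using S(4) \<phi> F(1) v(2) by (auto simp: lie.scale_eq_0_iff)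
  qed
  moreover obtain T :: "'g set" where "finite T" "lie.span T = UNIV" using finite_dim by blast
  ultimately have "finite (v ` weights H)" using lie.independent_span_bound by blast
  then show ?thesis using finite_imageD[OF _ inj] by blast
qed

end

section \<open>Weight strings of an sl2-triple\<close>

locale sl2_triple = finite_lie_cartan H for H :: "'g::complex_lie_algebra set" +
  fixes \<alpha> :: "'g \<Rightarrow> complex" and x y h :: 'g
  assumes \<alpha>_dual: "\<alpha> \<in> dual_space H"
    and x_root: "x \<in> root_space H \<alpha>"
    and y_root: "y \<in> root_space H (- \<alpha>)"
    and h_eq: "lie x y = h"
    and h_in: "h \<in> H"
    and \<alpha>_h: "\<alpha> h = 2"
begin

text \<open>By this symmetry each statement on raising by \<open>x\<close> also serves for lowering
  by \<open>y\<close>.\<close>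

lemma opposite: "sl2_triple H (- \<alpha>) y x (- h)"
proof unfold_locales
  show "- \<alpha> \<in> dual_space H" using \<alpha>_dual by (auto simp: dual_space_def)
  show "lie y x = - h" unfolding h_eq[symmetric] by (rule lie_anticomm)
  show "- h \<in> H" using subspace_H h_in by (rule lie.subspace_neg)
  have "\<alpha> (- 1 *\<^sub>C h) = - 1 * \<alpha> h" using h_in \<alpha>_dual unfolding dual_space_def by blast
  then show "(- \<alpha>) (- h) = 2" using \<alpha>_h by (simp add: lie.scale_minus_left cscale_one)
qed (use x_root y_root in simp_all)

lemma raise_root_space:
  assumes "z \<in> root_space H \<beta>"
  shows "(lie x ^^ n) z \<in> root_space H (\<lambda>u. \<beta> u + of_nat n * \<alpha> u)"
proof (induction n)
  case (Suc n)
  have "lie x ((lie x ^^ n) z) \<in> root_space H (\<lambda>u. \<alpha> u + (\<beta> u + of_nat n * \<alpha> u))"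
    by (rule root_space_lie[OF x_root Suc])
  then show ?case by (simp add: algebra_simps)
qed (use assms in simp)

lemma raise_weights:
  assumes "\<beta> \<in> dual_space H" "z \<in> root_space H \<beta>" "(lie x ^^ n) z \<noteq> 0"
  shows "(\<lambda>u. \<beta> u + of_nat n * \<alpha> u) \<in> weights H"
  using assms raise_root_space[OF assms(2)] dual_space_add_mult[OF assms(1) \<alpha>_dual]
  by (intro weightsI) auto

text \<open>Otherwise all \<beta> + n\<alpha> would be weights; their values at \<open>h\<close>
  differ, as \<alpha>(h) = 2.\<close>

lemma raise_nilpotent:
  assumes "\<beta> \<in> dual_space H" "z \<in> root_space H \<beta>"
  shows "\<exists>n. (lie x ^^ n) z = 0"
proof (rule ccontr)
  assume "\<nexists>n. (lie x ^^ n) z = 0"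
  then have "range (\<lambda>n u. \<beta> u + of_nat n * \<alpha> u) \<subseteq> weights H"
    using raise_weights[OF assms] by blast
  moreover have "inj (\<lambda>(n::nat) u. \<beta> u + of_nat n * \<alpha> u)"
  proof (rule injI)
    fix m n :: nat
    assume "(\<lambda>u. \<beta> u + of_nat m * \<alpha> u) = (\<lambda>u. \<beta> u + of_nat n * \<alpha> u)"
    from fun_cong[OF this, of h] show "m = n" using \<alpha>_h by simp
  qed
  ultimately show False using finite_weights finite_subset finite_imageD infinite_UNIV_nat by blast
qed

lemma h_weight: "z \<in> root_space H \<beta> \<Longrightarrow> lie h z = \<beta> h *\<^sub>C z"
  using h_in by (simp add: root_space_def)

lemma lower_raise: "lie y (lie x z) = lie x (lie y z) - lie h z"
  using lie_derivation[of x y z] by (simp add: h_eq algebra_simps)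

text \<open>The commutation rule of sl2. The hypothesis \<open>lie x (lie y z) = 0\<close> is weaker
  than \<open>lie y z = 0\<close>, and \<open>root_space_\<alpha>\<close> and
  \<open>root_space_multiple\<close> rely on that: there \<open>lie y z\<close> may be a nonzero
  element commuting with \<open>x\<close>.\<close>

lemma lower_raise_power:
  assumes "z \<in> root_space H \<beta>" "lie x (lie y z) = 0"
  shows "lie y ((lie x ^^ Suc n) z) = - (of_nat (Suc n) * (\<beta> h + of_nat n)) *\<^sub>C (lie x ^^ n) z"
proof (induction n)
  case 0
  then show ?case using assms h_weight[OF assms(1)] lower_raise[of z]
    by (simp add: lie.scale_minus_left)
next
  case (Suc n)
  let ?z = "(lie x ^^ Suc n) z"
  have "lie y (lie x ?z) = lie x (lie y ?z) - lie h ?z" by (rule lower_raise)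
  also have "lie x (lie y ?z) = - (of_nat (Suc n) * (\<beta> h + of_nat n)) *\<^sub>C ?z"
    unfolding Suc.IH by (simp add: lie_cscale_right)
  also have "lie h ?z = (\<beta> h + of_nat (Suc n) * 2) *\<^sub>C ?z"
    using h_weight[OF raise_root_space[OF assms(1), of "Suc n"]] \<alpha>_h by simp
  finally have "lie y (lie x ?z) =
      (- (of_nat (Suc n) * (\<beta> h + of_nat n)) - (\<beta> h + of_nat (Suc n) * 2)) *\<^sub>C ?z"
    by (simp only: lie.scale_left_diff_distrib)
  also have "- (of_nat (Suc n) * (\<beta> h + of_nat n)) - (\<beta> h + of_nat (Suc n) * 2) =
      - (of_nat (Suc (Suc n)) * (\<beta> h + of_nat (Suc n)))"
    by (simp add: algebra_simps)
  finally show ?case by simp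
qed

text \<open>Otherwise the scalars in \<open>lower_raise_power\<close> never vanish and \<open>ad x\<close> is not nilpotent at \<open>z\<close>.\<close>

lemma positive_weight_vanish:
  assumes "\<beta> \<in> dual_space H" "z \<in> root_space H \<beta>" "lie x (lie y z) = 0" "\<beta> h = of_nat (Suc m)"
  shows "z = 0"
proof -
  have c: "of_nat (Suc n) * (\<beta> h + of_nat n) \<noteq> (0::complex)" for n
    using assms(4) by (simp only: of_nat_add[symmetric] of_nat_mult[symmetric] of_nat_eq_0_iff) simp
  have "z = 0" if "(lie x ^^ n) z = 0" for n
    using that
  proof (induction n)
    case (Suc n)
    have "- (of_nat (Suc n) * (\<beta> h + of_nat n)) *\<^sub>C (lie x ^^ n) z = 0"
      unfolding lower_raise_power[OF assms(2,3), symmetric] Suc.prems by simp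
    then show ?case using c[of n] Suc.IH by (simp only: lie.scale_eq_0_iff neg_equal_0_iff_equal) simp
  qed simp
  then show ?thesis using raise_nilpotent[OF assms(1,2)] by blast
qed

text \<open>Correct \<open>z\<close> by a multiple of \<open>x\<close> until its bracket with
  \<open>y\<close> lies in the kernel of \<alpha>, hence commutes with \<open>x\<close>. As
  \<alpha>(h) = 2 is positive, \<open>positive_weight_vanish\<close> makes the corrected vector
  zero.\<close>

lemma root_space_\<alpha>:
  assumes "z \<in> root_space H \<alpha>"
  shows "\<exists>t. z = t *\<^sub>C x"
proof -
  have "lie y z \<in> root_space H (\<lambda>u. (- \<alpha>) u + \<alpha> u)" by (rule root_space_lie[OF y_root assms])
  then have hz: "lie y z \<in> H" using root_space_zero by simp
  \<comment> \<open>Since \<open>lie y x = - h\<close> and \<alpha>(h) = 2, adding \<open>t\<close>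
    times \<open>x\<close> lowers the value of \<alpha> at the bracket with \<open>y\<close> by
    2t.\<close>
  define t where "t = \<alpha> (lie y z) / 2"
  let ?z = "z + t *\<^sub>C x"
  have root: "?z \<in> root_space H \<alpha>"
    using assms x_root
    by (auto simp: root_space_def lie_add_right lie_cscale_right cscale_add_right cscale_cscale mult.commute)
  have yz: "lie y ?z = lie y z + (- t) *\<^sub>C h"
    using h_eq lie_anticomm[of y x]
    by (simp add: lie_add_right lie_cscale_right lie.scale_minus_left lie.scale_minus_right)
  have in_H: "(- t) *\<^sub>C h \<in> H" using subspace_H h_in by (rule lie.subspace_scale)
  have H: "lie y ?z \<in> H" unfolding yz using subspace_H hz in_H by (rule lie.subspace_add)
  have "\<alpha> (lie y ?z) = \<alpha> (lie y z) + \<alpha> ((- t) *\<^sub>C h)"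
    unfolding yz using \<alpha>_dual hz in_H unfolding dual_space_def by blast
  also have "\<alpha> ((- t) *\<^sub>C h) = (- t) * \<alpha> h"
    using \<alpha>_dual h_in unfolding dual_space_def by blast
  finally have "\<alpha> (lie y ?z) = 0" by (simp add: t_def \<alpha>_h)
  then have "lie (lie y ?z) x = 0" using H x_root by (auto simp: root_space_def lie.scale_zero_left)
  then have "lie x (lie y ?z) = 0" by (simp add: lie_anticomm[of x])
  then have "?z = 0" using positive_weight_vanish[OF \<alpha>_dual root, of 1] \<alpha>_h by simp
  then have "z = (- t) *\<^sub>C x" by (simp add: lie.scale_minus_left eq_neg_iff_add_eq_0)
  then show ?thesis ..
qed

text \<open>\<open>ad y\<close> lowers the multiple by one. From 2\<alpha> it leads into the line
  spanned by \<open>x\<close>, which \<open>ad x\<close> annihilates; from higher multiples it gives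
  0 by induction. The weight is positive at \<open>h\<close>, with value 4 or 2n + 6, so
  \<open>positive_weight_vanish\<close> applies.\<close>

lemma root_space_multiple:
  assumes "z \<in> root_space H (\<lambda>u. of_nat (n + 2) * \<alpha> u)"
  shows "z = 0"
  using assms
proof (induction n arbitrary: z)
  case (0 z)
  have "lie y z \<in> root_space H (\<lambda>u. (- \<alpha>) u + of_nat (0 + 2) * \<alpha> u)"
    by (rule root_space_lie[OF y_root 0])
  then have "lie y z \<in> root_space H \<alpha>" by simp
  then obtain t where t: "lie y z = t *\<^sub>C x" using root_space_\<alpha> by blast
  have "(\<lambda>u. of_nat (0 + 2) * \<alpha> u) \<in> dual_space H"
    using \<alpha>_dual by (auto simp: dual_space_def algebra_simps)
  then show ?case
    by (rule positive_weight_vanish[OF _ 0, where m = 3]) (simp_all add: t lie_cscale_right lie_self lie.scale_zero_right \<alpha>_h)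
next
  case (Suc n z)
  have "lie y z \<in> root_space H (\<lambda>u. (- \<alpha>) u + of_nat (Suc n + 2) * \<alpha> u)"
    by (rule root_space_lie[OF y_root Suc.prems])
  also have "(\<lambda>u. (- \<alpha>) u + of_nat (Suc n + 2) * \<alpha> u) = (\<lambda>u. of_nat (n + 2) * \<alpha> u)"
    by (simp add: algebra_simps)
  finally have "lie y z = 0" by (rule Suc.IH)
  moreover have "(\<lambda>u. of_nat (Suc n + 2) * \<alpha> u) \<in> dual_space H"
    using \<alpha>_dual by (auto simp: dual_space_def algebra_simps)
  ultimately show ?case
    by (intro positive_weight_vanish[OF _ Suc.prems, where m = "2 * n + 5"]) (simp_all add: \<alpha>_h)
qed

text \<open>Raise a weight vector of \<beta> as long as possible, in \<open>n\<close> steps, to a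
  highest weight vector \<open>v\<close>; then lower \<open>v\<close> as long as possible, in
  \<open>N\<close> steps. That the next lowering gives 0 forces the highest weight to take the value
  \<open>N\<close> at \<open>h\<close>, and the nonzero vectors on the way down witness the weights
  of the string.\<close>

lemma weight_string:
  assumes "\<beta> \<in> weights H"
  shows "\<exists>n N. \<beta> h = of_nat N - 2 * of_nat n \<and>
           (\<forall>k\<le>N. (\<lambda>u. \<beta> u + (of_nat n - of_nat k) * \<alpha> u) \<in> weights H)"
proof -
  interpret op: sl2_triple H "- \<alpha>" y x "- h" by (rule opposite)
  obtain z where z: "z \<in> root_space H \<beta>" "z \<noteq> 0" using assms by (rule weightsE)
  have \<beta>: "\<beta> \<in> dual_space H" using assms by (simp add: weights_def)
  have last: "\<exists>n. f n \<noteq> 0 \<and> f (Suc n) = 0" if "f 0 \<noteq> 0" "\<exists>n. f n = 0" for f :: "nat \<Rightarrow> 'g"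
  proof (rule ccontr)
    assume "\<nexists>n. f n \<noteq> 0 \<and> f (Suc n) = 0"
    then have "f n \<noteq> 0" for n using that(1) by (induction n) auto
    then show False using that(2) by blast
  qed
  obtain n where n: "(lie x ^^ n) z \<noteq> 0" "(lie x ^^ Suc n) z = 0"
    using last[of "\<lambda>n. (lie x ^^ n) z"] raise_nilpotent[OF \<beta> z(1)] z(2) by auto
  define v where "v = (lie x ^^ n) z"
  define \<gamma> where "\<gamma> = (\<lambda>u. \<beta> u + of_nat n * \<alpha> u)"
  have v: "v \<in> root_space H \<gamma>" unfolding v_def \<gamma>_def by (rule raise_root_space[OF z(1)])
  have \<gamma>: "\<gamma> \<in> dual_space H" unfolding \<gamma>_def by (rule dual_space_add_mult[OF \<beta> \<alpha>_dual])
  obtain N where N: "(lie y ^^ N) v \<noteq> 0" "(lie y ^^ Suc N) v = 0"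
    using last[of "\<lambda>n. (lie y ^^ n) v"] op.raise_nilpotent[OF \<gamma> v] n(1) by (auto simp: v_def)
  have "lie x v = 0" using n(2) by (simp add: v_def)
  then have "- (of_nat (Suc N) * (\<gamma> (- h) + of_nat N)) *\<^sub>C (lie y ^^ N) v = 0"
    using op.lower_raise_power[OF v, of N] N(2) by simp
  then have "\<gamma> (- h) + of_nat N = 0" using N(1)
    by (simp only: lie.scale_eq_0_iff neg_equal_0_iff_equal mult_eq_0_iff of_nat_eq_0_iff) simp
  moreover have "\<gamma> (- 1 *\<^sub>C h) = - 1 * \<gamma> h" using \<gamma> h_in unfolding dual_space_def by blast
  ultimately have "\<gamma> h = of_nat N" by (simp add: lie.scale_minus_left cscale_one)
  then have "\<beta> h = of_nat N - 2 * of_nat n" by (simp add: \<gamma>_def \<alpha>_h algebra_simps)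
  moreover have "(\<lambda>u. \<beta> u + (of_nat n - of_nat k) * \<alpha> u) \<in> weights H" if "k \<le> N" for k
  proof -
    have "(lie y ^^ k) v \<noteq> 0"
    proof
      assume "(lie y ^^ k) v = 0"
      then have "(lie y ^^ (j + k)) v = 0" for j by (induction j) simp_all
      from this[of "N - k"] show False using N(1) that by simp
    qed
    then have "(\<lambda>u. \<gamma> u + of_nat k * (- \<alpha>) u) \<in> weights H" by (rule op.raise_weights[OF \<gamma> v])
    then show ?thesis by (simp add: \<gamma>_def algebra_simps)
  qed
  ultimately show ?thesis by blast
qed

text \<open>The mirror image of \<beta> is the member \<open>k = N - n\<close> of its string,
  provided \<open>n \<le> N\<close>. The string of the opposite triple covers the remaining case:
  \<open>n > N\<close> and \<open>n' > N'\<close> together would make both \<beta>(h) and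
  -\<beta>(h) negative.\<close>

lemma weight_reflection:
  assumes "\<beta> \<in> weights H"
  shows "\<beta> h \<in> \<int>" and "(\<lambda>u. \<beta> u - \<beta> h * \<alpha> u) \<in> weights H"
proof -
  interpret op: sl2_triple H "- \<alpha>" y x "- h" by (rule opposite)
  obtain n N where s: "\<beta> h = of_nat N - 2 * of_nat n"
      "\<And>k. k \<le> N \<Longrightarrow> (\<lambda>u. \<beta> u + (of_nat n - of_nat k) * \<alpha> u) \<in> weights H"
    using weight_string[OF assms] by blast
  obtain n' N' where s': "\<beta> (- h) = of_nat N' - 2 * of_nat n'"
      "\<And>k. k \<le> N' \<Longrightarrow> (\<lambda>u. \<beta> u + (of_nat n' - of_nat k) * (- \<alpha>) u) \<in> weights H"
    using op.weight_string[OF assms] by blast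
  show "\<beta> h \<in> \<int>" unfolding s(1) by simp
  have "\<beta> (- 1 *\<^sub>C h) = - 1 * \<beta> h" using assms h_in unfolding weights_def dual_space_def by blast
  then have neg: "\<beta> (- h) = - \<beta> h" by (simp add: lie.scale_minus_left cscale_one)
  have "of_nat N - 2 * of_nat n = - (of_nat N' - 2 * of_nat n' :: complex)"
    unfolding s(1)[symmetric] s'(1)[symmetric] neg by simp
  then have "of_int (int N - 2 * int n) = (- of_int (int N' - 2 * int n') :: complex)"
    by simp
  then have "int N - 2 * int n = - (int N' - 2 * int n')"
    by (simp only: of_int_minus[symmetric] of_int_eq_iff)
  then consider "n \<le> N" | "n' \<le> N'" by linarith
  then show "(\<lambda>u. \<beta> u - \<beta> h * \<alpha> u) \<in> weights H"
  proof cases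
    case 1
    have "(\<lambda>u. \<beta> u + (of_nat n - of_nat (N - n)) * \<alpha> u) \<in> weights H" by (rule s(2)) simp
    then show ?thesis using 1 by (simp add: s(1) of_nat_diff algebra_simps)
  next
    case 2
    have "(\<lambda>u. \<beta> u + (of_nat n' - of_nat (N' - n')) * (- \<alpha>) u) \<in> weights H" by (rule s'(2)) simp
    moreover have "\<beta> h = 2 * of_nat n' - of_nat N'"
      using neg unfolding s'(1) by (metis minus_diff_eq minus_minus)
    then have eq: "\<beta> u + (of_nat n' - of_nat (N' - n')) * (- \<alpha>) u = \<beta> u - \<beta> h * \<alpha> u" for u
      using 2 by (simp only: of_nat_diff) (simp add: algebra_simps)
    ultimately show ?thesis unfolding eq by blast
  qed
qed

end


section \<open>Root systems in simple-root coordinates\<close>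

definition unit_coeff :: "nat \<Rightarrow> nat \<Rightarrow> int" where
  "unit_coeff i = (\<lambda>k. if k = i then 1 else 0)"

text \<open>\<open>A i j\<close> stands for \<alpha>_i at the j-th coroot and \<open>d j\<close> for
  half the squared length of \<alpha>_j. Definiteness is asked over the reals because it also has to
  yield the invertibility of the Cartan matrix; \<open>connected\<close> is irreducibility, phrased
  as the absence of proper nonempty sets of vertices closed under adjacency.\<close>

locale cartan_form =
  fixes r :: nat and A :: "nat \<Rightarrow> nat \<Rightarrow> int" and d :: "nat \<Rightarrow> int"
  assumes diagonal: "i \<in> {1..r} \<Longrightarrow> A i i = 2"
    and off_diagonal: "i \<in> {1..r} \<Longrightarrow> j \<in> {1..r} \<Longrightarrow> i \<noteq> j \<Longrightarrow> A i j \<le> 0"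
    and symmetrizable: "i \<in> {1..r} \<Longrightarrow> j \<in> {1..r} \<Longrightarrow> d j * A i j = d i * A j i"
    and d_pos: "i \<in> {1..r} \<Longrightarrow> 0 < d i"
    and positive_definite: "i \<in> {1..r} \<Longrightarrow> c i \<noteq> (0::real) \<Longrightarrow>
      0 < (\<Sum>j=1..r. c j * of_int (d j) * (\<Sum>i=1..r. c i * of_int (A i j)))"
    and connected: "S \<subseteq> {1..r} \<Longrightarrow> S \<noteq> {} \<Longrightarrow>
      (\<And>i j. i \<in> S \<Longrightarrow> j \<in> {1..r} \<Longrightarrow> A i j \<noteq> 0 \<Longrightarrow> j \<in> S) \<Longrightarrow> S = {1..r}"
begin

definition pairing :: "(nat \<Rightarrow> int) \<Rightarrow> nat \<Rightarrow> int" where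
  "pairing c j = (\<Sum>i=1..r. c i * A i j)"

text \<open>The invariant form with (\<alpha>_i, \<alpha>_j) = \<open>d j * A i j\<close>, hence
  with squared length \<open>2 * d i\<close> for \<alpha>_i.\<close>

definition form :: "(nat \<Rightarrow> int) \<Rightarrow> (nat \<Rightarrow> int) \<Rightarrow> int" where
  "form c c' = (\<Sum>j=1..r. c' j * d j * pairing c j)"

definition refl :: "nat \<Rightarrow> (nat \<Rightarrow> int) \<Rightarrow> nat \<Rightarrow> int" where
  "refl i c = (\<lambda>k. c k - pairing c i * unit_coeff i k)"

definition dominant :: "(nat \<Rightarrow> int) \<Rightarrow> bool" where
  "dominant c \<longleftrightarrow> (\<forall>j\<in>{1..r}. 0 \<le> pairing c j)"

lemma pairing_diff: "pairing (\<lambda>k. c k - t * c' k) j = pairing c j - t * pairing c' j"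
  by (simp add: pairing_def sum_subtractf sum_distrib_left algebra_simps)

lemma pairing_unit: "i \<in> {1..r} \<Longrightarrow> pairing (unit_coeff i) j = A i j"
proof -
  assume i: "i \<in> {1..r}"
  have "pairing (unit_coeff i) j = (\<Sum>k=1..r. if k = i then A k j else 0)"
    unfolding pairing_def by (rule sum.cong) (auto simp: unit_coeff_def)
  then show ?thesis using i by simp
qed

lemma form_commute: "form c c' = form c' c"
proof -
  have "form c c' = (\<Sum>j=1..r. \<Sum>i=1..r. c' j * (d j * A i j) * c i)"
    by (simp add: form_def pairing_def sum_distrib_left algebra_simps)
  also have "\<dots> = (\<Sum>j=1..r. \<Sum>i=1..r. c' j * (d i * A j i) * c i)"
    by (intro sum.cong refl arg_cong2[where f = "(*)"] symmetrizable)
  also have "\<dots> = (\<Sum>i=1..r. \<Sum>j=1..r. c' j * (d i * A j i) * c i)"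
    by (rule sum.swap)
  also have "\<dots> = form c' c"
    by (simp add: form_def pairing_def sum_distrib_left algebra_simps)
  finally show ?thesis .
qed

lemma form_diff_left: "form (\<lambda>k. c k - t * c' k) c'' = form c c'' - t * form c' c''"
  by (simp add: form_def pairing_diff sum_subtractf sum_distrib_left algebra_simps)

lemma form_diff_right: "form c'' (\<lambda>k. c k - t * c' k) = form c'' c - t * form c'' c'"
  by (metis form_commute form_diff_left)

lemma form_unit: "i \<in> {1..r} \<Longrightarrow> form c (unit_coeff i) = d i * pairing c i"
proof -
  assume i: "i \<in> {1..r}"
  have "form c (unit_coeff i) = (\<Sum>k=1..r. if k = i then d k * pairing c k else 0)"
    unfolding form_def by (rule sum.cong) (auto simp: unit_coeff_def)
  then show ?thesis using i by simp
qed

lemma form_unit_unit: "i \<in> {1..r} \<Longrightarrow> form (unit_coeff i) (unit_coeff i) = 2 * d i"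
  by (simp add: form_unit pairing_unit diagonal)

lemma form_refl: "i \<in> {1..r} \<Longrightarrow> form (refl i c) (refl i c) = form c c"
proof -
  assume i: "i \<in> {1..r}"
  have "form (unit_coeff i) c = d i * pairing c i" using form_unit[OF i] form_commute by simp
  then show ?thesis
    unfolding refl_def form_diff_left form_diff_right form_unit[OF i] pairing_unit[OF i] diagonal[OF i]
    by (simp add: algebra_simps)
qed

lemma refl_refl: "i \<in> {1..r} \<Longrightarrow> refl i (refl i c) = c"
proof -
  assume i: "i \<in> {1..r}"
  have "pairing (refl i c) i = - pairing c i"
    by (simp add: refl_def pairing_diff pairing_unit[OF i] diagonal[OF i])
  then show ?thesis unfolding refl_def[of i "refl i c"] by (simp add: refl_def)
qed

lemma refl_other: "k \<noteq> i \<Longrightarrow> refl i c k = c k"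
  by (simp add: refl_def unit_coeff_def)

lemma refl_same: "refl i c i = c i - pairing c i"
  by (simp add: refl_def unit_coeff_def)

lemma form_pos:
  assumes "i \<in> {1..r}" "c i \<noteq> 0"
  shows "0 < form c c"
proof -
  have "0 < (\<Sum>j=1..r. real_of_int (c j) * of_int (d j) * (\<Sum>i=1..r. of_int (c i) * of_int (A i j)))"
    using positive_definite[of i "\<lambda>i. of_int (c i)"] assms by simp
  also have "\<dots> = of_int (form c c)" by (simp add: form_def pairing_def)
  finally show ?thesis by (simp only: of_int_0_less_iff)
qed

text \<open>The squared length of \<open>c - \<theta>\<close> is twice (\<theta>, \<theta>) -
  (\<theta>, c), which is not positive, and the form is definite.\<close>

lemma form_eq_imp_eq:
  assumes "form c c = form \<theta> \<theta>" "form \<theta> \<theta> \<le> form \<theta> c" "i \<in> {1..r}"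
  shows "c i = \<theta> i"
proof (rule ccontr)
  assume "c i \<noteq> \<theta> i"
  then have "0 < form (\<lambda>k. c k - 1 * \<theta> k) (\<lambda>k. c k - 1 * \<theta> k)"
    using form_pos[of i "\<lambda>k. c k - 1 * \<theta> k"] assms(3) by simp
  also have "\<dots> = form c c - 2 * form \<theta> c + form \<theta> \<theta>"
    unfolding form_diff_left form_diff_right using form_commute[of c \<theta>] by simp
  finally show False using assms(1,2) by simp
qed

text \<open>Where a coefficient vanishes, the pairing is a sum of terms that are at most 0, so
  dominance makes each of them 0 and the coefficient vanishes at all neighbours too. By
  connectedness it would vanish everywhere.\<close>

lemma dominant_full_support:
  assumes dom: "dominant c" and nonneg: "\<And>i. i \<in> {1..r} \<Longrightarrow> 0 \<le> c i"
    and "k \<in> {1..r}" "c k \<noteq> 0" and i: "i \<in> {1..r}"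
  shows "1 \<le> c i"
proof (rule ccontr)
  define S where "S = {i \<in> {1..r}. c i = 0}"
  assume "\<not> 1 \<le> c i"
  then have "i \<in> S" using nonneg[OF i] i by (simp add: S_def)
  then have S: "S \<subseteq> {1..r}" "S \<noteq> {}" by (auto simp: S_def)
  have closed: "j \<in> S" if i: "i \<in> S" and j: "j \<in> {1..r}" and "A i j \<noteq> 0" for i j
  proof (cases "i = j")
    case False
    have ri: "i \<in> {1..r}" "c i = 0" using i by (auto simp: S_def)
    have "A j i \<noteq> 0" using symmetrizable[OF ri(1) j] d_pos[OF j] that(3) by auto
    then have Aji: "A j i < 0" using off_diagonal[OF j ri(1)] False by fastforce
    have le: "c k * A k i \<le> 0" if "k \<in> {1..r}" for k
      using off_diagonal[OF that ri(1)] nonneg[OF that] ri(2)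
      by (cases "k = i") (auto simp: mult_nonneg_nonpos)
    have "pairing c i \<le> 0" unfolding pairing_def by (rule sum_nonpos) (rule le)
    moreover have "0 \<le> pairing c i" using dom ri(1) by (simp add: dominant_def)
    ultimately have "(\<Sum>k\<in>{1..r}. - (c k * A k i)) = 0" by (simp add: pairing_def sum_negf)
    moreover have "\<And>k. k \<in> {1..r} \<Longrightarrow> 0 \<le> - (c k * A k i)" using le by simp
    ultimately have "\<forall>k\<in>{1..r}. - (c k * A k i) = 0" by (subst (asm) sum_nonneg_eq_0_iff) blast+
    then have "c j * A j i = 0" using j by simp
    then show ?thesis using Aji j by (simp add: S_def)
  qed (use i in simp)
  have "S = {1..r}" by (rule connected[OF S closed])
  then have "k \<in> S" using assms(3) by blast
  then show False using assms(4) by (simp add: S_def)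
qed

end

text \<open>What simple reflections alone deliver about a root system. In particular
  \<open>multiple\<close> concerns multiples of simple roots, for which an sl2-triple is at hand; it
  is the end of the descent in \<open>descend\<close>.\<close>

locale root_coeffs = cartan_form r A d for r A d +
  fixes \<Phi> :: "(nat \<Rightarrow> int) set"
  assumes finite_\<Phi>: "finite \<Phi>"
    and supported: "c \<in> \<Phi> \<Longrightarrow> i \<notin> {1..r} \<Longrightarrow> c i = 0"
    and unit_in: "i \<in> {1..r} \<Longrightarrow> unit_coeff i \<in> \<Phi>"
    and refl_in: "c \<in> \<Phi> \<Longrightarrow> i \<in> {1..r} \<Longrightarrow> refl i c \<in> \<Phi>"
    and sign: "c \<in> \<Phi> \<Longrightarrow> (\<forall>i. 0 \<le> c i) \<or> (\<forall>i. c i \<le> 0)"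
    and nonzero: "(\<lambda>_. 0) \<notin> \<Phi>"
    and multiple: "i \<in> {1..r} \<Longrightarrow> (\<lambda>k. n * unit_coeff i k) \<in> \<Phi> \<Longrightarrow> 0 < n \<Longrightarrow> n = 1"
begin

lemma obtain_nonzero:
  assumes "c \<in> \<Phi>"
  obtains i where "i \<in> {1..r}" "c i \<noteq> 0"
proof -
  have "c \<noteq> (\<lambda>_. 0)" using assms nonzero by blast
  then obtain i where "c i \<noteq> 0" by auto
  then show ?thesis using that[of i] supported[OF assms, of i] by blast
qed

lemma norm_pos: "c \<in> \<Phi> \<Longrightarrow> 0 < form c c"
  by (metis obtain_nonzero form_pos)

text \<open>Take a root of maximal height among those above \<open>c\<close> with property
  \<open>Q\<close>. If its pairing at \<open>j\<close> were negative, \<open>refl j\<close> would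
  increase the \<open>j\<close>-th coefficient and leave the others unchanged.\<close>

lemma ascend:
  assumes "c \<in> \<Phi>" "Q c" and Q: "\<And>c i. c \<in> \<Phi> \<Longrightarrow> i \<in> {1..r} \<Longrightarrow> Q c \<Longrightarrow> Q (refl i c)"
  shows "\<exists>c'\<in>\<Phi>. Q c' \<and> (\<forall>i. c i \<le> c' i) \<and> dominant c'"
proof -
  define T where "T = {c' \<in> \<Phi>. Q c' \<and> (\<forall>i. c i \<le> c' i)}"
  define ht :: "(nat \<Rightarrow> int) \<Rightarrow> int" where "ht c = (\<Sum>i=1..r. c i)" for c
  have T: "finite T" "T \<noteq> {}" using assms finite_\<Phi> by (auto simp: T_def)
  have "Max (ht ` T) \<in> ht ` T" using T by (intro Max_in) auto
  then obtain c' where c': "c' \<in> T" "ht c' = Max (ht ` T)" by auto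
  have max: "ht c'' \<le> ht c'" if "c'' \<in> T" for c'' using T(1) that c'(2) by simp
  have "0 \<le> pairing c' j" if j: "j \<in> {1..r}" for j
  proof (rule ccontr)
    assume neg: "\<not> 0 \<le> pairing c' j"
    have "c i \<le> refl j c' i" for i
    proof -
      have "c i \<le> c' i" using c'(1) by (simp add: T_def)
      then show ?thesis using neg by (cases "i = j") (simp_all add: refl_other refl_same)
    qed
    then have "refl j c' \<in> T" using c'(1) Q j refl_in by (auto simp: T_def)
    moreover have "ht c' < ht (refl j c')"
      unfolding ht_def using j neg
      by (intro sum_strict_mono_ex1) (auto simp: refl_def unit_coeff_def intro!: bexI[of _ j])
    ultimately show False using max by fastforce
  qed
  then show ?thesis using c'(1) unfolding T_def dominant_def by blast
qed

lemma dominant_nonneg: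
  assumes "c \<in> \<Phi>" "dominant c"
  shows "0 \<le> c i"
proof (rule ccontr)
  assume "\<not> 0 \<le> c i"
  then have neg: "\<And>i. c i \<le> 0" using sign[OF assms(1)] by auto
  have "form c c \<le> 0" unfolding form_def
  proof (rule sum_nonpos)
    fix j assume j: "j \<in> {1..r}"
    have "c j * d j \<le> 0" using neg[of j] d_pos[OF j] by (simp add: mult_nonpos_nonneg)
    then show "c j * d j * pairing c j \<le> 0"
      using assms(2) j by (simp add: dominant_def mult_nonpos_nonneg)
  qed
  then show False using norm_pos[OF assms(1)] by simp
qed

lemma dominant_root_full_support:
  assumes "c \<in> \<Phi>" "dominant c" "i \<in> {1..r}"
  shows "1 \<le> c i"
proof -
  obtain k where "k \<in> {1..r}" "c k \<noteq> 0" using obtain_nonzero[OF assms(1)] by blast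
  then show ?thesis using assms dominant_nonneg by (intro dominant_full_support[of c k i])
qed

text \<open>Some summand of \<open>form c c\<close> is positive, so some \<open>refl i\<close>
  lowers the height. The result is still positive if another coefficient, which
  \<open>refl i\<close> does not touch, is nonzero; otherwise \<open>c\<close> is a multiple of a
  simple root, hence simple. The invariant predicate \<open>P\<close> takes the place of the orbit
  under the Weyl group.\<close>

lemma descend:
  assumes "c \<in> \<Phi>" "\<And>i. 0 \<le> c i"
    and P: "\<And>c i. c \<in> \<Phi> \<Longrightarrow> i \<in> {1..r} \<Longrightarrow> P c \<Longrightarrow> P (refl i c)"
    and P_unit: "\<And>i. i \<in> {1..r} \<Longrightarrow> P (unit_coeff i)"
  shows "P c"
  using assms(1,2)
proof (induction "nat (\<Sum>i=1..r. c i)" arbitrary: c rule: less_induct)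
  case (less c)
  obtain k where k: "k \<in> {1..r}" "c k \<noteq> 0" using obtain_nonzero[OF less.prems(1)] by blast
  have "0 < form c c" by (rule norm_pos[OF less.prems(1)])
  then have "\<exists>i\<in>{1..r}. 0 < c i * d i * pairing c i"
    unfolding form_def by (meson not_le sum_nonpos)
  then obtain i where i: "i \<in> {1..r}" "0 < c i * d i * pairing c i" by blast
  have pos: "0 < c i" "0 < pairing c i"
    using i(2) less.prems(2)[of i] d_pos[OF i(1)]
    by (auto simp: zero_less_mult_iff mult_less_0_iff)
  show ?case
  proof (cases "\<exists>k\<in>{1..r}. k \<noteq> i \<and> c k \<noteq> 0")
    case True
    then obtain k where k: "k \<in> {1..r}" "k \<noteq> i" "c k \<noteq> 0" by blast
    then have "0 < refl i c k" using less.prems(2)[of k] by (simp add: refl_other)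
    moreover have ri: "refl i c \<in> \<Phi>" using less.prems(1) i(1) by (rule refl_in)
    ultimately have nn: "\<And>j. 0 \<le> refl i c j" using sign[OF ri] by (metis not_le)
    have "(\<Sum>j=1..r. refl i c j) < (\<Sum>j=1..r. c j)"
      using i(1) pos by (intro sum_strict_mono_ex1) (auto simp: refl_def unit_coeff_def intro!: bexI[of _ i])
    moreover have "0 \<le> (\<Sum>j=1..r. refl i c j)" by (intro sum_nonneg nn)
    ultimately have "P (refl i c)" using less.hyps[OF _ ri nn] by simp
    then have "P (refl i (refl i c))" using P[OF ri i(1)] by blast
    then show ?thesis by (simp add: refl_refl[OF i(1)])
  next
    case False
    then have eq: "c = (\<lambda>k. c i * unit_coeff i k)"
      using supported[OF less.prems(1)] by (auto simp: unit_coeff_def fun_eq_iff)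
    then have "c i = 1" using multiple[OF i(1), of "c i"] less.prems(1) pos(1) by metis
    then have "c = unit_coeff i" using eq by simp
    then show ?thesis using P_unit[OF i(1)] by simp
  qed
qed

text \<open>Negative roots are reached by contradiction: failure of \<open>P\<close> is inherited
  under reflections, these being involutions, so it would climb to a dominant root, which is
  positive and subject to \<open>descend\<close>.\<close>

lemma root_invariant:
  assumes "c \<in> \<Phi>"
    and P: "\<And>c i. c \<in> \<Phi> \<Longrightarrow> i \<in> {1..r} \<Longrightarrow> P c \<Longrightarrow> P (refl i c)"
    and P_unit: "\<And>i. i \<in> {1..r} \<Longrightarrow> P (unit_coeff i)"
  shows "P c"
proof (rule ccontr)
  assume "\<not> P c"
  then have "\<exists>c'\<in>\<Phi>. \<not> P c' \<and> (\<forall>i. c i \<le> c' i) \<and> dominant c'"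
    using assms(1) by (intro ascend) (metis P refl_in refl_refl)+
  then obtain c' where c': "c' \<in> \<Phi>" "\<not> P c'" "dominant c'" by blast
  have "P c'" by (rule descend[OF c'(1) dominant_nonneg[OF c'(1,3)] P P_unit])
  then show False using c'(2) by simp
qed

lemma root_norm:
  assumes "c \<in> \<Phi>"
  shows "\<exists>i\<in>{1..r}. form c c = 2 * d i"
proof (rule root_invariant[OF assms])
  fix c i assume "i \<in> {1..r}" "\<exists>j\<in>{1..r}. form c c = 2 * d j"
  then show "\<exists>j\<in>{1..r}. form (refl i c) (refl i c) = 2 * d j" by (simp add: form_refl)
qed (use form_unit_unit in blast)

text \<open>A root of the given length lies below a dominant root of the same length, and by
  \<open>form_eq_imp_eq\<close> that one is \<theta>. So it is a conclusion, not an assumption, that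
  \<theta> is a root.\<close>

lemma norm_class_top:
  assumes \<theta>_supp: "\<And>i. i \<notin> {1..r} \<Longrightarrow> \<theta> i = 0"
    and \<theta>: "\<And>c. c \<in> \<Phi> \<Longrightarrow> dominant c \<Longrightarrow> form c c = form \<theta> \<theta> \<Longrightarrow> form \<theta> \<theta> \<le> form \<theta> c"
    and c: "c \<in> \<Phi>" "form c c = form \<theta> \<theta>"
  shows "\<theta> \<in> \<Phi>" and "c i \<le> \<theta> i"
proof -
  obtain c' where c': "c' \<in> \<Phi>" "form c' c' = form \<theta> \<theta>" "\<forall>i. c i \<le> c' i" "dominant c'"
    using ascend[of c "\<lambda>c. form c c = form \<theta> \<theta>"] c form_refl by auto
  have "c' = \<theta>"
  proof
    fix i show "c' i = \<theta> i"
      using form_eq_imp_eq[OF c'(2) \<theta>[OF c'(1,4,2)], of i] supported[OF c'(1), of i] \<theta>_supp[of i]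
      by (cases "i \<in> {1..r}") auto
  qed
  then show "\<theta> \<in> \<Phi>" "c i \<le> \<theta> i" using c' by auto
qed

end


section \<open>The quadratic forms of the Lie types\<close>

text \<open>Half the squared length of the i-th simple root when short roots have squared length 2;
  these numbers symmetrize the Cartan matrix.\<close>

fun root_scale :: "lie_type \<Rightarrow> nat \<Rightarrow> int" where
  "root_scale (TypeB r) i = (if i < r then 2 else 1)"
| "root_scale (TypeC r) i = (if i = r then 2 else 1)"
| "root_scale TypeF4 i = (if i \<le> 2 then 2 else 1)"
| "root_scale TypeG2 i = (if i = 2 then 3 else 1)"
| "root_scale _ i = 1"

abbreviation cpair :: "lie_type \<Rightarrow> (nat \<Rightarrow> 'a::comm_ring_1) \<Rightarrow> nat \<Rightarrow> 'a" where
  "cpair X c j \<equiv> \<Sum>i=1..type_rank X. c i * of_int (cartan_entry X i j)"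

lemma chain_edges_iff:
  "{i, j} \<in> chain_edges a b \<longleftrightarrow> a \<le> i \<and> i < b \<and> j = i + 1 \<or> a \<le> j \<and> j < b \<and> i = j + 1"
  by (auto simp: chain_edges_def doubleton_eq_iff)

text \<open>\<open>T\<close> may contain indices such as 0 and r + 1 outside the diagram:
  \<open>c\<close> vanishes there, so the ends of a chain obey the same formula as its
  interior.\<close>

lemma sum_neighbours:
  fixes c :: "nat \<Rightarrow> 'a::comm_ring_1"
  assumes "finite T" "\<And>i. i \<notin> {1..r} \<Longrightarrow> c i = 0" "\<And>i. i \<in> {1..r} - T \<Longrightarrow> A i = 0"
  shows "(\<Sum>i=1..r. c i * of_int (A i)) = (\<Sum>i\<in>T. c i * of_int (A i))"
  by (rule sum.mono_neutral_cong) (use assms in auto)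

lemma cpair_TypeA:
  assumes "\<And>i. i \<notin> {1..r} \<Longrightarrow> c i = 0" "j \<in> {1..r}"
  shows "cpair (TypeA r) c j = 2 * c j - c (j - 1) - c (j + 1)"
proof -
  have "cpair (TypeA r) c j = (\<Sum>i\<in>{j - 1, j, j + 1}. c i * of_int (cartan_entry (TypeA r) i j))"
    using assms by (subst sum_neighbours[where T = "{j - 1, j, j + 1}"])
      (auto simp: cartan_entry_def chain_edges_iff)
  then show ?thesis using assms by (cases j) (auto simp: cartan_entry_def chain_edges_iff)
qed

lemma cpair_TypeB:
  assumes "\<And>i. i \<notin> {1..r} \<Longrightarrow> c i = 0" "j \<in> {1..r}"
  shows "cpair (TypeB r) c j =
    (if j = r then 2 * c r - 2 * c (r - 1) else 2 * c j - c (j - 1) - c (j + 1))"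
proof -
  have "cpair (TypeB r) c j = (\<Sum>i\<in>{j - 1, j, j + 1}. c i * of_int (cartan_entry (TypeB r) i j))"
    using assms by (subst sum_neighbours[where T = "{j - 1, j, j + 1}"])
      (auto simp: cartan_entry_def chain_edges_iff)
  then show ?thesis using assms by (cases j) (auto simp: cartan_entry_def chain_edges_iff)
qed

lemma cpair_TypeC:
  assumes "\<And>i. i \<notin> {1..r} \<Longrightarrow> c i = 0" "j \<in> {1..r}"
  shows "cpair (TypeC r) c j = 2 * c j - c (j - 1) - (if j + 1 = r then 2 else 1) * c (j + 1)"
proof -
  have "cpair (TypeC r) c j = (\<Sum>i\<in>{j - 1, j, j + 1}. c i * of_int (cartan_entry (TypeC r) i j))"
    using assms by (subst sum_neighbours[where T = "{j - 1, j, j + 1}"])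
      (auto simp: cartan_entry_def chain_edges_iff)
  then show ?thesis using assms by (cases j) (auto simp: cartan_entry_def chain_edges_iff)
qed

lemma cpair_TypeD:
  assumes "\<And>i. i \<notin> {1..r} \<Longrightarrow> c i = 0" "j \<in> {1..r}" "4 \<le> r"
  shows "cpair (TypeD r) c j =
    (if j = r then 2 * c r - c (r - 2)
     else if j + 1 = r then 2 * c j - c (j - 1)
     else 2 * c j - c (j - 1) - c (j + 1) - (if j + 2 = r then c r else 0))"
proof -
  obtain k where r: "r = k + 4" using assms(3) by (metis add.commute le_Suc_ex)
  let ?T = "if j = r then {r - 2, r} else if j + 1 = r then {j - 1, j}
     else if j + 2 = r then {j - 1, j, j + 1, j + 2} else {j - 1, j, j + 1}"
  have "cpair (TypeD r) c j = (\<Sum>i\<in>?T. c i * of_int (cartan_entry (TypeD r) i j))"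
    using assms by (subst sum_neighbours[where T = ?T])
      (auto simp: cartan_entry_def chain_edges_iff doubleton_eq_iff split: if_splits)
  then show ?thesis using assms
    by (cases j) (auto simp: cartan_entry_def chain_edges_iff doubleton_eq_iff r eval_nat_numeral)
qed

text \<open>Summation by parts. The boundary term is what the last vertices, which distinguish the
  classical types, combine with.\<close>

lemma chain_squares:
  fixes c :: "nat \<Rightarrow> 'a::comm_ring_1"
  assumes "c 0 = 0"
  shows "(\<Sum>j=1..n. c j * (2 * c j - c (j - 1) - c (j + 1))) =
    (\<Sum>k=1..n. (c k - c (k - 1))\<^sup>2) + c n * (c n - c (n + 1))"
  by (induction n) (simp_all add: assms power2_eq_square algebra_simps)

lemma chain_squares_zero:
  fixes c :: "nat \<Rightarrow> real"
  assumes "c 0 = 0" "(\<Sum>k=1..n. (c k - c (k - 1))\<^sup>2) \<le> 0" "k \<le> n"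
  shows "c k = 0"
proof -
  have "(\<Sum>k=1..n. (c k - c (k - 1))\<^sup>2) = 0" using assms(2) by (intro antisym sum_nonneg) auto
  then have eq: "c j = c (j - 1)" if "j \<in> {1..n}" for j
    using that by (subst (asm) sum_nonneg_eq_0_iff) auto
  show ?thesis using assms(3)
    by (induction k) (use assms(1) eq in force)+
qed

definition quad :: "lie_type \<Rightarrow> (nat \<Rightarrow> real) \<Rightarrow> real" where
  "quad X c = (\<Sum>j=1..type_rank X. c j * of_int (root_scale X j) * cpair X c j)"

text \<open>The squares are those of the coordinates in the usual orthonormal realization: with
  \<alpha>_k = e_k - e_(k+1) the coordinate at e_k is \<open>c k - c (k - 1)\<close>, and that at
  the last basis vector is \<open>- c r\<close>. The next three types differ in the last
  coordinates; the factor 2 in type B is due to short roots having squared length 2 instead of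
  1.\<close>

lemma quad_TypeA:
  assumes "\<And>i. i \<notin> {1..r} \<Longrightarrow> c i = 0"
  shows "quad (TypeA r) c = (\<Sum>k=1..r. (c k - c (k - 1))\<^sup>2) + (c r)\<^sup>2"
proof -
  have "quad (TypeA r) c = (\<Sum>j=1..r. c j * (2 * c j - c (j - 1) - c (j + 1)))"
    unfolding quad_def by (intro sum.cong) (use cpair_TypeA[of r c] assms in auto)
  also have "\<dots> = (\<Sum>k=1..r. (c k - c (k - 1))\<^sup>2) + c r * (c r - c (r + 1))"
    by (rule chain_squares) (simp add: assms)
  finally show ?thesis using assms[of "r + 1"] by (simp add: power2_eq_square)
qed

lemma quad_TypeB:
  assumes "\<And>i. i \<notin> {1..r} \<Longrightarrow> c i = 0" "2 \<le> r"
  shows "quad (TypeB r) c = 2 * (\<Sum>k=1..r. (c k - c (k - 1))\<^sup>2)"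
proof -
  obtain n where r: "r = Suc n" using assms(2) by (cases r) auto
  have "quad (TypeB r) c = (\<Sum>j=1..n. c j * of_int (root_scale (TypeB r) j) * cpair (TypeB r) c j)
      + c r * cpair (TypeB r) c r"
    unfolding quad_def by (simp add: r)
  also have "(\<Sum>j=1..n. c j * of_int (root_scale (TypeB r) j) * cpair (TypeB r) c j) =
      (\<Sum>j=1..n. 2 * (c j * (2 * c j - c (j - 1) - c (j + 1))))"
    by (intro sum.cong) (use cpair_TypeB[of r c] assms r in auto)
  also have "\<dots> = 2 * ((\<Sum>k=1..n. (c k - c (k - 1))\<^sup>2) + c n * (c n - c (n + 1)))"
    unfolding sum_distrib_left[symmetric] by (subst chain_squares) (simp_all add: assms)
  also have "cpair (TypeB r) c r = 2 * c r - 2 * c (r - 1)"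
    using assms by (subst cpair_TypeB) auto
  finally show ?thesis by (simp add: r power2_eq_square algebra_simps)
qed

lemma quad_TypeC:
  assumes "\<And>i. i \<notin> {1..r} \<Longrightarrow> c i = 0" "2 \<le> r"
  shows "quad (TypeC r) c = (\<Sum>k=1..r - 1. (c k - c (k - 1))\<^sup>2) + (2 * c r - c (r - 1))\<^sup>2"
proof -
  obtain n where r: "r = Suc (Suc n)" using assms(2) by (metis One_nat_def Suc_1 add_2_eq_Suc le_Suc_ex)
  have "quad (TypeC r) c = (\<Sum>j=1..n. c j * of_int (root_scale (TypeC r) j) * cpair (TypeC r) c j)
      + c (Suc n) * cpair (TypeC r) c (Suc n) + 2 * c r * cpair (TypeC r) c r"
    unfolding quad_def by (simp add: r)
  also have "(\<Sum>j=1..n. c j * of_int (root_scale (TypeC r) j) * cpair (TypeC r) c j) =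
      (\<Sum>j=1..n. c j * (2 * c j - c (j - 1) - c (j + 1)))"
    by (intro sum.cong) (use cpair_TypeC[of r c] assms r in auto)
  also have "\<dots> = (\<Sum>k=1..n. (c k - c (k - 1))\<^sup>2) + c n * (c n - c (n + 1))"
    by (rule chain_squares) (simp add: assms)
  also have "cpair (TypeC r) c r = 2 * c r - c (r - 1)"
    using assms by (subst cpair_TypeC) auto
  also have "cpair (TypeC r) c (Suc n) = 2 * c (Suc n) - c n - 2 * c r"
    using assms r by (subst cpair_TypeC) auto
  finally show ?thesis by (simp add: r power2_eq_square algebra_simps)
qed

lemma quad_TypeD:
  assumes "\<And>i. i \<notin> {1..r} \<Longrightarrow> c i = 0" "4 \<le> r"
  shows "quad (TypeD r) c = (\<Sum>k=1..r - 2. (c k - c (k - 1))\<^sup>2)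
    + (c (r - 2) - c (r - 1) - c r)\<^sup>2 + (c (r - 1) - c r)\<^sup>2"
proof -
  obtain k where k: "r = k + 4" using assms(2) by (metis add.commute le_Suc_ex)
  \<comment> \<open>\<open>n = r - 3\<close> is the last vertex before the branch vertex
    \<open>Suc n = r - 2\<close>.\<close>
  define n where "n = Suc k"
  have r: "r = Suc (Suc (Suc n))" and n: "1 \<le> n" by (simp_all add: k n_def)
  have "quad (TypeD r) c = (\<Sum>j=1..n. c j * cpair (TypeD r) c j)
      + c (Suc n) * cpair (TypeD r) c (Suc n)
      + c (Suc (Suc n)) * cpair (TypeD r) c (Suc (Suc n)) + c r * cpair (TypeD r) c r"
    unfolding quad_def by (simp add: r)
  also have "(\<Sum>j=1..n. c j * cpair (TypeD r) c j) =
      (\<Sum>j=1..n. c j * (2 * c j - c (j - 1) - c (j + 1)))"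
    by (intro sum.cong) (use cpair_TypeD[of r c] assms r in auto)
  also have "\<dots> = (\<Sum>k=1..n. (c k - c (k - 1))\<^sup>2) + c n * (c n - c (n + 1))"
    by (rule chain_squares) (simp add: assms)
  also have "cpair (TypeD r) c r = 2 * c r - c (r - 2)"
    using assms by (subst cpair_TypeD) auto
  also have "cpair (TypeD r) c (Suc (Suc n)) = 2 * c (Suc (Suc n)) - c (Suc n)"
    using assms r by (subst cpair_TypeD) auto
  also have "cpair (TypeD r) c (Suc n) = 2 * c (Suc n) - c n - c (Suc (Suc n)) - c r"
    using assms r by (subst cpair_TypeD) auto
  finally show ?thesis by (simp add: r power2_eq_square algebra_simps numeral_2_eq_2)
qed

lemma quad_pos_TypeA:
  assumes "\<And>i. i \<notin> {1..r} \<Longrightarrow> c i = 0" "c i \<noteq> 0"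
  shows "0 < quad (TypeA r) c"
proof (rule ccontr)
  have eq: "quad (TypeA r) c = (\<Sum>k=1..r. (c k - c (k - 1))\<^sup>2) + (c r)\<^sup>2"
    by (rule quad_TypeA) (use assms in auto)
  assume "\<not> 0 < quad (TypeA r) c"
  then have "(\<Sum>k=1..r. (c k - c (k - 1))\<^sup>2) \<le> 0"
    unfolding eq using zero_le_power2[of "c r"] by linarith
  then show False using chain_squares_zero[of c r i] assms by (cases "i \<in> {1..r}") auto
qed

lemma quad_pos_TypeB:
  assumes "\<And>i. i \<notin> {1..r} \<Longrightarrow> c i = 0" "c i \<noteq> 0" "2 \<le> r"
  shows "0 < quad (TypeB r) c"
proof (rule ccontr)
  have eq: "quad (TypeB r) c = 2 * (\<Sum>k=1..r. (c k - c (k - 1))\<^sup>2)"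
    by (rule quad_TypeB) (use assms in auto)
  assume "\<not> 0 < quad (TypeB r) c"
  then have "(\<Sum>k=1..r. (c k - c (k - 1))\<^sup>2) \<le> 0"
    unfolding eq by simp
  then show False using chain_squares_zero[of c r i] assms by (cases "i \<in> {1..r}") auto
qed

lemma quad_pos_TypeC:
  assumes "\<And>i. i \<notin> {1..r} \<Longrightarrow> c i = 0" "c i \<noteq> 0" "2 \<le> r"
  shows "0 < quad (TypeC r) c"
proof (rule ccontr)
  let ?S = "\<Sum>k=1..r - 1. (c k - c (k - 1))\<^sup>2"
  have eq: "quad (TypeC r) c = ?S + (2 * c r - c (r - 1))\<^sup>2"
    by (rule quad_TypeC) (use assms in auto)
  assume "\<not> 0 < quad (TypeC r) c"
  then have le: "?S + (2 * c r - c (r - 1))\<^sup>2 \<le> 0"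
    unfolding eq by simp
  have S: "0 \<le> ?S" by (intro sum_nonneg) auto
  have "?S \<le> 0" using le zero_le_power2[of "2 * c r - c (r - 1)"] by linarith
  then have z: "c k = 0" if "k \<le> r - 1" for k using chain_squares_zero[of c "r - 1" k] assms(1) that by auto
  have "(2 * c r - c (r - 1))\<^sup>2 \<le> 0" using le S by linarith
  then have "c r = 0" using z[of "r - 1"] by (simp add: power2_less_eq_zero_iff)
  then have "c k = 0" for k using z[of k] assms(1)[of k] by (cases "k \<le> r - 1"; cases "k = r") auto
  then show False using assms(2) by blast
qed

lemma quad_pos_TypeD:
  assumes "\<And>i. i \<notin> {1..r} \<Longrightarrow> c i = 0" "c i \<noteq> 0" "4 \<le> r"
  shows "0 < quad (TypeD r) c"
proof (rule ccontr)
  let ?S = "\<Sum>k=1..r - 2. (c k - c (k - 1))\<^sup>2"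
  let ?a = "c (r - 2) - c (r - 1) - c r" and ?b = "c (r - 1) - c r"
  have eq: "quad (TypeD r) c = ?S + ?a\<^sup>2 + ?b\<^sup>2"
    by (rule quad_TypeD) (use assms in auto)
  assume "\<not> 0 < quad (TypeD r) c"
  then have le: "?S + ?a\<^sup>2 + ?b\<^sup>2 \<le> 0"
    unfolding eq by simp
  have S: "0 \<le> ?S" by (intro sum_nonneg) auto
  have "?S \<le> 0" using le zero_le_power2[of ?a] zero_le_power2[of ?b] by linarith
  then have z: "c k = 0" if "k \<le> r - 2" for k using chain_squares_zero[of c "r - 2" k] assms(1) that by auto
  have "?a\<^sup>2 \<le> 0" "?b\<^sup>2 \<le> 0" using le S zero_le_power2[of ?a] zero_le_power2[of ?b] by linarith+
  then have "?a = 0" "?b = 0" by simp_all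
  then have "c r = 0" "c (r - 1) = 0" using z[of "r - 2"] by simp_all
  then have "c k = 0" for k using z[of k] assms(1)[of k] by (cases "k \<le> r - 2"; cases "k = r"; cases "k = r - 1") auto
  then show False using assms(2) by blast
qed

lemma nat_intervals:
  "{1..2::nat} = {1, 2}" "{1..4::nat} = {1, 2, 3, 4}" "{1..6::nat} = {1, 2, 3, 4, 5, 6}"
  "{1..7::nat} = {1, 2, 3, 4, 5, 6, 7}" "{1..8::nat} = {1, 2, 3, 4, 5, 6, 7, 8}"
  by auto

section \<open>Completion of squares for the exceptional types\<close>

lemma cpair_TypeE6:
  "cpair TypeE6 c 1 = 2 * c 1 - c 3"
  "cpair TypeE6 c 2 = 2 * c 2 - c 4"
  "cpair TypeE6 c 3 = 2 * c 3 - c 1 - c 4"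
  "cpair TypeE6 c 4 = 2 * c 4 - c 2 - c 3 - c 5"
  "cpair TypeE6 c 5 = 2 * c 5 - c 4 - c 6"
  "cpair TypeE6 c 6 = 2 * c 6 - c 5"
  by (simp_all add: nat_intervals cartan_entry_def chain_edges_iff doubleton_eq_iff del: One_nat_def)

text \<open>Completing squares along each arm, from its tip towards the branch vertex 4, gives the
  pivots (k + 1)/k. The last pivot is the determinant of the Cartan matrix divided by the
  determinants of the arms: 3/18 here, 2/24 for \<open>TypeE7\<close> and 1/30 for
  \<open>TypeE8\<close>.\<close>

lemma quad_TypeE6:
  "quad TypeE6 c = 2 * (c 6 - 1/2 * c 5)\<^sup>2
    + 3/2 * (c 5 - 2/3 * c 4)\<^sup>2
    + 2 * (c 1 - 1/2 * c 3)\<^sup>2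
    + 3/2 * (c 3 - 2/3 * c 4)\<^sup>2
    + 2 * (c 2 - 1/2 * c 4)\<^sup>2
    + 1/6 * (c 4)\<^sup>2"
proof -
  define P where "P j = cpair TypeE6 c j" for j
  have "quad TypeE6 c = (\<Sum>j\<in>{1, 2, 3, 4, 5, 6}. c j * of_int (root_scale TypeE6 j) * P j)"
    by (simp only: quad_def P_def type_rank.simps nat_intervals)
  then show ?thesis
    by (simp add: cpair_TypeE6[where c = c, folded P_def] power2_eq_square algebra_simps del: One_nat_def)
qed

lemma quad_pos_TypeE6:
  assumes "\<And>i. i \<notin> {1..6} \<Longrightarrow> c i = 0" "c i \<noteq> 0"
  shows "0 < quad TypeE6 c"
proof (rule ccontr)
  assume "\<not> 0 < quad TypeE6 c"
  then have zero: "(c 6 - 1/2 * c 5)\<^sup>2 = 0" "(c 5 - 2/3 * c 4)\<^sup>2 = 0" "(c 1 - 1/2 * c 3)\<^sup>2 = 0" "(c 3 - 2/3 * c 4)\<^sup>2 = 0" "(c 2 - 1/2 * c 4)\<^sup>2 = 0" "(c 4)\<^sup>2 = 0"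
    unfolding quad_TypeE6
    using zero_le_power2[of "c 6 - 1/2 * c 5"] zero_le_power2[of "c 5 - 2/3 * c 4"] zero_le_power2[of "c 1 - 1/2 * c 3"] zero_le_power2[of "c 3 - 2/3 * c 4"] zero_le_power2[of "c 2 - 1/2 * c 4"] zero_le_power2[of "c 4"]
    by linarith+
  then have "\<forall>k\<in>{1..6}. c k = 0" by (simp add: nat_intervals del: One_nat_def)
  then show False using assms by blast
qed

lemma cpair_TypeE7:
  "cpair TypeE7 c 1 = 2 * c 1 - c 3"
  "cpair TypeE7 c 2 = 2 * c 2 - c 4"
  "cpair TypeE7 c 3 = 2 * c 3 - c 1 - c 4"
  "cpair TypeE7 c 4 = 2 * c 4 - c 2 - c 3 - c 5"
  "cpair TypeE7 c 5 = 2 * c 5 - c 4 - c 6"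
  "cpair TypeE7 c 6 = 2 * c 6 - c 5 - c 7"
  "cpair TypeE7 c 7 = 2 * c 7 - c 6"
  by (simp_all add: nat_intervals cartan_entry_def chain_edges_iff doubleton_eq_iff del: One_nat_def)

lemma quad_TypeE7:
  "quad TypeE7 c = 2 * (c 7 - 1/2 * c 6)\<^sup>2
    + 3/2 * (c 6 - 2/3 * c 5)\<^sup>2
    + 4/3 * (c 5 - 3/4 * c 4)\<^sup>2
    + 2 * (c 1 - 1/2 * c 3)\<^sup>2
    + 3/2 * (c 3 - 2/3 * c 4)\<^sup>2
    + 2 * (c 2 - 1/2 * c 4)\<^sup>2
    + 1/12 * (c 4)\<^sup>2"
proof -
  define P where "P j = cpair TypeE7 c j" for j
  have "quad TypeE7 c = (\<Sum>j\<in>{1, 2, 3, 4, 5, 6, 7}. c j * of_int (root_scale TypeE7 j) * P j)"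
    by (simp only: quad_def P_def type_rank.simps nat_intervals)
  then show ?thesis
    by (simp add: cpair_TypeE7[where c = c, folded P_def] power2_eq_square algebra_simps del: One_nat_def)
qed

lemma quad_pos_TypeE7:
  assumes "\<And>i. i \<notin> {1..7} \<Longrightarrow> c i = 0" "c i \<noteq> 0"
  shows "0 < quad TypeE7 c"
proof (rule ccontr)
  assume "\<not> 0 < quad TypeE7 c"
  then have zero: "(c 7 - 1/2 * c 6)\<^sup>2 = 0" "(c 6 - 2/3 * c 5)\<^sup>2 = 0" "(c 5 - 3/4 * c 4)\<^sup>2 = 0" "(c 1 - 1/2 * c 3)\<^sup>2 = 0" "(c 3 - 2/3 * c 4)\<^sup>2 = 0" "(c 2 - 1/2 * c 4)\<^sup>2 = 0" "(c 4)\<^sup>2 = 0"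
    unfolding quad_TypeE7
    using zero_le_power2[of "c 7 - 1/2 * c 6"] zero_le_power2[of "c 6 - 2/3 * c 5"] zero_le_power2[of "c 5 - 3/4 * c 4"] zero_le_power2[of "c 1 - 1/2 * c 3"] zero_le_power2[of "c 3 - 2/3 * c 4"] zero_le_power2[of "c 2 - 1/2 * c 4"] zero_le_power2[of "c 4"]
    by linarith+
  then have "\<forall>k\<in>{1..7}. c k = 0" by (simp add: nat_intervals del: One_nat_def)
  then show False using assms by blast
qed

lemma cpair_TypeE8:
  "cpair TypeE8 c 1 = 2 * c 1 - c 3"
  "cpair TypeE8 c 2 = 2 * c 2 - c 4"
  "cpair TypeE8 c 3 = 2 * c 3 - c 1 - c 4"
  "cpair TypeE8 c 4 = 2 * c 4 - c 2 - c 3 - c 5"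
  "cpair TypeE8 c 5 = 2 * c 5 - c 4 - c 6"
  "cpair TypeE8 c 6 = 2 * c 6 - c 5 - c 7"
  "cpair TypeE8 c 7 = 2 * c 7 - c 6 - c 8"
  "cpair TypeE8 c 8 = 2 * c 8 - c 7"
  by (simp_all add: nat_intervals cartan_entry_def chain_edges_iff doubleton_eq_iff del: One_nat_def)

lemma quad_TypeE8:
  "quad TypeE8 c = 2 * (c 8 - 1/2 * c 7)\<^sup>2
    + 3/2 * (c 7 - 2/3 * c 6)\<^sup>2
    + 4/3 * (c 6 - 3/4 * c 5)\<^sup>2
    + 5/4 * (c 5 - 4/5 * c 4)\<^sup>2
    + 2 * (c 1 - 1/2 * c 3)\<^sup>2
    + 3/2 * (c 3 - 2/3 * c 4)\<^sup>2
    + 2 * (c 2 - 1/2 * c 4)\<^sup>2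
    + 1/30 * (c 4)\<^sup>2"
proof -
  define P where "P j = cpair TypeE8 c j" for j
  have "quad TypeE8 c = (\<Sum>j\<in>{1, 2, 3, 4, 5, 6, 7, 8}. c j * of_int (root_scale TypeE8 j) * P j)"
    by (simp only: quad_def P_def type_rank.simps nat_intervals)
  then show ?thesis
    by (simp add: cpair_TypeE8[where c = c, folded P_def] power2_eq_square algebra_simps del: One_nat_def)
qed

lemma quad_pos_TypeE8:
  assumes "\<And>i. i \<notin> {1..8} \<Longrightarrow> c i = 0" "c i \<noteq> 0"
  shows "0 < quad TypeE8 c"
proof (rule ccontr)
  assume "\<not> 0 < quad TypeE8 c"
  then have zero: "(c 8 - 1/2 * c 7)\<^sup>2 = 0" "(c 7 - 2/3 * c 6)\<^sup>2 = 0" "(c 6 - 3/4 * c 5)\<^sup>2 = 0" "(c 5 - 4/5 * c 4)\<^sup>2 = 0" "(c 1 - 1/2 * c 3)\<^sup>2 = 0" "(c 3 - 2/3 * c 4)\<^sup>2 = 0" "(c 2 - 1/2 * c 4)\<^sup>2 = 0" "(c 4)\<^sup>2 = 0"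
    unfolding quad_TypeE8
    using zero_le_power2[of "c 8 - 1/2 * c 7"] zero_le_power2[of "c 7 - 2/3 * c 6"] zero_le_power2[of "c 6 - 3/4 * c 5"] zero_le_power2[of "c 5 - 4/5 * c 4"] zero_le_power2[of "c 1 - 1/2 * c 3"] zero_le_power2[of "c 3 - 2/3 * c 4"] zero_le_power2[of "c 2 - 1/2 * c 4"] zero_le_power2[of "c 4"]
    by linarith+
  then have "\<forall>k\<in>{1..8}. c k = 0" by (simp add: nat_intervals del: One_nat_def)
  then show False using assms by blast
qed

lemma cpair_TypeF4:
  "cpair TypeF4 c 1 = 2 * c 1 - c 2"
  "cpair TypeF4 c 2 = 2 * c 2 - c 1 - c 3"
  "cpair TypeF4 c 3 = 2 * c 3 - 2 * c 2 - c 4"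
  "cpair TypeF4 c 4 = 2 * c 4 - c 3"
  by (simp_all add: nat_intervals cartan_entry_def chain_edges_iff doubleton_eq_iff del: One_nat_def)

text \<open>Squares are completed from both ends towards vertex 3; the factors 4 and 3 on the long
  side are twice the pivots 2 and 3/2 of a simply-laced chain.\<close>

lemma quad_TypeF4:
  "quad TypeF4 c = 4 * (c 1 - 1/2 * c 2)\<^sup>2
    + 3 * (c 2 - 2/3 * c 3)\<^sup>2
    + 2 * (c 4 - 1/2 * c 3)\<^sup>2
    + 1/6 * (c 3)\<^sup>2"
proof -
  define P where "P j = cpair TypeF4 c j" for j
  have "quad TypeF4 c = (\<Sum>j\<in>{1, 2, 3, 4}. c j * of_int (root_scale TypeF4 j) * P j)"
    by (simp only: quad_def P_def type_rank.simps nat_intervals)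
  then show ?thesis
    by (simp add: cpair_TypeF4[where c = c, folded P_def] power2_eq_square algebra_simps del: One_nat_def)
qed

lemma quad_pos_TypeF4:
  assumes "\<And>i. i \<notin> {1..4} \<Longrightarrow> c i = 0" "c i \<noteq> 0"
  shows "0 < quad TypeF4 c"
proof (rule ccontr)
  assume "\<not> 0 < quad TypeF4 c"
  then have zero: "(c 1 - 1/2 * c 2)\<^sup>2 = 0" "(c 2 - 2/3 * c 3)\<^sup>2 = 0" "(c 4 - 1/2 * c 3)\<^sup>2 = 0" "(c 3)\<^sup>2 = 0"
    unfolding quad_TypeF4
    using zero_le_power2[of "c 1 - 1/2 * c 2"] zero_le_power2[of "c 2 - 2/3 * c 3"] zero_le_power2[of "c 4 - 1/2 * c 3"] zero_le_power2[of "c 3"]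
    by linarith+
  then have "\<forall>k\<in>{1..4}. c k = 0" by (simp add: nat_intervals del: One_nat_def)
  then show False using assms by blast
qed

lemma cpair_TypeG2:
  "cpair TypeG2 c 1 = 2 * c 1 - 3 * c 2"
  "cpair TypeG2 c 2 = 2 * c 2 - c 1"
  by (simp_all add: nat_intervals cartan_entry_def chain_edges_iff doubleton_eq_iff del: One_nat_def)

lemma quad_TypeG2:
  "quad TypeG2 c = 2 * (c 1 - 3/2 * c 2)\<^sup>2
    + 3/2 * (c 2)\<^sup>2"
proof -
  define P where "P j = cpair TypeG2 c j" for j
  have "quad TypeG2 c = (\<Sum>j\<in>{1, 2}. c j * of_int (root_scale TypeG2 j) * P j)"
    by (simp only: quad_def P_def type_rank.simps nat_intervals)
  then show ?thesis
    by (simp add: cpair_TypeG2[where c = c, folded P_def] power2_eq_square algebra_simps del: One_nat_def)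
qed

lemma quad_pos_TypeG2:
  assumes "\<And>i. i \<notin> {1..2} \<Longrightarrow> c i = 0" "c i \<noteq> 0"
  shows "0 < quad TypeG2 c"
proof (rule ccontr)
  assume "\<not> 0 < quad TypeG2 c"
  then have zero: "(c 1 - 3/2 * c 2)\<^sup>2 = 0" "(c 2)\<^sup>2 = 0"
    unfolding quad_TypeG2
    using zero_le_power2[of "c 1 - 3/2 * c 2"] zero_le_power2[of "c 2"]
    by linarith+
  then have "\<forall>k\<in>{1..2}. c k = 0" by (simp add: nat_intervals del: One_nat_def)
  then show False using assms by blast
qed


section \<open>Diagrams and highest roots\<close>

fun lacing :: "lie_type \<Rightarrow> nat" where
  "lacing (TypeB r) = 2"
| "lacing (TypeC r) = 2"
| "lacing TypeF4 = 2"
| "lacing TypeG2 = 3"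
| "lacing _ = 1"

lemma root_scale_pos: "0 < root_scale X i"
  by (cases X) auto

lemma root_scale_cases: "root_scale X i = 1 \<or> root_scale X i = int (lacing X)"
  by (cases X) auto

lemma ex_short_simple: "valid_type X \<Longrightarrow> \<exists>i\<in>{1..type_rank X}. root_scale X i = 1"
  by (cases X) (auto intro: bexI[of _ 1] bexI[of _ "type_rank X"] bexI[of _ 3])

lemma ex_long_simple: "valid_type X \<Longrightarrow> \<exists>i\<in>{1..type_rank X}. root_scale X i = int (lacing X)"
  by (cases X) (auto intro: bexI[of _ 1] bexI[of _ 2] bexI[of _ "type_rank X"])

lemma cartan_entry_symmetrizable:
  assumes "valid_type X" "i \<in> {1..type_rank X}" "j \<in> {1..type_rank X}"
  shows "root_scale X j * cartan_entry X i j = root_scale X i * cartan_entry X j i"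
  using assms
  by (cases X) (auto simp: cartan_entry_def insert_commute chain_edges_iff doubleton_eq_iff)

lemma bond_pos: "0 < bond X i j"
  by (cases X) auto

text \<open>\<open>quad X c\<close> involves only the values of \<open>c\<close> on the vertices, so
  \<open>c\<close> may be replaced by 0 elsewhere, as the formulas with neighbours 0 and r + 1
  require.\<close>

lemma restrict_quad_pos:
  assumes "\<And>c i. (\<And>i. i \<notin> {1..type_rank X} \<Longrightarrow> c i = 0) \<Longrightarrow> c i \<noteq> 0 \<Longrightarrow> 0 < quad X c"
    and "i \<in> {1..type_rank X}" "c i \<noteq> 0"
  shows "0 < quad X c"
proof -
  define c' where "c' i = (if i \<in> {1..type_rank X} then c i else 0)" for i
  have "0 < quad X c'" using assms(2,3) by (intro assms(1)[of _ i]) (auto simp: c'_def)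
  also have "cpair X c' j = cpair X c j" for j by (intro sum.cong) (auto simp: c'_def)
  then have "quad X c' = quad X c" unfolding quad_def by (intro sum.cong) (auto simp: c'_def)
  finally show ?thesis .
qed

lemma quad_pos:
  assumes "valid_type X" "i \<in> {1..type_rank X}" "c i \<noteq> 0"
  shows "0 < quad X c"
proof (rule restrict_quad_pos[where i = i and c = c])
  fix c :: "nat \<Rightarrow> real" and k
  assume c: "\<And>i. i \<notin> {1..type_rank X} \<Longrightarrow> c i = 0" "c k \<noteq> 0"
  show "0 < quad X c"
  proof (cases X)
    case (TypeA r)
    show ?thesis unfolding TypeA
      by (rule quad_pos_TypeA[where i = k]) (use assms(1) c in \<open>simp_all add: TypeA\<close>)
  next
    case (TypeB r)
    show ?thesis unfolding TypeB
      by (rule quad_pos_TypeB[where i = k]) (use assms(1) c in \<open>simp_all add: TypeB\<close>)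
  next
    case (TypeC r)
    show ?thesis unfolding TypeC
      by (rule quad_pos_TypeC[where i = k]) (use assms(1) c in \<open>simp_all add: TypeC\<close>)
  next
    case (TypeD r)
    show ?thesis unfolding TypeD
      by (rule quad_pos_TypeD[where i = k]) (use assms(1) c in \<open>simp_all add: TypeD\<close>)
  next
    case TypeE6
    show ?thesis unfolding TypeE6
      by (rule quad_pos_TypeE6[where i = k]) (use c in \<open>simp_all add: TypeE6\<close>)
  next
    case TypeE7
    show ?thesis unfolding TypeE7
      by (rule quad_pos_TypeE7[where i = k]) (use c in \<open>simp_all add: TypeE7\<close>)
  next
    case TypeE8
    show ?thesis unfolding TypeE8
      by (rule quad_pos_TypeE8[where i = k]) (use c in \<open>simp_all add: TypeE8\<close>)
  next
    case TypeF4
    show ?thesis unfolding TypeF4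
      by (rule quad_pos_TypeF4[where i = k]) (use c in \<open>simp_all add: TypeF4\<close>)
  next
    case TypeG2
    show ?thesis unfolding TypeG2
      by (rule quad_pos_TypeG2[where i = k]) (use c in \<open>simp_all add: TypeG2\<close>)
  qed
qed (use assms in simp_all)

lemma chain_mem_iff:
  assumes "\<And>i. a \<le> i \<Longrightarrow> i < b \<Longrightarrow> i \<in> S \<longleftrightarrow> Suc i \<in> S" "a \<le> i" "i \<le> b"
  shows "i \<in> S \<longleftrightarrow> a \<in> S"
  using assms(2,3) by (induction rule: dec_induct) (use assms(1) in auto)

text \<open>The two Cartan entries of an edge are both nonzero, so membership in a closed set passes
  along each edge in both directions, and each vertex is joined to vertex 1 by a path.\<close>

lemma diagram_connected:
  assumes X: "valid_type X" and S: "S \<subseteq> {1..type_rank X}" "S \<noteq> {}"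
    and closed: "\<And>i j. i \<in> S \<Longrightarrow> j \<in> {1..type_rank X} \<Longrightarrow> cartan_entry X i j \<noteq> 0 \<Longrightarrow> j \<in> S"
  shows "S = {1..type_rank X}"
proof -
  have edge: "i \<in> S \<longleftrightarrow> j \<in> S" if "{i, j} \<in> dynkin_edges X" "i \<in> {1..type_rank X}" "j \<in> {1..type_rank X}" for i j
  proof -
    have "cartan_entry X i j \<noteq> 0" "cartan_entry X j i \<noteq> 0"
      using that(1) bond_pos[of X i j] bond_pos[of X j i]
      by (auto simp: cartan_entry_def insert_commute)
    then show ?thesis using closed that(2,3) by blast
  qed
  have "i \<in> S \<longleftrightarrow> 1 \<in> S" if i: "i \<in> {1..type_rank X}" for i
  proof (cases X)
    case (TypeA r)
    then show ?thesis using i by (intro chain_mem_iff[of 1 r] edge) (auto simp: chain_edges_iff)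
  next
    case (TypeB r)
    then show ?thesis using i by (intro chain_mem_iff[of 1 r] edge) (auto simp: chain_edges_iff)
  next
    case (TypeC r)
    then show ?thesis using i by (intro chain_mem_iff[of 1 r] edge) (auto simp: chain_edges_iff)
  next
    case (TypeD r)
    have c: "i \<in> S \<longleftrightarrow> 1 \<in> S" if "1 \<le> i" "i \<le> r - 1" for i
      using that TypeD by (intro chain_mem_iff[of 1 "r - 1"] edge) (auto simp: chain_edges_iff)
    have "r - 2 \<in> S \<longleftrightarrow> r \<in> S"
      using TypeD X by (intro edge) auto
    moreover have "r - 2 \<in> S \<longleftrightarrow> 1 \<in> S" using TypeD X by (intro c) auto
    ultimately have "r \<in> S \<longleftrightarrow> 1 \<in> S" by blast
    moreover have "i \<le> r - 1 \<or> i = r" "1 \<le> i" using i TypeD by auto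
    ultimately show ?thesis using c by blast
  next
    case TypeE6
    then show ?thesis using i edge[of 1 3] edge[of 2 4] edge[of 3 4] edge[of 4 5] edge[of 5 6]
      by (auto simp: chain_edges_iff nat_intervals simp del: One_nat_def)
  next
    case TypeE7
    then show ?thesis using i edge[of 1 3] edge[of 2 4] edge[of 3 4] edge[of 4 5] edge[of 5 6] edge[of 6 7]
      by (auto simp: chain_edges_iff nat_intervals simp del: One_nat_def)
  next
    case TypeE8
    then show ?thesis using i edge[of 1 3] edge[of 2 4] edge[of 3 4] edge[of 4 5] edge[of 5 6] edge[of 6 7] edge[of 7 8]
      by (auto simp: chain_edges_iff nat_intervals simp del: One_nat_def)
  next
    case TypeF4
    then show ?thesis using i edge[of 1 2] edge[of 2 3] edge[of 3 4]
      by (auto simp: chain_edges_iff nat_intervals simp del: One_nat_def)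
  next
    case TypeG2
    then show ?thesis using i edge[of 1 2]
      by (auto simp: chain_edges_iff nat_intervals simp del: One_nat_def)
  qed
  then show ?thesis using S by blast
qed

lemma cartan_form_type:
  assumes "valid_type X"
  shows "cartan_form (type_rank X) (cartan_entry X) (root_scale X)"
proof
  fix i :: nat and c :: "nat \<Rightarrow> real"
  assume "i \<in> {1..type_rank X}" "c i \<noteq> 0"
  then show "0 < (\<Sum>j=1..type_rank X. c j * of_int (root_scale X j) * cpair X c j)"
    using quad_pos[OF assms] unfolding quad_def by blast
next
  fix i j :: nat assume "i \<noteq> j"
  then show "cartan_entry X i j \<le> 0" using bond_pos[of X i j] by (simp add: cartan_entry_def)
qed (use diagram_connected[OF assms] cartan_entry_symmetrizable[OF assms] root_scale_pos
      in \<open>auto simp: cartan_entry_def\<close>)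

text \<open>The highest root for \<open>e = 0\<close> and the highest short root for \<open>e = 1\<close>, in coordinates with respect
  to the simple roots.  Entry 0 of each list is a dummy, since the vertices are numbered from 1.\<close>

fun top_coeff :: "lie_type \<Rightarrow> nat \<Rightarrow> nat \<Rightarrow> int" where
  "top_coeff (TypeA r) e i = (if i \<in> {1..r} then 1 else 0)"
| "top_coeff (TypeB r) e i = (if i \<notin> {1..r} then 0 else if e = 0 \<and> i \<noteq> 1 then 2 else 1)"
| "top_coeff (TypeC r) e i = (if i \<notin> {1..r} then 0 else if e \<noteq> 0 \<and> i = 1 \<or> i = r then 1 else 2)"
| "top_coeff (TypeD r) e i = (if i \<notin> {1..r} then 0 else if i = 1 \<or> i = r - 1 \<or> i = r then 1 else 2)"
| "top_coeff TypeE6 e i = (if i \<notin> {1..6} then 0 else [0, 1, 2, 2, 3, 2, 1] ! i)"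
| "top_coeff TypeE7 e i = (if i \<notin> {1..7} then 0 else [0, 2, 2, 3, 4, 3, 2, 1] ! i)"
| "top_coeff TypeE8 e i = (if i \<notin> {1..8} then 0 else [0, 2, 3, 4, 6, 5, 4, 3, 2] ! i)"
| "top_coeff TypeF4 e i = (if i \<notin> {1..4} then 0 else (if e = 0 then [0, 2, 3, 4, 2] else [0, 1, 2, 3, 2]) ! i)"
| "top_coeff TypeG2 e i = (if i \<notin> {1..2} then 0 else (if e = 0 then [0, 3, 2] else [0, 2, 1]) ! i)"

text \<open>The inner product (\<theta>, c) for \<theta> = \<open>top_coeff X e\<close>, as
  \<open>iform_top_coeff\<close> confirms. The root \<theta> is orthogonal to all simple roots but
  those adjacent to the affine vertex of the extended diagram (for the highest short root, of the
  twisted one). In type C with r = 2 and \<open>e \<noteq> 0\<close> that neighbour is the long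
  simple root, whence the factor 2.\<close>

fun top_value :: "lie_type \<Rightarrow> nat \<Rightarrow> (nat \<Rightarrow> int) \<Rightarrow> int" where
  "top_value (TypeA r) e c = c 1 + c r"
| "top_value (TypeB r) e c = (if e = 0 then 2 * c 2 else 2 * c 1)"
| "top_value (TypeC r) e c = (if e = 0 then 2 * c 1 else if r = 2 then 2 * c 2 else c 2)"
| "top_value (TypeD r) e c = c 2"
| "top_value TypeE6 e c = c 2"
| "top_value TypeE7 e c = c 1"
| "top_value TypeE8 e c = c 8"
| "top_value TypeF4 e c = (if e = 0 then 2 * c 1 else c 4)"
| "top_value TypeG2 e c = (if e = 0 then 3 * c 2 else c 1)"

lemma top_coeff_supported: "i \<notin> {1..type_rank X} \<Longrightarrow> top_coeff X e i = 0"
  by (cases X) auto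

lemma top_coeff_pos: "i \<in> {1..type_rank X} \<Longrightarrow> 0 < top_coeff X e i"
  by (cases X) (auto simp: nat_intervals simp del: One_nat_def)

definition iform :: "lie_type \<Rightarrow> (nat \<Rightarrow> int) \<Rightarrow> (nat \<Rightarrow> int) \<Rightarrow> int" where
  "iform X c c' = (\<Sum>j=1..type_rank X. c' j * root_scale X j * cpair X c j)"

lemma iform_delta:
  assumes "k \<in> {1..type_rank X}"
    and "\<And>j. j \<in> {1..type_rank X} \<Longrightarrow> root_scale X j * cpair X c j = (if j = k then t else 0)"
  shows "iform X c c' = t * c' k"
proof -
  have "iform X c c' = (\<Sum>j=1..type_rank X. if j = k then t * c' j else 0)"
    unfolding iform_def
  proof (rule sum.cong)
    fix j assume j: "j \<in> {1..type_rank X}"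
    show "c' j * root_scale X j * cpair X c j = (if j = k then t * c' j else 0)"
      unfolding mult.assoc assms(2)[OF j] by simp
  qed simp
  then show ?thesis using assms(1) by simp
qed

lemma iform_top_coeff:
  assumes "valid_type X"
  shows "iform X (top_coeff X e) c = top_value X e c"
proof (cases X)
  case (TypeA r)
  have r: "1 \<le> r" using assms TypeA by simp
  have "iform X (top_coeff X e) c = (\<Sum>j=1..r. (if j = 1 then c j else 0) + (if j = r then c j else 0))"
    unfolding iform_def TypeA type_rank.simps
    by (rule sum.cong, simp, subst cpair_TypeA[unfolded type_rank.simps]) auto
  then show ?thesis using r by (simp add: TypeA sum.distrib)
next
  case (TypeB r)
  have r: "2 \<le> r" using assms TypeB by simp
  show ?thesis
  proof (cases "e = 0")
    case True
    have "iform X (top_coeff X e) c = 2 * c 2" unfolding TypeB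
      by (rule iform_delta, use r in simp, subst cpair_TypeB) (use r True in \<open>auto split: if_splits\<close>)
    then show ?thesis by (simp add: TypeB True)
  next
    case False
    have "iform X (top_coeff X e) c = 2 * c 1" unfolding TypeB
      by (rule iform_delta, use r in simp, subst cpair_TypeB) (use r False in \<open>auto split: if_splits\<close>)
    then show ?thesis by (simp add: TypeB False)
  qed
next
  case (TypeC r)
  have r: "2 \<le> r" using assms TypeC by simp
  show ?thesis
  proof (cases "e = 0")
    case True
    have "iform X (top_coeff X e) c = 2 * c 1" unfolding TypeC
      by (rule iform_delta, use r in simp, subst cpair_TypeC) (use r True in \<open>auto split: if_splits\<close>)
    then show ?thesis by (simp add: TypeC True)
  next
    case False
    show ?thesis
    proof (cases "r = 2")
      case True
      have "iform X (top_coeff X e) c = 2 * c 2" unfolding TypeC True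
        by (rule iform_delta, simp, subst cpair_TypeC)
          (use False in \<open>auto simp: nat_intervals simp del: One_nat_def\<close>)
      then show ?thesis by (simp add: TypeC True False)
    next
      case r3: False
      then have "3 \<le> r" using r by simp
      then obtain k where k: "r = k + 3" by (metis add.commute le_Suc_ex)
      have "iform X (top_coeff X e) c = 1 * c 2" unfolding TypeC
      proof (rule iform_delta)
        fix j assume j: "j \<in> {1..type_rank (TypeC r)}"
        have "cpair (TypeC r) (top_coeff (TypeC r) e) j = (if j = 2 then 1 else 0)"
          by (subst cpair_TypeC) (use j k False in auto)
        then show "root_scale (TypeC r) j * cpair (TypeC r) (top_coeff (TypeC r) e) j = (if j = 2 then 1 else 0)"
          using k by simp
      qed (simp add: k)
      then show ?thesis by (simp add: TypeC r3 False)
    qed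
  qed
next
  case (TypeD r)
  have "4 \<le> r" using assms TypeD by simp
  then obtain k where r: "r = k + 4" by (metis add.commute le_Suc_ex)
  have "iform X (top_coeff X e) c = 1 * c 2" unfolding TypeD
  proof (rule iform_delta)
    fix j assume j: "j \<in> {1..type_rank (TypeD r)}"
    have "cpair (TypeD r) (top_coeff (TypeD r) e) j = (if j = 2 then 1 else 0)"
      by (subst cpair_TypeD) (use j r in auto)
    then show "root_scale (TypeD r) j * cpair (TypeD r) (top_coeff (TypeD r) e) j = (if j = 2 then 1 else 0)"
      by simp
  qed (simp add: r)
  then show ?thesis by (simp add: TypeD)
next
  case TypeE6
  define P where "P j = cpair TypeE6 (top_coeff TypeE6 e) j" for j
  have "iform TypeE6 (top_coeff TypeE6 e) c = (\<Sum>j\<in>{1, 2, 3, 4, 5, 6}. c j * root_scale TypeE6 j * P j)"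
    by (simp only: iform_def P_def type_rank.simps nat_intervals)
  then show ?thesis unfolding TypeE6
    by (simp add: cpair_TypeE6[where c = "top_coeff TypeE6 e", folded P_def] del: One_nat_def)
next
  case TypeE7
  define P where "P j = cpair TypeE7 (top_coeff TypeE7 e) j" for j
  have "iform TypeE7 (top_coeff TypeE7 e) c = (\<Sum>j\<in>{1, 2, 3, 4, 5, 6, 7}. c j * root_scale TypeE7 j * P j)"
    by (simp only: iform_def P_def type_rank.simps nat_intervals)
  then show ?thesis unfolding TypeE7
    by (simp add: cpair_TypeE7[where c = "top_coeff TypeE7 e", folded P_def] del: One_nat_def)
next
  case TypeE8
  define P where "P j = cpair TypeE8 (top_coeff TypeE8 e) j" for j
  have "iform TypeE8 (top_coeff TypeE8 e) c = (\<Sum>j\<in>{1, 2, 3, 4, 5, 6, 7, 8}. c j * root_scale TypeE8 j * P j)"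
    by (simp only: iform_def P_def type_rank.simps nat_intervals)
  then show ?thesis unfolding TypeE8
    by (simp add: cpair_TypeE8[where c = "top_coeff TypeE8 e", folded P_def] del: One_nat_def)
next
  case TypeF4
  define P where "P j = cpair TypeF4 (top_coeff TypeF4 e) j" for j
  have "iform TypeF4 (top_coeff TypeF4 e) c = (\<Sum>j\<in>{1, 2, 3, 4}. c j * root_scale TypeF4 j * P j)"
    by (simp only: iform_def P_def type_rank.simps nat_intervals)
  then show ?thesis unfolding TypeF4
    by (simp add: cpair_TypeF4[where c = "top_coeff TypeF4 e", folded P_def] del: One_nat_def)
next
  case TypeG2
  define P where "P j = cpair TypeG2 (top_coeff TypeG2 e) j" for j
  have "iform TypeG2 (top_coeff TypeG2 e) c = (\<Sum>j\<in>{1, 2}. c j * root_scale TypeG2 j * P j)"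
    by (simp only: iform_def P_def type_rank.simps nat_intervals)
  then show ?thesis unfolding TypeG2
    by (simp add: cpair_TypeG2[where c = "top_coeff TypeG2 e", folded P_def] del: One_nat_def)
qed

section \<open>Dominant vectors compared with the tabulated roots\<close>

lemma top_value_top_coeff:
  assumes "valid_type X"
  shows "top_value X e (top_coeff X e) = 2 * int (if e = 0 then lacing X else 1)"
  using assms by (cases X) auto

text \<open>Dominance along a chain is concavity: the increments do not grow, so a sequence that
  fails to increase at the step to \<open>a\<close> never increases afterwards.\<close>

lemma concave_bound:
  fixes c :: "nat \<Rightarrow> int"
  assumes "\<And>i. a \<le> i \<Longrightarrow> i < n \<Longrightarrow> c (i - 1) + c (i + 1) \<le> 2 * c i" "c a \<le> c (a - 1)" "a \<le> i" "i \<le> n"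
  shows "c i \<le> c (i - 1) \<and> c i \<le> c a"
  using assms(3,4)
proof (induction rule: dec_induct)
  case (step i)
  then show ?case using assms(1)[of i] by simp
qed (use assms(2) in simp)

text \<open>In the next four lemmas the \<open>a\<^sub>i\<close> are the values of a vector \<open>c\<close> at the simple coroots; the
  equations are rows of the inverse Cartan matrix, cleared of denominators.\<close>

lemma E6_integrality:
  fixes a1 a2 a3 a4 a5 a6 c1 c2 :: int
  assumes "0 \<le> a1" "0 \<le> a2" "0 \<le> a3" "0 \<le> a4" "0 \<le> a5" "0 \<le> a6" "1 \<le> c2"
    and c2: "c2 = a1 + 2 * a2 + 2 * a3 + 3 * a4 + 2 * a5 + a6"
    and c1: "3 * c1 = 4 * a1 + 3 * a2 + 5 * a3 + 6 * a4 + 4 * a5 + 2 * a6"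
  shows "2 \<le> c2"
proof (rule ccontr)
  assume "\<not> 2 \<le> c2"
  then have "a2 \<le> 0" "a3 \<le> 0" "a4 \<le> 0" "a5 \<le> 0" "c2 = 1" using assms by linarith+
  then have "a2 = 0" "a3 = 0" "a4 = 0" "a5 = 0" "c2 = 1" using assms by linarith+
  then have "a6 = 1 - a1" "3 * c1 = 2 + 2 * a1" "a1 \<le> 1" using assms by linarith+
  then show False using assms(1) by presburger
qed

lemma E7_integrality:
  fixes a1 a2 a3 a4 a5 a6 a7 c1 c7 :: int
  assumes "0 \<le> a1" "0 \<le> a2" "0 \<le> a3" "0 \<le> a4" "0 \<le> a5" "0 \<le> a6" "0 \<le> a7" "1 \<le> c1"
    and c1: "c1 = 2 * a1 + 2 * a2 + 3 * a3 + 4 * a4 + 3 * a5 + 2 * a6 + a7"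
    and c7: "2 * c7 = 2 * a1 + 3 * a2 + 4 * a3 + 6 * a4 + 5 * a5 + 4 * a6 + 3 * a7"
  shows "2 \<le> c1"
proof (rule ccontr)
  assume "\<not> 2 \<le> c1"
  then have "a1 \<le> 0" "a2 \<le> 0" "a3 \<le> 0" "a4 \<le> 0" "a5 \<le> 0" "a6 \<le> 0" "c1 = 1" using assms by linarith+
  then have "a1 = 0" "a2 = 0" "a3 = 0" "a4 = 0" "a5 = 0" "a6 = 0" "c1 = 1" using assms by linarith+
  then have "2 * c7 = 3" using assms by linarith
  then show False by presburger
qed

lemma E8_integrality:
  fixes a1 a2 a3 a4 a5 a6 a7 a8 c8 :: int
  assumes "0 \<le> a1" "0 \<le> a2" "0 \<le> a3" "0 \<le> a4" "0 \<le> a5" "0 \<le> a6" "0 \<le> a7" "0 \<le> a8" "1 \<le> c8"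
    and c8: "c8 = 2 * a1 + 3 * a2 + 4 * a3 + 6 * a4 + 5 * a5 + 4 * a6 + 3 * a7 + 2 * a8"
  shows "2 \<le> c8"
proof (rule ccontr)
  assume "\<not> 2 \<le> c8"
  then have "a1 \<le> 0" "a2 \<le> 0" "a3 \<le> 0" "a4 \<le> 0" "a5 \<le> 0" "a6 \<le> 0" "a7 \<le> 0" "a8 \<le> 0"
    using assms by linarith+
  then show False using assms by linarith
qed

lemma F4_long_integrality:
  fixes a1 a2 a3 a4 c1 :: int
  assumes "0 \<le> a1" "0 \<le> a2" "0 \<le> a3" "0 \<le> a4" "1 \<le> c1" "c1 = 2 * a1 + 3 * a2 + 2 * a3 + a4" "\<not> 2 \<le> c1"
  shows "a1 = 0" "a2 = 0" "a3 = 0" "a4 = 1"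
proof -
  have "a1 \<le> 0" "a2 \<le> 0" "a3 \<le> 0" using assms by linarith+
  then show "a1 = 0" "a2 = 0" "a3 = 0" "a4 = 1" using assms by linarith+
qed

text \<open>Where coefficients at least 1 do not suffice, it remains to exclude the value 1 of one
  coefficient. In the chains that value keeps the following coefficients at 1, up to the end or the
  branch. In the exceptional types the inverse Cartan matrix excludes it or, for e = 0 in F4 and G2,
  leaves only the highest short root, which the norm rules out. For long roots of type C the norm
  alone is too weak, and the parity \<open>par\<close> steps in.\<close>

lemma top_value_bound:
  assumes X: "valid_type X" and supp: "\<And>i. i \<notin> {1..type_rank X} \<Longrightarrow> c i = 0"
    and ge1: "\<And>i. i \<in> {1..type_rank X} \<Longrightarrow> 1 \<le> c i"
    and dom: "\<And>j. j \<in> {1..type_rank X} \<Longrightarrow> 0 \<le> cpair X c j"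
    and norm: "iform X c c = 2 * int (if e = 0 then lacing X else 1)"
    and par: "\<And>r. X = TypeC r \<Longrightarrow> e = 0 \<Longrightarrow> even (c 1)"
  shows "2 * int (if e = 0 then lacing X else 1) \<le> top_value X e c"
proof (cases X)
  case (TypeA r)
  then show ?thesis using ge1[of 1] ge1[of r] X by simp
next
  case (TypeB r)
  have r: "2 \<le> r" using X TypeB by simp
  have dom': "0 \<le> (if j = r then 2 * c r - 2 * c (r - 1) else 2 * c j - c (j - 1) - c (j + 1))"
    if "j \<in> {1..r}" for j
    using dom[of j] cpair_TypeB[of r c j] supp that by (simp add: TypeB)
  show ?thesis
  proof (cases "e = 0")
    case False
    then show ?thesis using ge1[of 1] r by (simp add: TypeB)
  next
    case True
    have "2 \<le> c 2"
    proof (rule ccontr)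
      assume "\<not> 2 \<le> c 2"
      then have c2: "c 2 = 1" using ge1[of 2] r by (simp add: TypeB)
      have "1 \<le> c 3" if "r \<noteq> 2" using ge1[of 3] r that by (simp add: TypeB)
      then have c1: "c 1 = 1" using dom'[of 2] r ge1[of 1] c2
        by (cases "r = 2") (auto simp: TypeB eval_nat_numeral)
      have "c i \<le> 1" if "2 \<le> i" "i \<le> r" for i
      proof -
        have "c (j - 1) + c (j + 1) \<le> 2 * c j" if "2 \<le> j" "j < r" for j
          using dom'[of j] that by simp
        moreover have "c 2 \<le> c (2 - 1)" using c1 c2 by simp
        ultimately have "c i \<le> c 2" using concave_bound[of 2 r c i] that by blast
        then show ?thesis using c2 by simp
      qed
      then have "c i \<le> 1" if "i \<in> {1..r}" for i
        using c1 that by (cases "i = 1") auto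
      then have "c i = 1" if "i \<in> {1..r}" for i
        using ge1[of i] that TypeB by (intro antisym) simp_all
      \<comment> \<open>This is the highest short root, of squared length 2 where 4 is
        required.\<close>
      then have "c = top_coeff X 1" using supp by (auto simp: TypeB)
      then have "iform X c c = 2" using iform_top_coeff[OF X, of 1 c] c1 by (simp add: TypeB)
      then show False using norm True by (simp add: TypeB)
    qed
    then show ?thesis by (simp add: True TypeB)
  qed
next
  case (TypeC r)
  have r: "2 \<le> r" using X TypeC by simp
  have dom': "0 \<le> 2 * c j - c (j - 1) - (if j + 1 = r then 2 else 1) * c (j + 1)"
    if "j \<in> {1..r}" for j
    using dom[of j] cpair_TypeC[of r c j] supp that by (simp add: TypeC)
  show ?thesis
  proof (cases "e = 0")
    case True
    then show ?thesis using par[OF TypeC True] ge1[of 1] r by (auto simp: TypeC elim!: evenE)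
  next
    case False
    show ?thesis
    proof (cases "r = 2")
      case True
      then show ?thesis using False ge1[of 2] by (simp add: TypeC)
    next
      case r3: False
      have "2 \<le> c 2"
      proof (rule ccontr)
        assume "\<not> 2 \<le> c 2"
        then have c2: "c 2 = 1" using ge1[of 2] r by (simp add: TypeC)
        have c: "c i \<le> 1" if "2 \<le> i" "i \<le> r - 1" for i
        proof -
          have "c (j - 1) + c (j + 1) \<le> 2 * c j" if "2 \<le> j" "j < r - 1" for j
          proof -
            have "j \<in> {1..r}" "j + 1 \<noteq> r" using that by auto
            then show ?thesis using dom'[of j] by simp
          qed
          moreover have "c 2 \<le> c (2 - 1)" using c2 ge1[of 1] r by (simp add: TypeC)
          ultimately have "c i \<le> c 2" using concave_bound[of 2 "r - 1" c i] that by blast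
          then show ?thesis using c2 by simp
        qed
        \<comment> \<open>The pairing at the vertex next to the double bond would be at most 2 - 1 -
          2.\<close>
        have "c (r - 1) \<le> 1" using c[of "r - 1"] r r3 by simp
        moreover have "1 \<le> c (r - 2)" "1 \<le> c r" using ge1[of "r - 2"] ge1[of r] r r3 by (simp_all add: TypeC)
        moreover have "r - 1 \<in> {1..r}" "r - 1 + 1 = r" "r - 1 - 1 = r - 2" using r r3 by auto
        ultimately show False using dom'[of "r - 1"] by simp
      qed
      then show ?thesis by (simp add: False TypeC)
    qed
  qed
next
  case (TypeD r)
  have r: "4 \<le> r" using X TypeD by simp
  have dom': "0 \<le> 2 * c j - c (j - 1) - c (j + 1) - (if j + 2 = r then c r else 0)"
    if "1 \<le> j" "j \<le> r - 2" for j
  proof -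
    have j: "j \<in> {1..r}" "j \<noteq> r" "j + 1 \<noteq> r" using that r by auto
    have "cpair (TypeD r) c j = 2 * c j - c (j - 1) - c (j + 1) - (if j + 2 = r then c r else 0)"
      using supp j r by (subst cpair_TypeD) (simp_all add: TypeD)
    then show ?thesis using dom[of j] j unfolding TypeD by simp
  qed
  have "2 \<le> c 2"
  proof (rule ccontr)
    assume "\<not> 2 \<le> c 2"
    then have c2: "c 2 = 1" using ge1[of 2] r by (simp add: TypeD)
    have c: "c i \<le> 1" if "2 \<le> i" "i \<le> r - 2" for i
    proof -
      have "c (j - 1) + c (j + 1) \<le> 2 * c j" if "2 \<le> j" "j < r - 2" for j
      proof -
        have "1 \<le> j" "j \<le> r - 2" "j + 2 \<noteq> r" using that by auto
        then show ?thesis using dom'[of j] by simp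
      qed
      moreover have "c 2 \<le> c (2 - 1)" using c2 ge1[of 1] r by (simp add: TypeD)
      ultimately have "c i \<le> c 2" using concave_bound[of 2 "r - 2" c i] that by blast
      then show ?thesis using c2 by simp
    qed
    \<comment> \<open>The branch vertex has three neighbours with coefficients at least 1, so its
      pairing would be at most 2 - 3.\<close>
    have "c (r - 2) \<le> 1" using c[of "r - 2"] r by simp
    moreover have "1 \<le> c (r - 2 - 1)" "1 \<le> c (r - 2 + 1)" "1 \<le> c r"
      using ge1[of "r - 2 - 1"] ge1[of "r - 2 + 1"] ge1[of r] r by (simp_all add: TypeD)
    moreover have "r - 2 + 2 = r" using r by simp
    ultimately show False using dom'[of "r - 2"] r by simp
  qed
  then show ?thesis by (simp add: TypeD)
next
  case TypeE6
  let ?a = "\<lambda>j. cpair TypeE6 c j"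
  have a: "0 \<le> ?a j" if "j \<in> {1, 2, 3, 4, 5, 6}" for j
    using dom[of j] that unfolding TypeE6 type_rank.simps nat_intervals by blast
  have a1: "0 \<le> ?a 1" and a2: "0 \<le> ?a 2" and a3: "0 \<le> ?a 3" and a4: "0 \<le> ?a 4" and a5: "0 \<le> ?a 5" and a6: "0 \<le> ?a 6"
    by (rule a, blast)+
  have c2: "c 2 = ?a 1 + 2 * ?a 2 + 2 * ?a 3 + 3 * ?a 4 + 2 * ?a 5 + ?a 6"
    unfolding cpair_TypeE6 by simp
  have c1: "3 * c 1 = 4 * ?a 1 + 3 * ?a 2 + 5 * ?a 3 + 6 * ?a 4 + 4 * ?a 5 + 2 * ?a 6"
    unfolding cpair_TypeE6 by simp
  have "1 \<le> c 2" using ge1[of 2] by (simp add: TypeE6)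
  then have "2 \<le> c 2"
    by (rule E6_integrality[OF a1 a2 a3 a4 a5 a6 _ c2 c1])
  then show ?thesis by (simp add: TypeE6)
next
  case TypeE7
  let ?a = "\<lambda>j. cpair TypeE7 c j"
  have a: "0 \<le> ?a j" if "j \<in> {1, 2, 3, 4, 5, 6, 7}" for j
    using dom[of j] that unfolding TypeE7 type_rank.simps nat_intervals by blast
  have a1: "0 \<le> ?a 1" and a2: "0 \<le> ?a 2" and a3: "0 \<le> ?a 3" and a4: "0 \<le> ?a 4" and a5: "0 \<le> ?a 5" and a6: "0 \<le> ?a 6" and a7: "0 \<le> ?a 7"
    by (rule a, blast)+
  have c1: "c 1 = 2 * ?a 1 + 2 * ?a 2 + 3 * ?a 3 + 4 * ?a 4 + 3 * ?a 5 + 2 * ?a 6 + ?a 7"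
    unfolding cpair_TypeE7 by simp
  have c7: "2 * c 7 = 2 * ?a 1 + 3 * ?a 2 + 4 * ?a 3 + 6 * ?a 4 + 5 * ?a 5 + 4 * ?a 6 + 3 * ?a 7"
    unfolding cpair_TypeE7 by simp
  have "1 \<le> c 1" using ge1[of 1] by (simp add: TypeE7)
  then have "2 \<le> c 1"
    by (rule E7_integrality[OF a1 a2 a3 a4 a5 a6 a7 _ c1 c7])
  then show ?thesis by (simp add: TypeE7)
next
  case TypeE8
  let ?a = "\<lambda>j. cpair TypeE8 c j"
  have a: "0 \<le> ?a j" if "j \<in> {1, 2, 3, 4, 5, 6, 7, 8}" for j
    using dom[of j] that unfolding TypeE8 type_rank.simps nat_intervals by blast
  have a1: "0 \<le> ?a 1" and a2: "0 \<le> ?a 2" and a3: "0 \<le> ?a 3" and a4: "0 \<le> ?a 4" and a5: "0 \<le> ?a 5" and a6: "0 \<le> ?a 6" and a7: "0 \<le> ?a 7" and a8: "0 \<le> ?a 8"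
    by (rule a, blast)+
  have c8: "c 8 = 2 * ?a 1 + 3 * ?a 2 + 4 * ?a 3 + 6 * ?a 4 + 5 * ?a 5 + 4 * ?a 6 + 3 * ?a 7 + 2 * ?a 8"
    unfolding cpair_TypeE8 by simp
  have "1 \<le> c 8" using ge1[of 8] by (simp add: TypeE8)
  then have "2 \<le> c 8"
    by (rule E8_integrality[OF a1 a2 a3 a4 a5 a6 a7 a8 _ c8])
  then show ?thesis by (simp add: TypeE8)
next
  case TypeF4
  let ?a = "\<lambda>j. cpair TypeF4 c j"
  have a: "0 \<le> ?a j" if "j \<in> {1, 2, 3, 4}" for j
    using dom[of j] that unfolding TypeF4 type_rank.simps nat_intervals by blast
  have a1: "0 \<le> ?a 1" and a2: "0 \<le> ?a 2" and a3: "0 \<le> ?a 3" and a4: "0 \<le> ?a 4"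
    by (rule a, blast)+
  have c1: "c 1 = 2 * ?a 1 + 3 * ?a 2 + 2 * ?a 3 + ?a 4" unfolding cpair_TypeF4 by simp
  have c4: "c 4 = 2 * ?a 1 + 4 * ?a 2 + 3 * ?a 3 + 2 * ?a 4" unfolding cpair_TypeF4 by simp
  have c1_pos: "1 \<le> c 1" and c4_pos: "1 \<le> c 4" using ge1[of 1] ge1[of 4] by (simp_all add: TypeF4)
  show ?thesis
  proof (cases "e = 0")
    case True
    have "2 \<le> c 1"
    proof (rule ccontr)
      assume "\<not> 2 \<le> c 1"
      then have z: "?a 1 = 0" "?a 2 = 0" "?a 3 = 0" "?a 4 = 1"
        using F4_long_integrality[OF a1 a2 a3 a4 c1_pos c1] by blast+
      \<comment> \<open>These pairings belong to the highest short root; its squared length is 2,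
        not 4.\<close>
      then have "c 4 = 2" using c4 by linarith
      define P where "P j = ?a j" for j
      have "iform TypeF4 c c = (\<Sum>j\<in>{1, 2, 3, 4}. c j * root_scale TypeF4 j * P j)"
        by (simp only: iform_def P_def type_rank.simps nat_intervals)
      then have "iform TypeF4 c c = 2"
        using z[folded P_def] \<open>c 4 = 2\<close> by (simp del: One_nat_def)
      then show False using norm True by (simp add: TypeF4)
    qed
    then show ?thesis by (simp add: True TypeF4)
  next
    case False
    have "2 \<le> c 4"
    proof (rule ccontr)
      assume "\<not> 2 \<le> c 4"
      then have "?a 1 \<le> 0" "?a 2 \<le> 0" "?a 3 \<le> 0" "?a 4 \<le> 0" using c4 a1 a2 a3 a4 by linarith+
      then show False using c4 c4_pos by linarith
    qed
    then show ?thesis by (simp add: False TypeF4)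
  qed
next
  case TypeG2
  let ?a = "\<lambda>j. cpair TypeG2 c j"
  have a: "0 \<le> ?a j" if "j \<in> {1, 2}" for j
    using dom[of j] that unfolding TypeG2 type_rank.simps nat_intervals by blast
  have a1: "0 \<le> ?a 1" and a2: "0 \<le> ?a 2"
    by (rule a, blast)+
  have c1: "c 1 = 2 * ?a 1 + 3 * ?a 2" and c2: "c 2 = ?a 1 + 2 * ?a 2"
    unfolding cpair_TypeG2 by simp_all
  have c1_pos: "1 \<le> c 1" and c2_pos: "1 \<le> c 2" using ge1[of 1] ge1[of 2] by (simp_all add: TypeG2)
  show ?thesis
  proof (cases "e = 0")
    case True
    have "2 \<le> c 2"
    proof (rule ccontr)
      assume "\<not> 2 \<le> c 2"
      moreover from this have "?a 2 \<le> 0" using c2 a1 by linarith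
      ultimately have z: "?a 1 = 1" "?a 2 = 0" using c2 c2_pos a1 a2 by linarith+
      \<comment> \<open>Again the highest short root, of squared length 2 instead of 6.\<close>
      then have "c 1 = 2" using c1 by linarith
      define P where "P j = ?a j" for j
      have "iform TypeG2 c c = (\<Sum>j\<in>{1, 2}. c j * root_scale TypeG2 j * P j)"
        by (simp only: iform_def P_def type_rank.simps nat_intervals)
      then have "iform TypeG2 c c = 2"
        using z[folded P_def] \<open>c 1 = 2\<close> by (simp del: One_nat_def)
      then show False using norm True by (simp add: TypeG2)
    qed
    then show ?thesis by (simp add: True TypeG2)
  next
    case False
    have "2 \<le> c 1"
    proof (rule ccontr)
      assume "\<not> 2 \<le> c 1"
      then have "?a 1 \<le> 0" "?a 2 \<le> 0" using c1 a1 a2 by linarith+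
      then show False using c1 c1_pos by linarith
    qed
    then show ?thesis by (simp add: False TypeG2)
  qed
qed

section \<open>Label weights and minimal levels\<close>

lemma mset_interval_ends:
  fixes r :: nat
  assumes "2 \<le> r"
  shows "mset_set {1..r} = {#1, r#} + mset_set {2..<r}"
proof -
  have "{1..r} = insert 1 (insert r {2..<r})" using assms by auto
  then show ?thesis using assms by (simp del: One_nat_def)
qed

lemma mset_interval_D:
  fixes r :: nat
  assumes "4 \<le> r"
  shows "mset_set {1..r} = {#1, r - 1, r#} + mset_set {2..<r - 1}"
proof -
  have "{1..r} = insert 1 (insert (r - 1) (insert r {2..<r - 1}))" using assms by auto
  then show ?thesis using assms by (simp del: One_nat_def)
qed

lemma image_mset_const:
  assumes "\<And>i. i \<in> I \<Longrightarrow> f i = k"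
  shows "image_mset f (mset_set I) = replicate_mset (card I) k"
proof (cases "finite I")
  case True
  then have "image_mset f (mset_set I) = image_mset (\<lambda>_. k) (mset_set I)"
    using assms by (intro image_mset_cong) simp
  then show ?thesis by (simp add: image_mset_const_eq)
qed simp

text \<open>This is \<langle>\<lambda>_i, \<theta>\<rangle>, because \<langle>\<lambda>_i,
  \<alpha>_j\<rangle> is \<open>root_scale X i\<close> for j = i and 0 otherwise.\<close>

definition label_weight :: "lie_type \<Rightarrow> nat \<Rightarrow> nat \<Rightarrow> nat" where
  "label_weight X e i = nat (top_coeff X e i * root_scale X i)"

lemma label_weight_pos: "i \<in> {1..type_rank X} \<Longrightarrow> 0 < label_weight X e i"
  using top_coeff_pos[of i X e] root_scale_pos[of X i] by (simp add: label_weight_def)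

lemma image_mset_label_weight:
  assumes "valid_type X"
  shows "image_mset (label_weight X e) (mset_set {1..type_rank X}) = exponents_table X e"
proof (cases X)
  case (TypeA r)
  then show ?thesis
    using image_mset_const[of "{1..r}" "label_weight X e" 1] by (simp add: label_weight_def)
next
  case (TypeB r)
  have r: "2 \<le> r" using assms TypeB by simp
  have "image_mset (label_weight X e) (mset_set {2..<r}) = replicate_mset (r - 2) (if e = 0 then 4 else 2)"
    using image_mset_const[of "{2..<r}" "label_weight X e"] by (simp add: TypeB label_weight_def)
  then show ?thesis using r unfolding TypeB type_rank.simps mset_interval_ends[OF r]
    by (cases r; cases "r - 1") (auto simp: label_weight_def)
next
  case (TypeC r)
  have r: "2 \<le> r" using assms TypeC by simp
  have "image_mset (label_weight X e) (mset_set {2..<r}) = replicate_mset (r - 2) 2"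
    using image_mset_const[of "{2..<r}" "label_weight X e"] by (simp add: TypeC label_weight_def)
  then show ?thesis using r unfolding TypeC type_rank.simps mset_interval_ends[OF r]
    by (cases r; cases "r - 1") (auto simp: label_weight_def)
next
  case (TypeD r)
  have r: "4 \<le> r" using assms TypeD by simp
  have "image_mset (label_weight X e) (mset_set {2..<r - 1}) = replicate_mset (card {2..<r - 1}) 2"
    by (rule image_mset_const) (auto simp: TypeD label_weight_def)
  also have "card {2..<r - 1} = r - 3" by simp
  finally have "image_mset (label_weight X e) (mset_set {2..<r - 1}) = replicate_mset (r - 3) 2" .
  then show ?thesis using r unfolding TypeD type_rank.simps mset_interval_D[OF r]
    by (auto simp: label_weight_def)
qed (simp_all add: nat_intervals label_weight_def flip: One_nat_def)

text \<open>The sum is \<langle>\<rho>, \<theta>\<rangle>. The hypothesis on \<open>e\<close> leaves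
  out the simply-laced types with \<open>e \<noteq> 0\<close>, for which the tables ignore
  \<open>e\<close>.\<close>

lemma sum_label_weight:
  assumes "valid_type X" "e = 0 \<or> 1 < lacing X"
  shows "(\<Sum>i=1..type_rank X. label_weight X e i) + (if e = 0 then lacing X else 2) = min_level X e"
proof -
  have "(\<Sum>i=1..type_rank X. label_weight X e i) = sum_mset (exponents_table X e)"
    unfolding image_mset_label_weight[OF assms(1), symmetric] by (rule sum_unfold_sum_mset)
  then show ?thesis using assms by (cases X) (auto simp: algebra_simps)
qed

text \<open>For the long root \<theta>, \<langle>\<lambda>_i, \<theta>\<rangle> is m times the
  integer value of \<lambda>_i at the coroot of \<theta>.\<close>

lemma lacing_dvd_label_weight:
  assumes "valid_type X" "i \<in> {1..type_rank X}"
  shows "lacing X dvd label_weight X 0 i"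
  using assms by (cases X) (auto simp: label_weight_def nat_intervals simp del: One_nat_def)

lemma top_coeff_le: "top_coeff X 1 i \<le> top_coeff X 0 i"
  by (cases X) (auto simp: nat_intervals simp del: One_nat_def)


section \<open>Linear systems and generating functions\<close>

text \<open>The hypothesis speaks of combinations of rows, so it is the determinant of the transpose
  that is seen to be nonzero. Vertices start at 1 and matrix indices at 0, whence the
  shifts.\<close>

lemma square_system_inverse:
  fixes M :: "nat \<Rightarrow> nat \<Rightarrow> 'a::field"
  assumes inj: "\<And>c i. (\<And>j. j \<in> {1..r} \<Longrightarrow> (\<Sum>i=1..r. c i * M i j) = 0) \<Longrightarrow> i \<in> {1..r} \<Longrightarrow> c i = 0"
  shows "\<exists>B.
    (\<forall>i\<in>{1..r}. \<forall>k\<in>{1..r}. (\<Sum>j=1..r. B i j * M j k) = (if i = k then 1 else 0)) \<and>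
    (\<forall>i\<in>{1..r}. \<forall>k\<in>{1..r}. (\<Sum>j=1..r. M i j * B j k) = (if i = k then 1 else 0))"
proof -
  define A where "A = mat r r (\<lambda>(i, j). M (Suc i) (Suc j))"
  have A: "A \<in> carrier_mat r r" by (simp add: A_def)
  have "det A\<^sup>T \<noteq> 0"
  proof
    assume "det A\<^sup>T = 0"
    then obtain v where v: "v \<in> carrier_vec r" "v \<noteq> 0\<^sub>v r" "A\<^sup>T *\<^sub>v v = 0\<^sub>v r"
      using det_0_iff_vec_prod_zero[of "A\<^sup>T" r] A by auto
    define c where "c i = vec_index v (i - 1)" for i
    have "(\<Sum>i=1..r. c i * M i j) = 0" if j: "j \<in> {1..r}" for j
    proof -
      have "j - 1 < r" using j by auto
      then have "vec_index (A\<^sup>T *\<^sub>v v) (j - 1) = 0" unfolding v(3) by simp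
      moreover have "vec_index (A\<^sup>T *\<^sub>v v) (j - 1) = (\<Sum>i<r. M (Suc i) j * vec_index v i)"
        using A j v(1) by (auto simp: A_def scalar_prod_def lessThan_atLeast0 intro!: sum.cong)
      ultimately show ?thesis by (simp add: sum.atLeast1_atMost_eq c_def mult.commute)
    qed
    then have zero: "c i = 0" if "i \<in> {1..r}" for i using inj that by blast
    have "v = 0\<^sub>v r"
    proof
      fix i assume "i < dim_vec (0\<^sub>v r :: 'a vec)"
      then show "vec_index v i = vec_index (0\<^sub>v r) i" using zero[of "Suc i"] by (simp add: c_def)
    qed (use v(1) in simp)
    then show False using v(2) by blast
  qed
  then have "A \<in> Units (ring_mat TYPE('a) r ())"
    using det_non_zero_imp_unit[OF A, of "()"] det_transpose[OF A] by simp
  then obtain B where B: "B \<in> carrier_mat r r" "B * A = 1\<^sub>m r" "A * B = 1\<^sub>m r"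
    unfolding Units_def ring_mat_def by auto
  define B' where "B' i j = B $$ (i - 1, j - 1)" for i j
  have entry: "(\<Sum>j=1..r. P $$ (i - 1, j - 1) * Q $$ (j - 1, k - 1)) = (if i = k then 1 else 0)"
    if "P \<in> carrier_mat r r" "Q \<in> carrier_mat r r" "P * Q = 1\<^sub>m r" "i \<in> {1..r}" "k \<in> {1..r}"
    for P Q :: "'a mat" and i k
  proof -
    have "i - 1 < r" "k - 1 < r" using that(4,5) by auto
    then have "(P * Q) $$ (i - 1, k - 1) = (\<Sum>j<r. P $$ (i - 1, j) * Q $$ (j, k - 1))"
      using that(1,2) by (simp add: scalar_prod_def lessThan_atLeast0)
    moreover have "(1\<^sub>m r :: 'a mat) $$ (i - 1, k - 1) = (if i = k then 1 else 0)"
      using that(4,5) by auto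
    ultimately show ?thesis unfolding that(3) by (simp add: sum.atLeast1_atMost_eq)
  qed
  have M: "M i j = A $$ (i - 1, j - 1)" if "i \<in> {1..r}" "j \<in> {1..r}" for i j
    using that by (auto simp: A_def)
  show ?thesis
  proof (intro exI[of _ B'] conjI ballI)
    fix i k assume ik: "i \<in> {1..r}" "k \<in> {1..r}"
    have "(\<Sum>j=1..r. B' i j * M j k) = (\<Sum>j=1..r. B $$ (i - 1, j - 1) * A $$ (j - 1, k - 1))"
      using ik by (intro sum.cong) (simp_all only: B'_def M)
    then show "(\<Sum>j=1..r. B' i j * M j k) = (if i = k then 1 else 0)"
      using entry[OF B(1) A B(2) ik] by simp
    have "(\<Sum>j=1..r. M i j * B' j k) = (\<Sum>j=1..r. A $$ (i - 1, j - 1) * B $$ (j - 1, k - 1))"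
      using ik by (intro sum.cong) (simp_all only: B'_def M)
    then show "(\<Sum>j=1..r. M i j * B' j k) = (if i = k then 1 else 0)"
      using entry[OF A B(1) B(3) ik] by simp
  qed
qed

section \<open>Weighted lattice points and their generating function\<close>

definition bounded_sums :: "nat set \<Rightarrow> (nat \<Rightarrow> nat) \<Rightarrow> nat \<Rightarrow> (nat \<Rightarrow> nat) set" where
  "bounded_sums I w n = {a. (\<forall>i. i \<notin> I \<longrightarrow> a i = 0) \<and> (\<Sum>i\<in>I. a i * w i) \<le> n}"

lemma finite_bounded_sums:
  assumes "finite I" "\<And>i. i \<in> I \<Longrightarrow> 0 < w i"
  shows "finite (bounded_sums I w n)"
proof (rule finite_subset)
  show "finite {a. \<forall>i. (i \<in> I \<longrightarrow> a i \<in> {..n}) \<and> (i \<notin> I \<longrightarrow> a i = (0::nat))}"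
    using assms(1) by (rule finite_set_of_finite_funs) simp
  have "a i \<le> n" if "(\<Sum>i\<in>I. a i * w i) \<le> n" "i \<in> I" for a i
  proof -
    have "a i \<le> a i * w i" using assms(2)[OF that(2)] by simp
    also have "\<dots> \<le> (\<Sum>i\<in>I. a i * w i)" using assms(1) that(2) by (intro member_le_sum) auto
    finally show ?thesis using that(1) by simp
  qed
  then show "bounded_sums I w n \<subseteq> {a. \<forall>i. (i \<in> I \<longrightarrow> a i \<in> {..n}) \<and> (i \<notin> I \<longrightarrow> a i = 0)}"
    by (auto simp: bounded_sums_def)
qed

text \<open>The vectors with \<open>a k = 0\<close> are those over \<open>I\<close>; in the others
  \<open>a k\<close> can be lowered by one, which lowers the bound by \<open>w k\<close>.\<close>

lemma card_bounded_sums_insert: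
  assumes "finite I" "k \<notin> I" "\<And>i. i \<in> insert k I \<Longrightarrow> 0 < w i"
  shows "card (bounded_sums (insert k I) w n) = card (bounded_sums I w n) +
    (if n < w k then 0 else card (bounded_sums (insert k I) w (n - w k)))"
proof -
  let ?G = "bounded_sums (insert k I) w"
  let ?s = "\<lambda>a. \<Sum>i\<in>I. a i * w i"
  have sum: "(\<Sum>i\<in>insert k I. a i * w i) = a k * w k + ?s a" for a
    using assms(1,2) by simp
  have upd: "?s (a(k := x)) = ?s a" for a x
    using assms(2) by (intro sum.cong) auto
  have memI: "a(k := x) \<in> ?G m" if "\<And>i. i \<notin> insert k I \<Longrightarrow> a i = 0" "x * w k + ?s a \<le> m" for a x m
  proof -
    have "(\<Sum>i\<in>insert k I. (a(k := x)) i * w i) = x * w k + ?s a"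
      unfolding sum upd by simp
    then show ?thesis using that unfolding bounded_sums_def by simp
  qed
  have memD: "a k * w k + ?s a \<le> m" "i \<notin> insert k I \<Longrightarrow> a i = 0" if "a \<in> ?G m" for a m i
    using that unfolding bounded_sums_def sum by auto
  define U where "U = {a \<in> ?G n. 0 < a k}"
  have zero: "{a \<in> ?G n. a k = 0} = bounded_sums I w n"
    using sum assms(2) by (auto simp: bounded_sums_def) metis
  have U: "U = (if n < w k then {} else (\<lambda>a. a(k := Suc (a k))) ` ?G (n - w k))"
  proof (cases "n < w k")
    case True
    have "a \<notin> U" for a
    proof
      assume "a \<in> U"
      then have "0 < a k" "a k * w k \<le> n" unfolding U_def bounded_sums_def sum by auto
      moreover have "w k \<le> a k * w k" using \<open>0 < a k\<close> by simp
      ultimately show False using True by simp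
    qed
    then show ?thesis using True by auto
  next
    case False
    have "a \<in> (\<lambda>a. a(k := Suc (a k))) ` ?G (n - w k)" if "a \<in> U" for a
    proof -
      have "0 < a k" using that by (simp add: U_def)
      then obtain x where x: "a k = Suc x" by (cases "a k") auto
      have "a = (a(k := x))(k := Suc ((a(k := x)) k))" using x by auto
      moreover have "a \<in> ?G n" using that by (simp add: U_def)
      then have "a(k := x) \<in> ?G (n - w k)"
        using memD[of a n] x by (intro memI) auto
      ultimately show ?thesis by (rule image_eqI)
    qed
    moreover have "a(k := Suc (a k)) \<in> U" if "a \<in> ?G (n - w k)" for a
    proof -
      have "a(k := Suc (a k)) \<in> ?G n"
        using memD[OF that] False by (intro memI) auto
      then show ?thesis by (simp add: U_def)
    qed
    ultimately show ?thesis using False by auto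
  qed
  have inj: "inj_on (\<lambda>a. a(k := Suc (a k))) (?G (n - w k))"
  proof (rule inj_onI)
    fix a b :: "nat \<Rightarrow> nat" assume "a(k := Suc (a k)) = b(k := Suc (b k))"
    then show "a = b" by (metis fun_upd_same fun_upd_triv fun_upd_upd nat.inject)
  qed
  have fin: "finite (?G n)" using assms by (intro finite_bounded_sums) auto
  have "?G n = {a \<in> ?G n. a k = 0} \<union> U" by (auto simp: U_def)
  then have "card (?G n) = card {a \<in> ?G n. a k = 0} + card U"
    using fin by (subst card_Un_disjoint[symmetric]) (auto simp: U_def)
  then show ?thesis unfolding zero U by (simp add: card_image[OF inj])
qed

text \<open>Compare coefficients in \<open>g = f + g * fps_X ^ w\<close>; the result has the shape
  of \<open>card_bounded_sums_insert\<close>.\<close>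

lemma fps_nth_over_one_minus_X_power:
  fixes f :: "'a::field fps"
  assumes "0 < w"
  shows "fps_nth (f * (1 / (1 - fps_X ^ w))) n =
    fps_nth f n + (if n < w then 0 else fps_nth (f * (1 / (1 - fps_X ^ w))) (n - w))"
proof -
  define g where "g = f * (1 / (1 - fps_X ^ w :: 'a fps))"
  have "fps_nth (1 - fps_X ^ w :: 'a fps) 0 \<noteq> 0" using assms by (simp add: fps_X_power_nth)
  then have "1 / (1 - fps_X ^ w) * (1 - fps_X ^ w) = (1 :: 'a fps)"
    by (simp add: fps_divide_unit inverse_mult_eq_1)
  then have "g * (1 - fps_X ^ w) = f" by (simp add: g_def mult.assoc)
  then have "f = g - g * fps_X ^ w" by (simp add: right_diff_distrib)
  then have "fps_nth f n = fps_nth g n - fps_nth (g * fps_X ^ w) n" by (metis fps_sub_nth)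
  then show ?thesis by (simp add: fps_X_power_mult_right_nth g_def)
qed

text \<open>When an index \<open>k\<close> is added, both sides obey the same recurrence in
  \<open>n\<close>, which terminates because \<open>w k > 0\<close>. The factor
  \<open>1 / (1 - fps_X)\<close> acts as a slack variable: it turns sums equal to \<open>n\<close>
  into sums at most \<open>n\<close>.\<close>

lemma card_bounded_sums_coefficient:
  fixes w :: "nat \<Rightarrow> nat"
  assumes "finite I" "\<And>i. i \<in> I \<Longrightarrow> 0 < w i"
  shows "fps_nth (1 / (1 - fps_X) * (\<Prod>i\<in>I. 1 / (1 - fps_X ^ w i))) n =
    (of_nat (card (bounded_sums I w n)) :: 'a::field)"
  using assms
proof (induction I arbitrary: n rule: finite_induct)
  case empty
  have "bounded_sums {} w n = {\<lambda>_. 0}" by (auto simp: bounded_sums_def)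
  moreover have "fps_nth (1 / (1 - fps_X)) n = (1 :: 'a)"
  proof (induction n)
    case 0
    then show ?case using fps_nth_over_one_minus_X_power[of 1 "1::'a fps" 0] by simp
  next
    case (Suc n)
    then show ?case using fps_nth_over_one_minus_X_power[of 1 "1::'a fps" "Suc n"] by simp
  qed
  ultimately show ?case by simp
next
  case (insert k I)
  define f :: "'a fps" where "f = 1 / (1 - fps_X) * (\<Prod>i\<in>I. 1 / (1 - fps_X ^ w i))"
  have eq: "1 / (1 - fps_X) * (\<Prod>i\<in>insert k I. 1 / (1 - fps_X ^ w i)) = f * (1 / (1 - fps_X ^ w k))"
    unfolding f_def prod.insert[OF insert.hyps] by (simp only: ac_simps)
  show ?case unfolding eq
  proof (induction n rule: less_induct)
    case (less n)
    have "fps_nth (f * (1 / (1 - fps_X ^ w k))) n = fps_nth f n +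
        (if n < w k then 0 else fps_nth (f * (1 / (1 - fps_X ^ w k))) (n - w k))"
      using insert.prems by (intro fps_nth_over_one_minus_X_power) simp
    also have "fps_nth f n = of_nat (card (bounded_sums I w n))"
      using insert.IH insert.prems by (simp add: f_def)
    also have "of_nat (card (bounded_sums I w n)) +
        (if n < w k then 0 else fps_nth (f * (1 / (1 - fps_X ^ w k))) (n - w k)) =
        (of_nat (card (bounded_sums (insert k I) w n)) :: 'a)"
      using less.IH[of "n - w k"] insert.prems[of k] card_bounded_sums_insert[OF insert.hyps insert.prems]
      by simp
    finally show ?case .
  qed
qed


section \<open>The root system of a simple Lie algebra\<close>

context root_coeffs begin

definition positive :: "(nat \<Rightarrow> int) set" where
  "positive = {c \<in> \<Phi>. \<forall>i. 0 \<le> c i}"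

text \<open>A positive root other than \<alpha>_i is not a multiple of it, so it has a positive
  coefficient elsewhere; \<open>refl i\<close> keeps that coefficient, hence the sign.\<close>

lemma refl_positive:
  assumes i: "i \<in> {1..r}" and c: "c \<in> positive - {unit_coeff i}"
  shows "refl i c \<in> positive - {unit_coeff i}"
proof -
  have cp: "c \<in> \<Phi>" "\<And>k. 0 \<le> c k" "c \<noteq> unit_coeff i" using c by (auto simp: positive_def)
  have "\<exists>k. k \<noteq> i \<and> 0 < c k"
  proof (rule ccontr)
    assume "\<not> (\<exists>k. k \<noteq> i \<and> 0 < c k)"
    then have z: "c k = 0" if "k \<noteq> i" for k using cp(2)[of k] that by force
    then have eq: "c = (\<lambda>k. c i * unit_coeff i k)" by (auto simp: unit_coeff_def fun_eq_iff)
    have "c i \<noteq> 0" using obtain_nonzero[OF cp(1)] z by metis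
    then have "0 < c i" using cp(2)[of i] by simp
    then have "c i = 1" using multiple[OF i, of "c i"] cp(1) eq by metis
    then show False using eq cp(3) by simp
  qed
  then obtain k where k: "k \<noteq> i" "0 < c k" by blast
  have ri: "refl i c \<in> \<Phi>" using cp(1) i by (rule refl_in)
  have "0 < refl i c k" using k by (simp add: refl_other)
  then have "\<forall>j. 0 \<le> refl i c j" using sign[OF ri] by (metis not_le)
  then have "refl i c \<in> positive" using ri by (simp add: positive_def)
  moreover have "refl i c \<noteq> unit_coeff i"
    using k by (metis refl_other unit_coeff_def less_irrefl)
  ultimately show ?thesis by blast
qed

text \<open>\<open>refl i\<close> permutes the positive roots other than \<alpha>_i and negates
  their pairing with the i-th coroot, so they cancel and only \<alpha>_i, with pairing 2,
  remains.\<close>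

lemma sum_positive_pairing:
  assumes i: "i \<in> {1..r}"
  shows "(\<Sum>c\<in>positive. pairing c i) = 2"
proof -
  let ?P = "positive - {unit_coeff i}"
  have fin: "finite positive" using finite_\<Phi> by (simp add: positive_def)
  have u: "unit_coeff i \<in> positive" using unit_in[OF i] by (simp add: positive_def unit_coeff_def)
  have "(\<Sum>c\<in>?P. pairing c i) = (\<Sum>c\<in>?P. pairing (refl i c) i)"
    by (rule sum.reindex_bij_witness[of _ "refl i" "refl i"])
      (use refl_positive[OF i] refl_refl[OF i] in auto)
  also have "\<dots> = (\<Sum>c\<in>?P. - pairing c i)"
    by (rule sum.cong) (simp_all add: refl_def pairing_diff pairing_unit[OF i] diagonal[OF i])
  finally have "(\<Sum>c\<in>?P. pairing c i) = 0" by (simp add: sum_negf)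
  then show ?thesis using sum.remove[OF fin u, of "\<lambda>c. pairing c i"]
    by (simp add: pairing_unit[OF i] diagonal[OF i])
qed

end

locale typed_frame =
  fixes D :: "'g::complex_lie_algebra root_frame" and X :: lie_type
  assumes simple: "simple_lie_algebra TYPE('g)"
    and frame: "simple_root_frame D"
    and valid: "valid_type X" and type: "has_type D X"
begin

abbreviation "H \<equiv> csa D"
abbreviation "r \<equiv> type_rank X"
abbreviation "\<alpha> \<equiv> sroot D"
abbreviation "h \<equiv> scoroot D"
abbreviation "A \<equiv> cartan_entry X"

lemma rnk: "rnk D = r"
  using type by (simp add: has_type_def)

lemma \<alpha>_h: "i \<in> {1..r} \<Longrightarrow> j \<in> {1..r} \<Longrightarrow> \<alpha> i (h j) = of_int (A i j)"
  using type rnk by (simp add: has_type_def)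

sublocale finite_lie_cartan H
  using frame simple by unfold_locales (auto simp: simple_root_frame_def simple_lie_algebra_def)

sublocale cartan_form r A "root_scale X"
  by (rule cartan_form_type[OF valid])

lemma \<alpha>_root: "i \<in> {1..r} \<Longrightarrow> \<alpha> i \<in> roots H"
  using frame rnk by (simp add: simple_root_frame_def root_base_def)

lemma \<alpha>_dual: "i \<in> {1..r} \<Longrightarrow> \<alpha> i \<in> dual_space H"
  using \<alpha>_root by (auto simp: roots_def)

lemma \<alpha>_independent:
  assumes "\<And>u. (\<Sum>i=1..r. c i * \<alpha> i u) = 0" "i \<in> {1..r}"
  shows "c i = 0"
  using frame rnk assms by (simp add: simple_root_frame_def root_base_def)

lemma ex_sl2_triple:
  assumes "i \<in> {1..r}"
  shows "\<exists>x y. sl2_triple H (\<alpha> i) x y (h i)"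
proof -
  have "is_coroot H (\<alpha> i) (h i)" using frame assms rnk by (simp add: simple_root_frame_def)
  then obtain x y where "h i \<in> H" "\<alpha> i (h i) = 2" "x \<in> root_space H (\<alpha> i)" "y \<in> root_space H (- \<alpha> i)" "h i = lie x y"
    unfolding is_coroot_def by blast
  then have "sl2_triple H (\<alpha> i) x y (h i)"
    using \<alpha>_dual[OF assms] by unfold_locales auto
  then show ?thesis by blast
qed

lemma h_in: "i \<in> {1..r} \<Longrightarrow> h i \<in> H"
  using ex_sl2_triple sl2_triple.h_in by blast

lemma root_reflection:
  assumes "\<beta> \<in> roots H" "i \<in> {1..r}"
  shows "(\<lambda>u. \<beta> u - \<beta> (h i) * \<alpha> i u) \<in> roots H"
proof -
  obtain x y where "sl2_triple H (\<alpha> i) x y (h i)" using ex_sl2_triple[OF assms(2)] by blast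
  then interpret sl2_triple H "\<alpha> i" x y "h i" .
  have "(\<lambda>u. \<beta> u - \<beta> (h i) * \<alpha> i u) \<in> weights H"
    using assms(1) by (intro weight_reflection) (simp add: roots_eq_weights)
  moreover have "(\<lambda>u. \<beta> u - \<beta> (h i) * \<alpha> i u) \<noteq> 0"
  proof
    assume z: "(\<lambda>u. \<beta> u - \<beta> (h i) * \<alpha> i u) = 0"
    \<comment> \<open>The reflected functional takes the value -\<beta>(h_i) at h_i.\<close>
    have "\<beta> (h i) = 0" using fun_cong[OF z, of "h i"] \<alpha>_h by simp
    then have "\<beta> = 0" using z by (simp add: fun_eq_iff)
    then show False using assms(1) by (simp add: roots_def)
  qed
  ultimately show ?thesis by (simp add: roots_eq_weights)
qed

section \<open>Roots as integer vectors\<close>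

definition comb :: "(nat \<Rightarrow> int) \<Rightarrow> 'g \<Rightarrow> complex" where
  "comb c = int_comb r c \<alpha>"

lemma comb_apply: "comb c u = (\<Sum>i=1..r. of_int (c i) * \<alpha> i u)"
  by (simp add: comb_def int_comb_def)

lemma comb_h: "j \<in> {1..r} \<Longrightarrow> comb c (h j) = of_int (pairing c j)"
  by (simp add: comb_apply pairing_def \<alpha>_h)

lemma comb_diff: "comb (\<lambda>k. c k - t * c' k) = (\<lambda>u. comb c u - of_int t * comb c' u)"
  by (simp add: fun_eq_iff comb_apply sum_subtractf sum_distrib_left algebra_simps)

lemma comb_unit: "i \<in> {1..r} \<Longrightarrow> comb (unit_coeff i) = \<alpha> i"
proof
  fix u assume i: "i \<in> {1..r}"
  have "comb (unit_coeff i) u = (\<Sum>k=1..r. if k = i then \<alpha> k u else 0)"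
    unfolding comb_apply by (rule sum.cong) (auto simp: unit_coeff_def)
  then show "comb (unit_coeff i) u = \<alpha> i u" using i by simp
qed

lemma comb_refl: "i \<in> {1..r} \<Longrightarrow> comb (refl i c) = (\<lambda>u. comb c u - comb c (h i) * \<alpha> i u)"
  unfolding refl_def comb_diff by (simp add: comb_unit comb_h)

lemma comb_inject:
  assumes "comb c = comb c'" "i \<in> {1..r}"
  shows "c i = c' i"
proof -
  have "(\<Sum>i=1..r. of_int (c i - c' i) * \<alpha> i u) = 0" for u
    using fun_cong[OF assms(1), of u] by (simp add: comb_apply left_diff_distrib sum_subtractf)
  then have "(of_int (c i - c' i) :: complex) = 0"
    using \<alpha>_independent[of "\<lambda>i. of_int (c i - c' i)"] assms(2) by blast
  then show ?thesis by simp
qed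

lemma comb_cong: "(\<And>i. i \<in> {1..r} \<Longrightarrow> c i = c' i) \<Longrightarrow> comb c = comb c'"
  by (simp add: fun_eq_iff comb_apply)

text \<open>Entries outside the vertices are fixed to be 0, so that each root has exactly one
  coefficient vector although \<open>comb\<close> ignores those entries.\<close>

definition \<Phi> :: "(nat \<Rightarrow> int) set" where
  "\<Phi> = {c. (\<forall>i. i \<notin> {1..r} \<longrightarrow> c i = 0) \<and> comb c \<in> roots H}"

lemma root_is_comb:
  assumes "\<beta> \<in> roots H"
  shows "\<exists>c\<in>\<Phi>. \<beta> = comb c \<and> ((\<forall>i. 0 \<le> c i) \<or> (\<forall>i. c i \<le> 0))"
proof -
  have "\<beta> \<in> nonneg_cone r \<alpha> \<or> - \<beta> \<in> nonneg_cone r \<alpha>"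
    using frame assms rnk by (simp add: simple_root_frame_def root_base_def)
  then show ?thesis
  proof
    assume "\<beta> \<in> nonneg_cone r \<alpha>"
    then obtain c where c: "\<beta> = comb c" "\<forall>i\<in>{1..r}. 0 \<le> c i"
      by (auto simp: nonneg_cone_def comb_def)
    let ?c = "\<lambda>i. if i \<in> {1..r} then c i else 0"
    have "\<beta> = comb ?c" unfolding c(1) by (rule comb_cong) simp
    then show ?thesis using assms c(2) by (intro bexI[of _ ?c]) (auto simp: \<Phi>_def)
  next
    assume "- \<beta> \<in> nonneg_cone r \<alpha>"
    then obtain c where c: "- \<beta> = comb c" "\<forall>i\<in>{1..r}. 0 \<le> c i"
      by (auto simp: nonneg_cone_def comb_def)
    let ?c = "\<lambda>i. if i \<in> {1..r} then - c i else 0"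
    have "\<beta> u = comb ?c u" for u
    proof -
      have "comb ?c u = - comb c u" unfolding comb_apply sum_negf[symmetric] by (rule sum.cong) simp_all
      then show ?thesis by (simp add: c(1)[symmetric])
    qed
    then have "\<beta> = comb ?c" by blast
    then show ?thesis using assms c(2) by (intro bexI[of _ ?c]) (auto simp: \<Phi>_def)
  qed
qed

lemma roots_eq: "roots H = comb ` \<Phi>"
  using root_is_comb by (auto simp: \<Phi>_def)

lemma \<Phi>_inject: "c \<in> \<Phi> \<Longrightarrow> c' \<in> \<Phi> \<Longrightarrow> comb c = comb c' \<Longrightarrow> c = c'"
proof
  fix i assume "c \<in> \<Phi>" "c' \<in> \<Phi>" "comb c = comb c'"
  then show "c i = c' i" using comb_inject[of c c' i] by (cases "i \<in> {1..r}") (auto simp: \<Phi>_def)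
qed

lemma finite_roots: "finite (roots H)"
  using finite_weights by (simp add: roots_eq_weights)

text \<open>The Lie algebra hands over to lattice arguments: finiteness comes from
  \<open>finite_weights\<close>, stability from the weight strings, and \<open>multiple\<close> from
  the absence of nonzero root vectors for n\<alpha>_i with n \<ge> 2.\<close>

sublocale root_coeffs r A "root_scale X" \<Phi>
proof
  show "finite \<Phi>"
    using finite_roots \<Phi>_inject unfolding roots_eq by (intro finite_imageD[of comb]) (auto intro: inj_onI)
  fix c i assume c: "c \<in> \<Phi>"
  show "c i = 0" if "i \<notin> {1..r}" using c that by (simp add: \<Phi>_def)
  show "(\<forall>i. 0 \<le> c i) \<or> (\<forall>i. c i \<le> 0)"
  proof -
    have "comb c \<in> roots H" using c by (simp add: \<Phi>_def)
    then obtain c' where c': "c' \<in> \<Phi>" "comb c = comb c'" "(\<forall>i. 0 \<le> c' i) \<or> (\<forall>i. c' i \<le> 0)"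
      using root_is_comb by blast
    then show ?thesis using \<Phi>_inject[OF c c'(1,2)] by blast
  qed
  show "refl i c \<in> \<Phi>" if i: "i \<in> {1..r}"
    using root_reflection[of "comb c" i] c i by (auto simp: \<Phi>_def comb_refl refl_other)
next
  fix i assume i: "i \<in> {1..r}"
  show "unit_coeff i \<in> \<Phi>" using \<alpha>_root[OF i] comb_unit[OF i] i by (auto simp: \<Phi>_def unit_coeff_def)
  fix n :: int assume n: "(\<lambda>k. n * unit_coeff i k) \<in> \<Phi>" "0 < n"
  show "n = 1"
  proof (rule ccontr)
    assume "n \<noteq> 1"
    define m where "m = nat (n - 2)"
    then have m: "n = int (m + 2)" using n(2) \<open>n \<noteq> 1\<close> by simp
    have "comb (\<lambda>k. n * unit_coeff i k) u = of_int n * comb (unit_coeff i) u" for u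
      by (simp add: comb_apply sum_distrib_left mult.assoc)
    then have "comb (\<lambda>k. n * unit_coeff i k) = (\<lambda>u. of_nat (m + 2) * \<alpha> i u)"
      by (simp add: fun_eq_iff comb_unit[OF i] m)
    then have "(\<lambda>u. of_nat (m + 2) * \<alpha> i u) \<in> weights H"
      using n(1) by (simp add: \<Phi>_def roots_eq_weights)
    then obtain v where v: "v \<in> root_space H (\<lambda>u. of_nat (m + 2) * \<alpha> i u)" "v \<noteq> 0" by (rule weightsE)
    obtain x y where "sl2_triple H (\<alpha> i) x y (h i)" using ex_sl2_triple[OF i] by blast
    then show False using sl2_triple.root_space_multiple v by blast
  qed
next
  have "comb (\<lambda>_. 0) = 0" by (simp add: fun_eq_iff comb_apply)
  then show "(\<lambda>_. 0) \<notin> \<Phi>" by (simp add: \<Phi>_def roots_def)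
qed

lemma form_eq_iform: "form c c' = iform X c c'"
  by (simp add: form_def iform_def pairing_def)

lemma form_top: "form (top_coeff X e) c = top_value X e c"
  using iform_top_coeff[OF valid] by (simp add: form_eq_iform)

lemma form_top_top: "form (top_coeff X e) (top_coeff X e) = 2 * int (if e = 0 then lacing X else 1)"
  by (simp add: form_top top_value_top_coeff[OF valid])

lemma root_form: "c \<in> \<Phi> \<Longrightarrow> form c c = 2 \<or> form c c = 2 * int (lacing X)"
  using root_norm[of c] root_scale_cases[of X] by fastforce

text \<open>In type \<open>C\<close> there are dominant vectors of long-root length in the root lattice that are not
  roots; divisibility of the coefficients by 2 rules them out.\<close>

lemma TypeC_long_even:
  assumes X: "X = TypeC n" and "c \<in> \<Phi>" "form c c = 4" "i < n"
  shows "even (c i)"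
proof -
  have "form c c = 4 \<longrightarrow> (\<forall>i<n. even (c i))"
  proof (rule root_invariant[OF assms(2)])
    fix c j assume c: "c \<in> \<Phi>" and j: "j \<in> {1..r}" and IH: "form c c = 4 \<longrightarrow> (\<forall>i<n. even (c i))"
    show "form (refl j c) (refl j c) = 4 \<longrightarrow> (\<forall>i<n. even (refl j c i))"
    proof (intro impI allI)
      fix i assume f: "form (refl j c) (refl j c) = 4" and i: "i < n"
      then have ev: "even (c k)" if "k < n" for k using IH form_refl[OF j] that by simp
      show "even (refl j c i)"
      proof (cases "i = j")
        case True
        have "pairing c j = cpair X c j" by (simp add: pairing_def)
        also have "\<dots> = 2 * c j - c (j - 1) - (if j + 1 = n then 2 else 1) * c (j + 1)"
          using supported[OF c] j unfolding X by (intro cpair_TypeC) auto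
        \<comment> \<open>The neighbour \<open>j + 1\<close> is either below \<open>n\<close>, with
          an even coefficient, or equal to \<open>n\<close>, where the double bond contributes the
          factor 2.\<close>
        finally have "even (pairing c j)" using ev[of "j - 1"] ev[of "j + 1"] True i by auto
        then show ?thesis using ev[OF i] True by (simp add: refl_same)
      qed (use ev[OF i] in \<open>simp add: refl_other\<close>)
    qed
  next
    fix j assume "j \<in> {1..r}"
    then have "form (unit_coeff j) (unit_coeff j) = 4 \<longrightarrow> root_scale X j = 2"
      by (simp add: form_unit_unit)
    moreover have "root_scale X j = 2 \<Longrightarrow> j = n" by (simp add: X split: if_splits)
    ultimately show "form (unit_coeff j) (unit_coeff j) = 4 \<longrightarrow> (\<forall>i<n. even (unit_coeff j i))"
      by (auto simp: unit_coeff_def)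
  qed
  then show ?thesis using assms by blast
qed

text \<open>\<open>norm_class_top\<close>, started at a simple root of the required length, yields
  that the tabulated vector is a root. Full support of dominant roots supplies the lower bounds that
  \<open>top_value_bound\<close> asks for.\<close>

lemma top_root:
  assumes e: "e = 0 \<or> e = 1"
  shows "top_coeff X e \<in> \<Phi>"
    and "c \<in> \<Phi> \<Longrightarrow> form c c = 2 * int (if e = 0 then lacing X else 1) \<Longrightarrow> c i \<le> top_coeff X e i"
proof -
  let ?\<theta> = "top_coeff X e"
  have \<theta>: "form ?\<theta> ?\<theta> \<le> form ?\<theta> c" if c: "c \<in> \<Phi>" "dominant c" "form c c = form ?\<theta> ?\<theta>" for c
  proof -
    have "2 * int (if e = 0 then lacing X else 1) \<le> top_value X e c"
    proof (rule top_value_bound[OF valid])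
      show "1 \<le> c i" if "i \<in> {1..r}" for i using dominant_root_full_support[OF c(1,2) that] .
      show "0 \<le> cpair X c j" if "j \<in> {1..r}" for j
        using c(2) that by (simp add: dominant_def pairing_def)
      show "iform X c c = 2 * int (if e = 0 then lacing X else 1)"
        using c(3) by (simp add: form_top_top form_eq_iform[symmetric])
      show "even (c 1)" if "X = TypeC n" "e = 0" for n
      proof (rule TypeC_long_even[OF that(1) c(1)])
        show "form c c = 4" unfolding c(3) form_top_top using that by simp
        show "1 < n" using valid that(1) by simp
      qed
    qed (use supported[OF c(1)] in blast)
    then show ?thesis by (simp add: form_top form_top_top top_value_top_coeff[OF valid])
  qed
  have top: "form c c = form ?\<theta> ?\<theta> \<Longrightarrow> ?\<theta> \<in> \<Phi> \<and> c i \<le> ?\<theta> i" if "c \<in> \<Phi>" for c i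
    using norm_class_top(1)[of ?\<theta> c] norm_class_top(2)[of ?\<theta> c i] top_coeff_supported \<theta> that by blast
  obtain k where "k \<in> {1..r}" "root_scale X k = int (if e = 0 then lacing X else 1)"
    using ex_short_simple[OF valid] ex_long_simple[OF valid] by (cases "e = 0") auto
  then show "?\<theta> \<in> \<Phi>"
    using top[of "unit_coeff k"] unit_in[of k] by (simp add: form_unit_unit form_top_top)
  show "c i \<le> ?\<theta> i" if "c \<in> \<Phi>" "form c c = 2 * int (if e = 0 then lacing X else 1)"
    using top[of c i] that by (simp add: form_top_top)
qed

lemma top_root_max: "c \<in> \<Phi> \<Longrightarrow> c i \<le> top_coeff X 0 i"
  using root_form[of c] top_root(2)[of 0 c i] top_root(2)[of 1 c i] top_coeff_le[of X i] by fastforce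

end


section \<open>Weights\<close>

lemma dual_space_linear_sum:
  assumes "\<phi> \<in> dual_space H" "lie.subspace H" "finite S" "\<And>i. i \<in> S \<Longrightarrow> v i \<in> H"
  shows "\<phi> (\<Sum>i\<in>S. c i *\<^sub>C v i) = (\<Sum>i\<in>S. c i * \<phi> (v i))"
  using assms(3,4)
proof (induction S rule: finite_induct)
  case empty
  have "\<phi> (0 *\<^sub>C 0) = 0 * \<phi> 0" using assms(1) lie.subspace_0[OF assms(2)] unfolding dual_space_def by blast
  then show ?case by (simp add: lie.scale_zero_left)
next
  case (insert i S)
  have v: "c i *\<^sub>C v i \<in> H" "(\<Sum>i\<in>S. c i *\<^sub>C v i) \<in> H"
    using insert.prems assms(2) by (auto intro!: lie.subspace_scale lie.subspace_sum)
  have "\<phi> (c i *\<^sub>C v i + (\<Sum>i\<in>S. c i *\<^sub>C v i)) = \<phi> (c i *\<^sub>C v i) + \<phi> (\<Sum>i\<in>S. c i *\<^sub>C v i)"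
    using assms(1) v unfolding dual_space_def by blast
  also have "\<phi> (c i *\<^sub>C v i) = c i * \<phi> (v i)"
    using assms(1) insert.prems unfolding dual_space_def by blast
  finally show ?case using insert by simp
qed

context typed_frame begin

text \<open>Every root is a combination of simple roots, so \<open>x\<close> acts by 0 on all weight
  vectors. These span the algebra, so \<open>x\<close> is central, and the centre is an ideal that
  is not everything because the bracket is not zero.\<close>

lemma center_trivial:
  assumes x: "x \<in> H" and zero: "\<And>i. i \<in> {1..r} \<Longrightarrow> \<alpha> i x = 0"
  shows "x = 0"
proof -
  have weight_zero: "\<phi> x = 0" if "\<phi> \<in> weights H" for \<phi>
  proof (cases "\<phi> = 0")
    case False
    then have "\<phi> \<in> roots H" using that by (simp add: roots_eq_weights)
    then obtain c where "\<phi> = comb c" unfolding roots_eq by blast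
    then show ?thesis by (simp add: comb_apply zero)
  qed simp
  let ?V = "{v. \<exists>\<phi>. \<forall>h\<in>H. lie h v = \<phi> h *\<^sub>C v}"
  have "lie x v = 0" if v: "v \<in> ?V" for v
  proof (cases "v = 0")
    case False
    obtain \<phi> where \<phi>: "\<And>h. h \<in> H \<Longrightarrow> lie h v = \<phi> h *\<^sub>C v" using v by blast
    \<comment> \<open>Diagonalizability provides \<phi> as a mere function. Its linearity on
      \<open>H\<close> follows from \<open>v \<noteq> 0\<close>, and cutting it off outside
      \<open>H\<close> puts it into \<open>dual_space H\<close>.\<close>
    define \<psi> where "\<psi> h = (if h \<in> H then \<phi> h else 0)" for h
    have "\<phi> (u + w) = \<phi> u + \<phi> w" if "u \<in> H" "w \<in> H" for u w
    proof -
      have "\<phi> (u + w) *\<^sub>C v = (\<phi> u + \<phi> w) *\<^sub>C v"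
        using \<phi>[of "u + w"] \<phi>[OF that(1)] \<phi>[OF that(2)] lie.subspace_add[OF subspace_H that]
        by (simp add: lie_add_left cscale_add_left)
      then show ?thesis using False by (simp add: lie.scale_cancel_right)
    qed
    moreover have "\<phi> (c *\<^sub>C u) = c * \<phi> u" if "u \<in> H" for c u
    proof -
      have "\<phi> (c *\<^sub>C u) *\<^sub>C v = (c * \<phi> u) *\<^sub>C v"
        using \<phi>[of "c *\<^sub>C u"] \<phi>[OF that] lie.subspace_scale[OF subspace_H that]
        by (metis lie_cscale_left cscale_cscale)
      then show ?thesis using False by (simp add: lie.scale_cancel_right)
    qed
    ultimately have "\<psi> \<in> dual_space H"
      using lie.subspace_add[OF subspace_H] lie.subspace_scale[OF subspace_H]
      by (simp add: dual_space_def \<psi>_def)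
    moreover have "v \<in> root_space H \<psi>" using \<phi> by (simp add: root_space_def \<psi>_def)
    ultimately have "\<psi> x = 0" using False by (intro weight_zero weightsI)
    then show ?thesis using \<phi>[OF x] x by (simp add: \<psi>_def lie.scale_zero_left)
  qed simp
  note weight_vector_zero = this
  have "lie x v = 0" if "v \<in> lie.span ?V" for v
    using that
  proof (induction rule: lie.span_induct_alt)
    case (step c v w)
    then show ?case
      using weight_vector_zero[OF step(1)] by (simp add: lie_add_right lie_cscale_right lie.scale_zero_right)
  qed simp
  moreover have "lie.span ?V = UNIV" using cartan unfolding cartan_subalgebra_def by blast
  ultimately have xZ: "\<forall>v. lie x v = 0" by simp
  define Z where "Z = {x :: 'g. \<forall>v. lie x v = 0}"
  have "lie_ideal Z" unfolding lie_ideal_def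
  proof
    show "lie.subspace Z"
      by (rule lie.subspaceI) (auto simp: Z_def lie_add_left lie_cscale_left lie.scale_zero_right)
    have "lie u y = 0" if "y \<in> Z" for u y using that lie_anticomm[of u y] by (simp add: Z_def)
    then show "\<forall>u. \<forall>y\<in>Z. lie u y \<in> Z" by (simp add: Z_def)
  qed
  then have "Z = {0} \<or> Z = UNIV" using simple by (simp add: simple_lie_algebra_def)
  moreover have "Z \<noteq> UNIV" using simple by (auto simp: simple_lie_algebra_def Z_def)
  ultimately show ?thesis using xZ by (auto simp: Z_def)
qed

text \<open>Definiteness excludes a real kernel; the matrix is real, so a complex vector is treated
  through its real and imaginary parts.\<close>

lemma cartan_matrix_inverse:
  "\<exists>B :: nat \<Rightarrow> nat \<Rightarrow> complex.
    (\<forall>i\<in>{1..r}. \<forall>k\<in>{1..r}. (\<Sum>j=1..r. B i j * of_int (A j k)) = (if i = k then 1 else 0)) \<and>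
    (\<forall>i\<in>{1..r}. \<forall>k\<in>{1..r}. (\<Sum>j=1..r. of_int (A i j) * B j k) = (if i = k then 1 else 0))"
proof (rule square_system_inverse)
  fix c :: "nat \<Rightarrow> complex" and i
  assume z: "\<And>j. j \<in> {1..r} \<Longrightarrow> (\<Sum>i=1..r. c i * of_int (A i j)) = 0" and i: "i \<in> {1..r}"
  have zero: "x i = 0" if "\<And>j. j \<in> {1..r} \<Longrightarrow> (\<Sum>i=1..r. x i * of_int (A i j)) = 0" for x :: "nat \<Rightarrow> real"
  proof (rule ccontr)
    assume "x i \<noteq> 0"
    moreover have "(\<Sum>j=1..r. x j * of_int (root_scale X j) * (\<Sum>i=1..r. x i * of_int (A i j))) = 0"
      by (intro sum.neutral ballI) (simp only: that mult_zero_right)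
    ultimately show False using positive_definite[OF i, of x] by simp
  qed
  have re: "(\<Sum>i=1..r. Re (c i) * of_int (A i j)) = 0" if "j \<in> {1..r}" for j
    using arg_cong[OF z[OF that], of Re] by simp
  have im: "(\<Sum>i=1..r. Im (c i) * of_int (A i j)) = 0" if "j \<in> {1..r}" for j
    using arg_cong[OF z[OF that], of Im] by simp
  show "c i = 0" using zero[OF re] zero[OF im] by (simp add: complex_eq_iff)
qed

text \<open>The simple coroots span \<open>H\<close>: some combination \<open>y\<close> of them has
  the same values under all simple roots as \<open>x\<close>, and then \<open>x - y\<close> is 0 by
  \<open>center_trivial\<close>. This is the uniqueness behind
  \<open>fundamental_weight\<close>.\<close>

lemma dual_space_eq_coroots:
  assumes "\<phi> \<in> dual_space H" "\<psi> \<in> dual_space H" "\<And>j. j \<in> {1..r} \<Longrightarrow> \<phi> (h j) = \<psi> (h j)"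
  shows "\<phi> = \<psi>"
proof (rule dual_space_eqI[OF assms(1,2)])
  fix x assume x: "x \<in> H"
  obtain B :: "nat \<Rightarrow> nat \<Rightarrow> complex" where B:
    "\<forall>i\<in>{1..r}. \<forall>k\<in>{1..r}. (\<Sum>j=1..r. of_int (A i j) * B j k) = (if i = k then 1 else 0)"
    using cartan_matrix_inverse by blast
  \<comment> \<open>The solution of \<Sum>_k t_k \<alpha>_i(h_k) = \<alpha>_i(x) for all i.\<close>
  define t where "t k = (\<Sum>j=1..r. B k j * \<alpha> j x)" for k
  define y where "y = (\<Sum>k=1..r. t k *\<^sub>C h k)"
  have lin: "\<chi> y = (\<Sum>k=1..r. t k * \<chi> (h k))" if "\<chi> \<in> dual_space H" for \<chi>
    unfolding y_def by (rule dual_space_linear_sum[OF that subspace_H]) (auto simp: h_in)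
  have y: "y \<in> H" unfolding y_def
    by (intro lie.subspace_sum lie.subspace_scale subspace_H h_in)
  have "\<alpha> i (x - y) = 0" if i: "i \<in> {1..r}" for i
  proof -
    have "\<alpha> i y = (\<Sum>k=1..r. t k * of_int (A i k))"
      unfolding lin[OF \<alpha>_dual[OF i]] by (rule sum.cong) (simp_all add: \<alpha>_h[OF i])
    also have "\<dots> = (\<Sum>k=1..r. \<Sum>j=1..r. of_int (A i k) * B k j * \<alpha> j x)"
      unfolding t_def sum_distrib_right by (intro sum.cong) (simp_all add: mult_ac)
    also have "\<dots> = (\<Sum>j=1..r. \<Sum>k=1..r. of_int (A i k) * B k j * \<alpha> j x)" by (rule sum.swap)
    also have "\<dots> = (\<Sum>j=1..r. if i = j then \<alpha> j x else 0)"
    proof (rule sum.cong)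
      fix j assume "j \<in> {1..r}"
      then show "(\<Sum>k=1..r. of_int (A i k) * B k j * \<alpha> j x) = (if i = j then \<alpha> j x else 0)"
        unfolding sum_distrib_right[symmetric] using B i by simp
    qed simp
    finally have eq: "\<alpha> i y = \<alpha> i x" using i by simp
    have "\<alpha> i (x + (- 1) *\<^sub>C y) = \<alpha> i x + \<alpha> i ((- 1) *\<^sub>C y)"
      using \<alpha>_dual[OF i] x lie.subspace_scale[OF subspace_H y] unfolding dual_space_def by blast
    also have "\<alpha> i ((- 1) *\<^sub>C y) = (- 1) * \<alpha> i y"
      using \<alpha>_dual[OF i] y unfolding dual_space_def by blast
    finally show ?thesis using eq by (simp add: lie.scale_minus_left cscale_one)
  qed
  then have "x - y = 0" using lie.subspace_diff[OF subspace_H x y] by (intro center_trivial)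
  then have "x = y" by simp
  then show "\<phi> x = \<psi> x" using lin[OF assms(1)] lin[OF assms(2)] assms(3) by simp
qed

abbreviation "\<omega> \<equiv> fundamental_weight D"

lemma fundamental_weight:
  assumes "i \<in> {1..r}"
  shows "\<omega> i \<in> dual_space H"
    and "j \<in> {1..r} \<Longrightarrow> \<omega> i (h j) = (if i = j then 1 else 0)"
proof -
  obtain B :: "nat \<Rightarrow> nat \<Rightarrow> complex" where B:
    "\<forall>i\<in>{1..r}. \<forall>k\<in>{1..r}. (\<Sum>j=1..r. B i j * of_int (A j k)) = (if i = k then 1 else 0)"
    using cartan_matrix_inverse by blast
  let ?P = "\<lambda>w. w \<in> dual_space H \<and> (\<forall>j\<in>{1..rnk D}. w (h j) = (if i = j then 1 else 0))"
  define w where "w = (\<lambda>x. \<Sum>j=1..r. B i j * \<alpha> j x)"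
  have "w (h k) = (if i = k then 1 else 0)" if "k \<in> {1..r}" for k
  proof -
    have "w (h k) = (\<Sum>j=1..r. B i j * of_int (A j k))"
      unfolding w_def by (rule sum.cong) (use \<alpha>_h[OF _ that] in simp_all)
    then show ?thesis using B assms that by simp
  qed
  moreover have "w \<in> dual_space H" unfolding w_def by (intro dual_space_sum \<alpha>_dual)
  ultimately have "?P w" by (simp add: rnk)
  moreover have "w' = w" if "?P w'" for w'
    using that \<open>?P w\<close> by (intro dual_space_eq_coroots) (auto simp: rnk)
  ultimately have "?P (\<omega> i)" unfolding fundamental_weight_def by (rule theI)
  then show "\<omega> i \<in> dual_space H" "j \<in> {1..r} \<Longrightarrow> \<omega> i (h j) = (if i = j then 1 else 0)"
    by (auto simp: rnk)
qed

definition wcomb :: "(nat \<Rightarrow> int) \<Rightarrow> 'g \<Rightarrow> complex" where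
  "wcomb z = int_comb r z \<omega>"

lemma wcomb_dual: "wcomb z \<in> dual_space H"
  unfolding wcomb_def int_comb_def by (intro dual_space_sum fundamental_weight)

lemma wcomb_h: "j \<in> {1..r} \<Longrightarrow> wcomb z (h j) = of_int (z j)"
proof -
  assume j: "j \<in> {1..r}"
  have "wcomb z (h j) = (\<Sum>i=1..r. if i = j then of_int (z i) else 0)"
    unfolding wcomb_def int_comb_def by (rule sum.cong) (use j in \<open>auto simp: fundamental_weight\<close>)
  then show ?thesis using j by simp
qed

lemma eq_wcombI:
  assumes "\<phi> \<in> dual_space H" "\<And>j. j \<in> {1..r} \<Longrightarrow> \<phi> (h j) = of_int (z j)"
  shows "\<phi> = wcomb z"
  by (rule dual_space_eq_coroots) (use assms wcomb_dual wcomb_h in auto)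

lemma weight_lattice_eq: "weight_lattice D = range wcomb"
  by (auto simp: weight_lattice_def wcomb_def rnk)

lemma wcomb_add: "wcomb y + wcomb z = wcomb (\<lambda>i. y i + z i)"
  by (auto simp: wcomb_def int_comb_def fun_eq_iff sum.distrib algebra_simps)

lemma \<alpha>_eq_wcomb: "i \<in> {1..r} \<Longrightarrow> \<alpha> i = wcomb (\<lambda>j. A i j)"
  by (rule eq_wcombI) (simp_all add: \<alpha>_dual \<alpha>_h)

lemma comb_eq_wcomb: "comb c = wcomb (pairing c)"
proof (rule eq_wcombI)
  have "comb c = (\<lambda>u. \<Sum>i=1..r. of_int (c i) * \<alpha> i u)" by (simp add: fun_eq_iff comb_apply)
  then show "comb c \<in> dual_space H" by (simp only:) (intro dual_space_sum \<alpha>_dual)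
qed (rule comb_h)

lemma weyl_vector_eq: "weyl_vector D = wcomb (\<lambda>_. 1)"
proof (rule eq_wcombI)
  have P: "positive_roots D = comb ` positive"
  proof -
    have "comb c \<in> nonneg_cone r \<alpha> \<longleftrightarrow> (\<forall>i. 0 \<le> c i)" if "c \<in> \<Phi>" for c
    proof
      assume "comb c \<in> nonneg_cone r \<alpha>"
      then obtain c' where c': "comb c = comb c'" "\<forall>i\<in>{1..r}. 0 \<le> c' i"
        by (auto simp: nonneg_cone_def comb_def)
      then have "0 \<le> c i" if "i \<in> {1..r}" for i using comb_inject[OF c'(1) that] that by simp
      then show "\<forall>i. 0 \<le> c i" using supported[OF \<open>c \<in> \<Phi>\<close>] by (metis order_refl)
    qed (auto simp: nonneg_cone_def comb_def)
    then show ?thesis by (auto simp: positive_roots_def roots_eq rnk positive_def)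
  qed
  have inj: "inj_on comb positive" by (auto intro!: inj_onI \<Phi>_inject simp: positive_def)
  have eq: "weyl_vector D = (\<lambda>x. \<Sum>c\<in>positive. 1 / 2 * comb c x)"
    by (simp add: weyl_vector_def P sum.reindex[OF inj] sum_divide_distrib)
  show "weyl_vector D \<in> dual_space H" unfolding eq
    by (rule dual_space_sum) (simp add: comb_eq_wcomb wcomb_dual)
  fix j assume j: "j \<in> {1..r}"
  have "weyl_vector D (h j) = (\<Sum>c\<in>positive. of_int (pairing c j)) / 2"
    unfolding eq by (simp add: comb_h[OF j] sum_divide_distrib)
  also have "\<dots> = of_int (\<Sum>c\<in>positive. pairing c j) / 2" by simp
  finally show "weyl_vector D (h j) = of_int 1" by (simp only: sum_positive_pairing[OF j]) simp
qed

end


section \<open>The normalized form\<close>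

locale normalized_frame = typed_frame D X for D :: "'g::complex_lie_algebra root_frame" and X +
  fixes b :: "'g weight_form"
  assumes normalized: "normalized_form D b"
begin

lemma b_add: "b (wcomb x + wcomb y) (wcomb z) = b (wcomb x) (wcomb z) + b (wcomb y) (wcomb z)"
  using normalized by (simp add: normalized_form_def weight_lattice_eq)

lemma b_sym: "b (wcomb x) (wcomb y) = b (wcomb y) (wcomb x)"
  using normalized by (simp add: normalized_form_def weight_lattice_eq)

lemma b_weyl: "w \<in> weyl_group D \<Longrightarrow> b (w (wcomb x)) (w (wcomb y)) = b (wcomb x) (wcomb y)"
  using normalized by (simp add: normalized_form_def weight_lattice_eq)

lemma b_zero: "b (wcomb (\<lambda>_. 0)) (wcomb z) = 0"
  using b_add[of "\<lambda>_. 0" "\<lambda>_. 0" z] by (simp add: wcomb_add)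

text \<open>\<open>normalized_form\<close> grants additivity only, and only on the weight lattice,
  so multiples are recovered one at a time.\<close>

lemma b_nat_mult: "b (wcomb (\<lambda>i. int n * x i)) (wcomb z) = real n * b (wcomb x) (wcomb z)"
proof (induction n)
  case (Suc n)
  have eq: "wcomb (\<lambda>i. int (Suc n) * x i) = wcomb x + wcomb (\<lambda>i. int n * x i)"
    by (simp add: wcomb_add algebra_simps)
  show ?case unfolding eq b_add Suc.IH by (simp add: algebra_simps)
qed (simp add: b_zero)

lemma b_mult: "b (wcomb (\<lambda>i. n * x i)) (wcomb z) = of_int n * b (wcomb x) (wcomb z)"
proof (cases "0 \<le> n")
  case True
  then show ?thesis using b_nat_mult[of "nat n" x z] by simp
next
  case False
  have "wcomb (\<lambda>i. n * x i) + wcomb (\<lambda>i. int (nat (- n)) * x i) = wcomb (\<lambda>_. 0)"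
    using False by (simp add: wcomb_add)
  then have "b (wcomb (\<lambda>i. n * x i)) (wcomb z) + b (wcomb (\<lambda>i. int (nat (- n)) * x i)) (wcomb z) = 0"
    by (simp add: b_add[symmetric] b_zero)
  then show ?thesis using b_nat_mult[of "nat (- n)" x z] False by simp
qed

lemma b_diff_mult:
  "b (wcomb (\<lambda>i. x i - n * y i)) (wcomb z) = b (wcomb x) (wcomb z) - of_int n * b (wcomb y) (wcomb z)"
proof -
  have "wcomb (\<lambda>i. x i - n * y i) = wcomb x + wcomb (\<lambda>i. (- n) * y i)" by (simp add: wcomb_add)
  then show ?thesis using b_mult[of "- n" y z] by (simp add: b_add)
qed

lemma b_sum:
  assumes "finite S"
  shows "b (wcomb (\<lambda>i. \<Sum>j\<in>S. n j * y j i)) (wcomb z) = (\<Sum>j\<in>S. of_int (n j) * b (wcomb (y j)) (wcomb z))"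
  using assms
proof (induction S rule: finite_induct)
  case (insert k S)
  have eq: "wcomb (\<lambda>i. \<Sum>j\<in>insert k S. n j * y j i) = wcomb (\<lambda>i. n k * y k i) + wcomb (\<lambda>i. \<Sum>j\<in>S. n j * y j i)"
    using insert.hyps by (simp add: wcomb_add)
  show ?case unfolding eq b_add b_mult insert.IH using insert.hyps by simp
qed (simp add: b_zero)

definition root_length :: "nat \<Rightarrow> real" where
  "root_length j = b (\<alpha> j) (\<alpha> j)"

text \<open>The simple reflection sends \<alpha>_j to -\<alpha>_j and z to z - z_j \<alpha>_j, so
  invariance gives b(z, \<alpha>_j) = -b(z, \<alpha>_j) + z_j b(\<alpha>_j, \<alpha>_j).\<close>

lemma b_\<alpha>:
  assumes j: "j \<in> {1..r}"
  shows "2 * b (wcomb z) (\<alpha> j) = of_int (z j) * root_length j"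
proof -
  let ?a = "\<lambda>k. A j k"
  let ?s = "simple_reflection D j"
  have a: "\<alpha> j = wcomb ?a" using j by (rule \<alpha>_eq_wcomb)
  have s: "?s (wcomb y) = wcomb (\<lambda>i. y i - y j * ?a i)" for y
  proof
    fix x
    have "?s (wcomb y) x = wcomb y x - of_int (y j) * wcomb ?a x"
      using wcomb_h[OF j] a by (simp add: simple_reflection_def)
    then show "?s (wcomb y) x = wcomb (\<lambda>i. y i - y j * ?a i) x"
      by (simp add: wcomb_def int_comb_def left_diff_distrib sum_subtractf sum_distrib_left mult.assoc)
  qed
  have sa: "?s (wcomb ?a) = wcomb (\<lambda>i. 0 - 1 * ?a i)"
    unfolding s by (simp add: diagonal[OF j])
  have "?s \<circ> id \<in> weyl_group D" using j rnk by (intro weyl_group.intros) simp_all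
  then have "b (?s (wcomb z)) (?s (wcomb ?a)) = b (wcomb z) (wcomb ?a)" by (intro b_weyl) simp
  moreover have "b (?s (wcomb z)) (?s (wcomb ?a)) = - b (wcomb (\<lambda>i. z i - z j * ?a i)) (wcomb ?a)"
  proof -
    have "b (wcomb (\<lambda>i. z i - z j * ?a i)) (wcomb (\<lambda>i. 0 - 1 * ?a i)) =
        b (wcomb (\<lambda>i. 0 - 1 * ?a i)) (wcomb (\<lambda>i. z i - z j * ?a i))" by (rule b_sym)
    also have "\<dots> = - b (wcomb ?a) (wcomb (\<lambda>i. z i - z j * ?a i))"
      unfolding b_diff_mult[of "\<lambda>_. 0"] b_zero by simp
    also have "b (wcomb ?a) (wcomb (\<lambda>i. z i - z j * ?a i)) = b (wcomb (\<lambda>i. z i - z j * ?a i)) (wcomb ?a)"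
      by (rule b_sym)
    finally show ?thesis unfolding s[of z] sa .
  qed
  ultimately show ?thesis by (simp add: b_diff_mult a root_length_def)
qed

lemma root_length_symmetric:
  assumes "i \<in> {1..r}" "j \<in> {1..r}"
  shows "of_int (A i j) * root_length j = of_int (A j i) * root_length i"
proof -
  have "b (\<alpha> i) (\<alpha> j) = b (\<alpha> j) (\<alpha> i)" using b_sym assms by (simp add: \<alpha>_eq_wcomb)
  then show ?thesis using b_\<alpha>[OF assms(2), of "A i"] b_\<alpha>[OF assms(1), of "A j"] assms
    by (simp add: \<alpha>_eq_wcomb)
qed

text \<open>Both \<open>root_length\<close> and \<open>root_scale\<close> symmetrize the Cartan
  matrix, so their quotient is constant along edges. The sign of \<open>t\<close> is still
  open.\<close>

lemma root_length_proportional: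
  "\<exists>t. \<forall>j\<in>{1..r}. root_length j = 2 * t * of_int (root_scale X j)"
proof -
  obtain k where k: "k \<in> {1..r}" using ex_short_simple[OF valid] by blast
  define q where "q i = root_length i / of_int (root_scale X i)" for i
  define S where "S = {i \<in> {1..r}. q i = q k}"
  have pos: "(of_int (root_scale X i) :: real) > 0" for i using root_scale_pos[of X i] by simp
  have closed: "j \<in> S" if i: "i \<in> S" and j: "j \<in> {1..r}" and A: "A i j \<noteq> 0" for i j
  proof -
    have ri: "i \<in> {1..r}" using i by (simp add: S_def)
    let ?di = "of_int (root_scale X i) :: real" and ?dj = "of_int (root_scale X j) :: real"
    have "?dj * of_int (A i j) = ?di * of_int (A j i)"
      using symmetrizable[OF ri j] by (simp only: of_int_mult[symmetric])
    moreover have "of_int (A i j) * (q j * ?dj) = of_int (A j i) * (q i * ?di)"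
      using root_length_symmetric[OF ri j] pos[of i] pos[of j] by (simp add: q_def)
    ultimately have "(?dj * of_int (A i j)) * q j = (?dj * of_int (A i j)) * q i"
      by (simp add: mult_ac)
    moreover have "?dj * of_int (A i j) \<noteq> 0" using A pos[of j] by simp
    ultimately have "q j = q i" using mult_left_cancel by blast
    then show ?thesis using i j by (simp add: S_def)
  qed
  have S: "S \<subseteq> {1..r}" "S \<noteq> {}" using k by (auto simp: S_def)
  have "S = {1..r}" by (rule connected[OF S closed])
  then have "j \<in> S" if "j \<in> {1..r}" for j using that by blast
  then have "q j = q k" if "j \<in> {1..r}" for j using that by (simp add: S_def)
  then have "\<forall>j\<in>{1..r}. root_length j = 2 * (q k / 2) * of_int (root_scale X j)"
    using pos by (metis q_def less_irrefl nonzero_eq_divide_eq times_divide_eq_right nonzero_mult_div_cancel_left zero_neq_numeral)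
  then show ?thesis ..
qed

lemma b_comb:
  "2 * b (wcomb z) (comb c) = (\<Sum>j=1..r. of_int (c j * z j) * root_length j)"
proof -
  have "comb c = wcomb (\<lambda>i. \<Sum>j=1..r. c j * A j i)"
    unfolding comb_eq_wcomb by (simp add: pairing_def[abs_def])
  then have "b (wcomb z) (comb c) = (\<Sum>j=1..r. of_int (c j) * b (wcomb (A j)) (wcomb z))"
    using b_sym b_sum[of "{1..r}"] by simp
  also have "\<dots> = (\<Sum>j=1..r. of_int (c j) * b (wcomb z) (\<alpha> j))"
    by (intro sum.cong) (simp_all add: \<alpha>_eq_wcomb b_sym)
  finally have "2 * b (wcomb z) (comb c) = (\<Sum>j=1..r. of_int (c j) * (2 * b (wcomb z) (\<alpha> j)))"
    by (simp add: sum_distrib_left mult_ac)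
  also have "\<dots> = (\<Sum>j=1..r. of_int (c j * z j) * root_length j)"
    by (intro sum.cong) (simp_all add: b_\<alpha>)
  finally show ?thesis .
qed

text \<open>\<open>short_roots D b\<close> is defined by minimality with respect to \<open>b\<close>
  itself, so the sign of the factor \<open>t\<close> must be settled. For t > 0 a short simple root
  is minimal, and 2t = 2. For t \<le> 0 a long simple root is minimal, and its value 2mt would have
  to be 2, which is impossible.\<close>

lemma root_length_eq:
  assumes "j \<in> {1..r}"
  shows "root_length j = 2 * of_int (root_scale X j)"
proof -
  obtain t where t: "\<And>j. j \<in> {1..r} \<Longrightarrow> root_length j = 2 * t * of_int (root_scale X j)"
    using root_length_proportional by blast
  have bt: "b (comb c) (comb c) = t * of_int (form c c)" for c
  proof -
    have "2 * b (comb c) (comb c) = (\<Sum>j=1..r. of_int (c j * pairing c j) * root_length j)"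
      using b_comb[of "pairing c" c] by (simp add: comb_eq_wcomb)
    also have "\<dots> = (\<Sum>j=1..r. 2 * t * of_int (c j * root_scale X j * pairing c j))"
      by (intro sum.cong) (simp_all add: t)
    also have "\<dots> = 2 * t * of_int (form c c)" by (simp add: form_def sum_distrib_left)
    finally show ?thesis by simp
  qed
  have m: "1 \<le> lacing X" by (cases X) auto
  have short: "t * of_int (form c c) = 2" if "c \<in> \<Phi>" "\<And>c'. c' \<in> \<Phi> \<Longrightarrow> t * of_int (form c c) \<le> t * of_int (form c' c')" for c
  proof -
    have "comb c \<in> short_roots D b"
      using that by (auto simp: short_roots_def roots_eq bt)
    moreover have "\<forall>\<alpha>\<in>short_roots D b. b \<alpha> \<alpha> = 2"
      using normalized unfolding normalized_form_def by blast
    ultimately show ?thesis using bt by metis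
  qed
  have "t = 1"
  proof (cases "0 < t")
    case True
    obtain k where k: "k \<in> {1..r}" "root_scale X k = 1" using ex_short_simple[OF valid] by blast
    then have f: "form (unit_coeff k) (unit_coeff k) = 2" by (simp add: form_unit_unit)
    have "t * of_int (form (unit_coeff k) (unit_coeff k)) = 2"
    proof (rule short[OF unit_in[OF k(1)]])
      fix c' assume "c' \<in> \<Phi>"
      then have "2 \<le> form c' c'" using root_form[of c'] m by auto
      then show "t * of_int (form (unit_coeff k) (unit_coeff k)) \<le> t * of_int (form c' c')"
        unfolding f using True by (intro mult_left_mono) simp_all
    qed
    then show ?thesis by (simp add: f)
  next
    case False
    obtain k where k: "k \<in> {1..r}" "root_scale X k = int (lacing X)" using ex_long_simple[OF valid] by blast
    then have f: "form (unit_coeff k) (unit_coeff k) = 2 * int (lacing X)" by (simp add: form_unit_unit)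
    have "t * of_int (form (unit_coeff k) (unit_coeff k)) = 2"
    proof (rule short[OF unit_in[OF k(1)]])
      fix c' assume "c' \<in> \<Phi>"
      then have "form c' c' \<le> 2 * int (lacing X)" using root_form[of c'] m by auto
      then show "t * of_int (form (unit_coeff k) (unit_coeff k)) \<le> t * of_int (form c' c')"
        unfolding f using False by (intro mult_left_mono_neg) (simp_all only: of_int_le_iff not_less)
    qed
    moreover have "t * of_int (form (unit_coeff k) (unit_coeff k)) \<le> 0"
      unfolding f using False by (intro mult_nonpos_nonneg) simp_all
    ultimately show ?thesis by simp
  qed
  then show ?thesis using t[OF assms] by simp
qed

lemma b_wcomb_comb: "b (wcomb z) (comb c) = of_int (\<Sum>j=1..r. c j * root_scale X j * z j)"
proof -
  have "2 * b (wcomb z) (comb c) = (\<Sum>j=1..r. 2 * of_int (c j * root_scale X j * z j))"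
    unfolding b_comb by (intro sum.cong) (simp_all add: root_length_eq)
  then show ?thesis by (simp add: sum_distrib_left[symmetric])
qed

lemma b_comb_comb: "b (comb c) (comb c) = of_int (form c c)"
  using b_wcomb_comb[of "pairing c" c] by (simp add: comb_eq_wcomb[symmetric] form_def)

lemma lacing_pos: "1 \<le> lacing X"
  by (cases X) auto

section \<open>Short, long and highest roots\<close>

lemma short_roots_eq: "short_roots D b = comb ` {c \<in> \<Phi>. form c c = 2}"
proof -
  obtain k where k: "k \<in> {1..r}" "root_scale X k = 1" using ex_short_simple[OF valid] by blast
  then have "unit_coeff k \<in> \<Phi>" "form (unit_coeff k) (unit_coeff k) = 2"
    by (simp_all add: form_unit_unit unit_in)
  moreover have "2 \<le> form c c" if "c \<in> \<Phi>" for c using root_form[OF that] lacing_pos by auto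
  ultimately have iff: "(\<forall>c'\<in>\<Phi>. form c c \<le> form c' c') \<longleftrightarrow> form c c = 2" if "c \<in> \<Phi>" for c
    using that by (metis order_antisym)
  have "short_roots D b = comb ` {c \<in> \<Phi>. \<forall>\<beta>\<in>comb ` \<Phi>. b (comb c) (comb c) \<le> b \<beta> \<beta>}"
    unfolding short_roots_def roots_eq by blast
  also have "{c \<in> \<Phi>. \<forall>\<beta>\<in>comb ` \<Phi>. b (comb c) (comb c) \<le> b \<beta> \<beta>} = {c \<in> \<Phi>. form c c = 2}"
    by (rule Collect_cong) (use iff in \<open>simp add: b_comb_comb cong: conj_cong\<close>)
  finally show ?thesis .
qed

lemma long_roots_eq: "long_roots D b = comb ` {c \<in> \<Phi>. form c c = 2 * int (lacing X)}"
proof -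
  obtain k where k: "k \<in> {1..r}" "root_scale X k = int (lacing X)" using ex_long_simple[OF valid] by blast
  then have "unit_coeff k \<in> \<Phi>" "form (unit_coeff k) (unit_coeff k) = 2 * int (lacing X)"
    by (simp_all add: form_unit_unit unit_in)
  moreover have "form c c \<le> 2 * int (lacing X)" if "c \<in> \<Phi>" for c using root_form[OF that] lacing_pos by auto
  ultimately have iff: "(\<forall>c'\<in>\<Phi>. form c' c' \<le> form c c) \<longleftrightarrow> form c c = 2 * int (lacing X)" if "c \<in> \<Phi>" for c
    using that by (metis order_antisym)
  have "long_roots D b = comb ` {c \<in> \<Phi>. \<forall>\<beta>\<in>comb ` \<Phi>. b \<beta> \<beta> \<le> b (comb c) (comb c)}"
    unfolding long_roots_def roots_eq by blast
  also have "{c \<in> \<Phi>. \<forall>\<beta>\<in>comb ` \<Phi>. b \<beta> \<beta> \<le> b (comb c) (comb c)} = {c \<in> \<Phi>. form c c = 2 * int (lacing X)}"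
    by (rule Collect_cong) (use iff in \<open>simp add: b_comb_comb cong: conj_cong\<close>)
  finally show ?thesis .
qed

lemma length_ratio_eq: "length_ratio D b = lacing X"
  unfolding length_ratio_def
proof (rule the_equality)
  have s: "comb (top_coeff X 1) \<in> short_roots D b" and l: "comb (top_coeff X 0) \<in> long_roots D b"
    using top_root(1) form_top_top by (simp_all add: short_roots_eq long_roots_eq)
  show "\<exists>\<alpha>\<in>long_roots D b. \<exists>\<beta>\<in>short_roots D b. b \<alpha> \<alpha> = of_nat (lacing X) * b \<beta> \<beta>"
    using s l by (intro bexI[of _ "comb (top_coeff X 0)"] bexI[of _ "comb (top_coeff X 1)"])
      (simp_all add: b_comb_comb form_top_top)
  fix m assume "\<exists>\<alpha>\<in>long_roots D b. \<exists>\<beta>\<in>short_roots D b. b \<alpha> \<alpha> = of_nat m * b \<beta> \<beta>"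
  then show "m = lacing X" by (auto simp: short_roots_eq long_roots_eq b_comb_comb)
qed

text \<open>The shape shared by \<open>highest_root\<close> and \<open>highest_short_root\<close>;
  the order given by the cone is the componentwise order of coefficients.\<close>

lemma the_top_root:
  assumes "S \<subseteq> \<Phi>" "c0 \<in> S" "\<And>c i. c \<in> S \<Longrightarrow> c i \<le> c0 i"
  shows "(THE \<theta>. \<theta> \<in> comb ` S \<and> (\<forall>\<beta>\<in>comb ` S. \<theta> - \<beta> \<in> nonneg_cone (rnk D) \<alpha>)) = comb c0"
proof (rule the_equality)
  have cone: "comb c - comb c' \<in> nonneg_cone (rnk D) \<alpha> \<longleftrightarrow> (\<forall>i\<in>{1..r}. c' i \<le> c i)" for c c'
  proof -
    have eq: "comb c - comb c' = comb (\<lambda>i. c i - 1 * c' i)" unfolding comb_diff by (simp add: fun_eq_iff)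
    show ?thesis
    proof
      assume "comb c - comb c' \<in> nonneg_cone (rnk D) \<alpha>"
      then obtain x where x: "comb (\<lambda>i. c i - 1 * c' i) = comb x" "\<forall>i\<in>{1..r}. 0 \<le> x i"
        unfolding eq nonneg_cone_def rnk comb_def[symmetric] by blast
      show "\<forall>i\<in>{1..r}. c' i \<le> c i"
      proof
        fix i assume "i \<in> {1..r}"
        then show "c' i \<le> c i" using comb_inject[OF x(1), of i] x(2) by force
      qed
    next
      assume "\<forall>i\<in>{1..r}. c' i \<le> c i"
      then show "comb c - comb c' \<in> nonneg_cone (rnk D) \<alpha>"
        unfolding eq by (auto simp: nonneg_cone_def rnk comb_def)
    qed
  qed
  then show "comb c0 \<in> comb ` S \<and> (\<forall>\<beta>\<in>comb ` S. comb c0 - \<beta> \<in> nonneg_cone (rnk D) \<alpha>)"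
    using assms by auto
  fix \<theta> assume \<theta>: "\<theta> \<in> comb ` S \<and> (\<forall>\<beta>\<in>comb ` S. \<theta> - \<beta> \<in> nonneg_cone (rnk D) \<alpha>)"
  then obtain c where c: "c \<in> S" "\<theta> = comb c" by blast
  have "\<theta> - comb c0 \<in> nonneg_cone (rnk D) \<alpha>" using \<theta> assms(2) by blast
  then have "\<forall>i\<in>{1..r}. c0 i \<le> c i" unfolding c(2) cone .
  then show "\<theta> = comb c0" unfolding c(2) using assms(3)[OF c(1)] by (intro comb_cong antisym) auto
qed

lemma highest_root_eq: "highest_root D = comb (top_coeff X 0)"
  unfolding highest_root_def roots_eq
  by (rule the_top_root) (simp_all add: top_root(1) top_root_max)

lemma highest_short_root_eq: "highest_short_root D b = comb (top_coeff X 1)"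
  unfolding highest_short_root_def short_roots_eq
  by (rule the_top_root) (use top_root form_top_top[of 1] in auto)

section \<open>Labels as lattice points\<close>

definition labels :: "nat \<Rightarrow> nat \<Rightarrow> (nat \<Rightarrow> nat) set" where
  "labels e l = {a. (\<forall>i. i \<notin> {1..r} \<longrightarrow> a i = 0) \<and> (\<Sum>i=1..r. Suc (a i) * label_weight X e i) < l}"

lemma dominant_weights_eq:
  "dominant_weights D = (\<lambda>a. wcomb (\<lambda>i. int (a i))) ` {a. \<forall>i. i \<notin> {1..r} \<longrightarrow> a i = 0}"
proof (intro equalityI subsetI)
  fix \<mu> assume "\<mu> \<in> dominant_weights D"
  then obtain c where c: "\<mu> = wcomb c" "\<forall>i\<in>{1..r}. 0 \<le> c i"
    by (auto simp: dominant_weights_def nonneg_cone_def wcomb_def rnk)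
  let ?a = "\<lambda>i. if i \<in> {1..r} then nat (c i) else 0"
  have "\<mu> = wcomb (\<lambda>i. int (?a i))"
    unfolding c(1) by (rule eq_wcombI) (use c(2) in \<open>simp_all add: wcomb_dual wcomb_h\<close>)
  then show "\<mu> \<in> (\<lambda>a. wcomb (\<lambda>i. int (a i))) ` {a. \<forall>i. i \<notin> {1..r} \<longrightarrow> a i = 0}"
    by (rule image_eqI[where x = ?a]) simp
qed (auto simp: dominant_weights_def nonneg_cone_def wcomb_def rnk)

lemma wcomb_int_inject:
  "inj_on (\<lambda>a. wcomb (\<lambda>i. int (a i))) {a. \<forall>i. i \<notin> {1..r} \<longrightarrow> a i = 0}"
proof (rule inj_onI, rule ext)
  fix a a' :: "nat \<Rightarrow> nat" and i
  assume a: "a \<in> {a. \<forall>i. i \<notin> {1..r} \<longrightarrow> a i = 0}" "a' \<in> {a. \<forall>i. i \<notin> {1..r} \<longrightarrow> a i = 0}"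
    and eq: "wcomb (\<lambda>i. int (a i)) = wcomb (\<lambda>i. int (a' i))"
  show "a i = a' i"
  proof (cases "i \<in> {1..r}")
    case True
    have "wcomb (\<lambda>i. int (a i)) (h i) = wcomb (\<lambda>i. int (a' i)) (h i)" by (simp only: eq)
    then show ?thesis using True by (simp add: wcomb_h)
  qed (use a in simp)
qed

lemma b_label:
  assumes "e = 0 \<or> e = 1"
  shows "b (wcomb (\<lambda>i. int (a i)) + weyl_vector D) (comb (top_coeff X e)) =
    of_nat (\<Sum>i=1..r. Suc (a i) * label_weight X e i)"
proof -
  have w: "int (label_weight X e i) = top_coeff X e i * root_scale X i" if "i \<in> {1..r}" for i
    using top_coeff_pos[OF that, of e] root_scale_pos[of X i] by (simp add: label_weight_def)
  have "b (wcomb (\<lambda>i. int (a i)) + weyl_vector D) (comb (top_coeff X e)) =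
      of_int (\<Sum>j=1..r. top_coeff X e j * root_scale X j * int (Suc (a j)))"
    unfolding weyl_vector_eq wcomb_add b_wcomb_comb by (simp add: add.commute)
  also have "(\<Sum>j=1..r. top_coeff X e j * root_scale X j * int (Suc (a j))) =
      (\<Sum>j=1..r. int (Suc (a j) * label_weight X e j))"
    by (intro sum.cong) (simp_all only: of_nat_mult w mult.commute)
  finally show ?thesis by (simp only: of_nat_sum[symmetric] of_int_of_nat_eq)
qed

lemma card_simple_labels:
  "card (simple_labels D b l) = card (labels (if lacing X dvd l then 0 else 1) l)"
proof -
  define e :: nat where "e = (if lacing X dvd l then 0 else 1)"
  have "simple_labels D b l = {\<mu> \<in> dominant_weights D. b (\<mu> + weyl_vector D) (comb (top_coeff X e)) < of_nat l}"
    by (simp add: simple_labels_def length_ratio_eq highest_root_eq highest_short_root_eq e_def)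
  also have "\<dots> = (\<lambda>a. wcomb (\<lambda>i. int (a i))) ` {a \<in> {a. \<forall>i. i \<notin> {1..r} \<longrightarrow> a i = 0}.
      b (wcomb (\<lambda>i. int (a i)) + weyl_vector D) (comb (top_coeff X e)) < of_nat l}"
    unfolding dominant_weights_eq by blast
  also have "{a \<in> {a. \<forall>i. i \<notin> {1..r} \<longrightarrow> a i = 0}.
      b (wcomb (\<lambda>i. int (a i)) + weyl_vector D) (comb (top_coeff X e)) < of_nat l} = labels e l"
    unfolding labels_def by (subst b_label) (simp_all only: e_def of_nat_less_iff mem_Collect_eq split: if_splits, simp_all)
  finally have eq: "simple_labels D b l = (\<lambda>a. wcomb (\<lambda>i. int (a i))) ` labels e l" .
  have "labels e l \<subseteq> {a. \<forall>i. i \<notin> {1..r} \<longrightarrow> a i = 0}" unfolding labels_def by blast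
  then show ?thesis unfolding e_def[symmetric] eq
    by (intro card_image inj_on_subset[OF wcomb_int_inject])
qed

lemma labels_eq_bounded_sums:
  assumes e: "e = (if lacing X dvd l then 0 else 1)" and l: "min_level X e \<le> l"
  shows "labels e l = bounded_sums {1..r} (label_weight X e) (l - min_level X e + e)"
proof -
  let ?w = "label_weight X e"
  have m: "(\<Sum>i=1..r. ?w i) + (if e = 0 then lacing X else 2) = min_level X e"
  proof (rule sum_label_weight[OF valid])
    show "e = 0 \<or> 1 < lacing X" using e lacing_pos by (cases "lacing X = 1") auto
  qed
  have "(\<Sum>i=1..r. Suc (a i) * ?w i) < l \<longleftrightarrow> (\<Sum>i=1..r. a i * ?w i) \<le> l - min_level X e + e" for a
  proof (cases "e = 0")
    case False
    then have "e = 1" using e by (simp split: if_splits)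
    \<comment> \<open>The bound is l - 1 minus the sum of the weights, and \<open>min_level\<close>
      exceeds that sum by 2; this accounts for the summand \<open>e\<close>.\<close>
    then show ?thesis using m l by (auto simp: sum.distrib)
  next
    case True
    have dvd: "lacing X dvd l" using e True by (simp split: if_splits)
    have "lacing X dvd (\<Sum>i=1..r. Suc (a i) * ?w i)"
      using lacing_dvd_label_weight[OF valid] True by (intro dvd_sum dvd_mult) blast
    then obtain p where p: "(\<Sum>i=1..r. Suc (a i) * ?w i) = lacing X * p" by (rule dvdE)
    obtain q where q: "l = lacing X * q" using dvd by (rule dvdE)
    \<comment> \<open>Both sides are multiples of m, so being smaller means being smaller by at
      least m.\<close>
    have "(\<Sum>i=1..r. Suc (a i) * ?w i) < l \<longleftrightarrow> lacing X * p + lacing X \<le> lacing X * q"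
    proof -
      have "lacing X * p + lacing X \<le> lacing X * q \<longleftrightarrow> lacing X * Suc p \<le> lacing X * q"
        by (simp add: add.commute)
      also have "\<dots> \<longleftrightarrow> p < q" using lacing_pos by (simp only: mult_le_cancel1 Suc_le_eq) simp
      finally show ?thesis unfolding p q using lacing_pos by simp
    qed
    then show ?thesis using m l True unfolding p[symmetric] q[symmetric] by (auto simp: sum.distrib)
  qed
  then show ?thesis by (simp add: labels_def bounded_sums_def)
qed

lemma rank_series_nth:
  "fps_nth (rank_series X e) n = of_nat (card (bounded_sums {1..r} (label_weight X e) n))"
proof -
  have "rank_series X e = 1 / (1 - fps_X) * (\<Prod>i\<in>{1..r}. 1 / (1 - fps_X ^ label_weight X e i))"
    unfolding rank_series_def image_mset_label_weight[OF valid, symmetric]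
    by (simp add: prod_unfold_prod_mset image_mset.compositionality comp_def)
  then show ?thesis
    using card_bounded_sums_coefficient[of "{1..r}" "label_weight X e" n] label_weight_pos by simp
qed

end

theorem theorem3p2:
  fixes D :: "'g::complex_lie_algebra root_frame"
    and X :: lie_type
    and b :: "'g weight_form"
    and l l\<^sub>m :: nat
  assumes "simple_lie_algebra TYPE('g)"
    and "simple_root_frame D"
    and "valid_type X" and "has_type D X"
    and "normalized_form D b"
    and "0 < l"
    and "l\<^sub>m = (if length_ratio D b dvd l then 0 else 1)"
    and "min_level X l\<^sub>m \<le> l"
  shows "of_nat (card (simple_labels D b l))
           = fps_nth (rank_series X l\<^sub>m) (l - min_level X l\<^sub>m + l\<^sub>m)"
proof -
  interpret normalized_frame D X b
    using assms by unfold_locales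
  have e: "l\<^sub>m = (if lacing X dvd l then 0 else 1)" using assms(7) by (simp add: length_ratio_eq)
  show ?thesis
    unfolding rank_series_nth card_simple_labels e[symmetric] labels_eq_bounded_sums[OF e assms(8)] ..
qed

end
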